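(* Let $\mathbb{G}=\mathbb{R}^q\times\mathbb{R}^m$ be a step-two group with Carnot--Carath\'eodory distance $d(g)$ from $g$ to the identity, and let $\Omega_*^{(k)}$, $\phi_k$, $\phi_k^*$, $\Phi_k$ ($k\in\mathbb{N}=\{0,1,2,\dots\}$) be as defined in the context. Let $k\in\mathbb{N}$ and $g=(x,t)\in\mathbb{G}$. Then: (P4') $d(g)^2\ge \Phi_k(g)$. (P6'a) If $\phi_k(g;\cdot,\cdot)$ attains its minimax, namely if there exists $(\mathbf{s}^*,\theta^* )\in(\mathbb{R}^q)^k\times\Omega_*^{(k)}$ such that $\Phi_k(g)=\phi_k^*(g;\mathbf{s}^* )=\phi_k(g;\mathbf{s}^*,\theta^* )$ (for $k=0$: if there exists $\theta^*\in\Omega_*^{(0)}$ such that $\Phi_0(g)=\phi_0(g;\theta^* )$), then $d(g)^2=\Phi_k(g)$. (P6'b) $\Phi_k(g)\le\Phi_{k+1}(g)$. (P6'c) If $\Phi_k(g)=\Phi_{k+1}(g)$, then there exists $(\mathbf{s}^*,\mathbf{s}^*_{k+1},\theta^* )\in(\mathbb{R}^q)^{k+1}\times\overline{\Omega_*^{(k)}}$ such that $\Phi_{k+1}(g)=\phi_{k+1}^*(g;\mathbf{s}^*,\mathbf{s}^*_{k+1})=\phi_{k+1}(g;\mathbf{s}^*,\mathbf{s}^*_{k+1},\theta^* )$, and in particular $d(g)^2=\Phi_k(g)=\Phi_{k+1}(g)$.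
   Context: **Step-two group.** Let $q,m\in\{1,2,\dots\}$ and let $\mathbb{U}=\{U^{(1)},\dots,U^{(m)}\}$ be linearly independent real skew-symmetric $q\times q$ matrices. For $x,x'\in\mathbb{R}^q$ put $\langle\mathbb{U}x,x'\rangle=(\langle U^{(1)}x,x'\rangle,\dots,\langle U^{(m)}x,x'\rangle)\in\mathbb{R}^m$. The step-two group $\mathbb{G}$ is $\mathbb{R}^q\times\mathbb{R}^m$ with the law $(x,t)\cdot(x',t')=(x+x',\,t+t'+\tfrac12\langle\mathbb{U}x,x'\rangle)$ and identity $o=(0,0)$. Let $X_l(g)=\frac{\partial}{\partial x_l}+\frac12\sum_{j=1}^m\big(\sum_{i=1}^q U^{(j)}_{l,i}x_i\big)\frac{\partial}{\partial t_j}$, $1\le l\le q$. The Carnot--Carath\'eodory distance is associated with the sub-Riemannian structure for which $X_1,\dots,X_q$ are orthonormal: it is the infimum of $\int_0^1|u(r)|\,dr$ over absolutely continuous curves $\gamma$ on $[0,1]$ joining the two points with $\dot\gamma=\sum_l u_l X_l(\gamma)$ a.e.; $d(g)$ is the distance from $g$ to $o$. **Matrices.** For $\lambda\in\mathbb{R}^m$ (or $\mathbb{C}^m$, by linearity), $\widetilde U(\lambda)=\sum_{j=1}^m\lambda_jU^{(j)}$ and $U(\lambda)=i\,\widetilde U(\lambda)$. For $\tau\in\mathbb{R}^m$, $U(\tau)$ is Hermitian, and $U(i\tau)=iU(\tau)$. Functions of these matrices are defined by functional calculus; $\|\cdot\|$ is the operator norm on $\mathbb{C}^q$. **Bessel-related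 functions.** For $k\in\mathbb{N}$, $0<\mathcal{Z}_{k,1}<\mathcal{Z}_{k,2}<\cdots$ are the positive zeros of the Bessel function $J_{k+1/2}$ (so $\mathcal{Z}_{0,1}=\pi$), and $\mathrm{R}_k(z)=2\sum_{l=1}^{\infty}\frac{z^2}{\mathcal{Z}_{k,l}^2+z^2}$ for $z\in\mathbb{C}\setminus\{\pm i\mathcal{Z}_{k,l}\}$. **Reference sets and functions.** For $k\in\mathbb{N}$, $\Omega_*^{(k)}=\{\tau\in\mathbb{R}^m:\|U(\tau)\|<\mathcal{Z}_{k,1}\}$; in particular $\Omega_*^{(0)}=\{\tau:\|U(\tau)\|<\pi\}$. Set $\phi_0(g;\tau)=\langle U(\tau)\cot U(\tau)\,x,x\rangle+4\,t\cdot\tau$ for $g=(x,t)$, $\tau\in\Omega_*^{(0)}$. For $k\ge1$, write $\mathbf{s}=(\mathbf{s}_1,\dots,\mathbf{s}_k)\in(\mathbb{R}^q)^k$ and, for $\tau\in\Omega_*^{(k)}$, $$\phi_k(g;\mathbf{s},\tau)=|x|^2+\sum_{j=1}^k2(2j+1)|\mathbf{s}_j|^2+2\langle\mathrm{R}_k(U(i\tau))\mathbf{s}_k,\mathbf{s}_k\rangle+4\Big(t+\tfrac1{\sqrt2}\langle\mathbb{U}x,\mathbf{s}_1\rangle+\sum_{j=2}^k\langle\mathbb{U}\mathbf{s}_{j-1},\mathbf{s}_j\rangle\Big)\cdot\tau .$$ Finally $\Phi_0(g)=\phi_0^*(g)=\sup_{\tau\in\Omega_*^{(0)}}\phi_0(g;\tau)$,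 and for $k\ge1$, $\phi_k^*(g;\mathbf{s})=\sup_{\tau\in\Omega_*^{(k)}}\phi_k(g;\mathbf{s},\tau)$ and $\Phi_k(g)=\inf_{\mathbf{s}\in(\mathbb{R}^q)^k}\phi_k^*(g;\mathbf{s})$. Elements of $(\mathbb{R}^q)^{k+1}=(\mathbb{R}^q)^k\times\mathbb{R}^q$ are written $(\mathbf{s},\mathbf{s}_{k+1})$; for $k=0$ the component $\mathbf{s}$ is absent. *)

theory Defs
  imports "HOL-Analysis.Analysis"
begin

section \<open>Step-two groups\<close>

definition step_two_data :: "('m::finite \<Rightarrow> real^'q^'q) \<Rightarrow> bool" where
  "step_two_data U \<longleftrightarrow>
     (\<forall>j. transpose (U j) = - U j) \<and> inj U \<and> independent (range U)"

definition U_pair :: "('m::finite \<Rightarrow> real^'q^'q) \<Rightarrow> real^'q \<Rightarrow> real^'q \<Rightarrow> real^'m" where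
  "U_pair U x y = (\<chi> j. (U j *v x) \<bullet> y)"

type_synonym ('q, 'm) grp = "(real^'q) \<times> (real^'m)"

text \<open>The identity element is \<^term>\<open>0 :: ('q::finite, 'm::finite) grp\<close>.\<close>

definition grp_mult ::
  "('m::finite \<Rightarrow> real^'q^'q) \<Rightarrow> ('q::finite, 'm) grp \<Rightarrow> ('q, 'm) grp \<Rightarrow> ('q, 'm) grp" where
  "grp_mult U g h =
     (fst g + fst h, snd g + snd h + (1/2) *\<^sub>R U_pair U (fst g) (fst h))"

definition hfield :: "('m::finite \<Rightarrow> real^'q^'q) \<Rightarrow> 'q::finite \<Rightarrow> ('q, 'm) grp \<Rightarrow> ('q, 'm) grp" where
  "hfield U l g =
     (axis l 1, \<chi> j. (1/2) * (\<Sum>i\<in>UNIV. U j $ l $ i * fst g $ i))"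

lemma hfield_left_invariant:
  "((\<lambda>r. grp_mult U g (r *\<^sub>R axis l 1, 0)) has_vector_derivative hfield U l g) (at 0)"
proof -
  have "grp_mult U g (r *\<^sub>R axis l 1, 0) = g + r *\<^sub>R hfield U l g" for r
    by (simp add: grp_mult_def hfield_def U_pair_def prod_eq_iff vec_eq_iff
        inner_axis matrix_vector_mult_def)
  then show ?thesis
    by (auto intro!: derivative_eq_intros)
qed


section \<open>The Carnot--Caratheodory distance\<close>

definition abs_cont_on :: "(real \<Rightarrow> 'a::real_normed_vector) \<Rightarrow> real set \<Rightarrow> bool" where
  "abs_cont_on f S \<longleftrightarrow>
     (\<forall>\<epsilon>>0. \<exists>\<delta>>0. \<forall>D. D division_of \<Union>D \<and> \<Union>D \<subseteq> S \<and> (\<Sum>K\<in>D. measure lborel K) < \<delta> \<longrightarrow>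
        (\<Sum>K\<in>D. norm (f (Sup K) - f (Inf K))) < \<epsilon>)"

text \<open>
  The integrability of the control \<open>u\<close> is automatic: by the form of the fields it
  agrees almost everywhere with the derivative of the \<open>x\<close>-component of an absolutely continuous
  curve. It is listed because the integral of a non-integrable function is \<open>0\<close> by convention.
\<close>
definition horizontal_curve ::
  "('m::finite \<Rightarrow> real^'q^'q) \<Rightarrow> (real \<Rightarrow> ('q::finite, 'm) grp) \<Rightarrow> (real \<Rightarrow> real^'q) \<Rightarrow> bool" where
  "horizontal_curve U \<gamma> u \<longleftrightarrow>
     abs_cont_on \<gamma> {0..1} \<and> u absolutely_integrable_on {0..1} \<and>
     (AE r in lebesgue_on {0..1}.
        (\<gamma> has_vector_derivative (\<Sum>l\<in>UNIV. (u r $ l) *\<^sub>R hfield U l (\<gamma> r))) (at r within {0..1}))"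

definition cc_dist :: "('m::finite \<Rightarrow> real^'q^'q) \<Rightarrow> ('q::finite, 'm) grp \<Rightarrow> ('q, 'm) grp \<Rightarrow> real" where
  "cc_dist U g h =
     Inf {integral {0..1} (\<lambda>r. norm (u r)) |\<gamma> u. horizontal_curve U \<gamma> u \<and> \<gamma> 0 = g \<and> \<gamma> 1 = h}"

definition cc_norm :: "('m::finite \<Rightarrow> real^'q^'q) \<Rightarrow> ('q::finite, 'm) grp \<Rightarrow> real" where
  "cc_norm U g = cc_dist U g 0"


section \<open>Matrices and functional calculus\<close>

definition cvec :: "real^'n \<Rightarrow> complex^'n" where
  "cvec x = (\<chi> i. complex_of_real (x $ i))"

definition U_tilde :: "('m::finite \<Rightarrow> real^'q^'q) \<Rightarrow> complex^'m \<Rightarrow> complex^'q^'q" where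
  "U_tilde U z = (\<chi> a b. \<Sum>j\<in>UNIV. z $ j * complex_of_real (U j $ a $ b))"

definition U_mat :: "('m::finite \<Rightarrow> real^'q^'q) \<Rightarrow> complex^'m \<Rightarrow> complex^'q^'q" where
  "U_mat U z = (\<chi> a b. \<i> * U_tilde U z $ a $ b)"

definition op_norm :: "complex^'n^'n \<Rightarrow> real" where
  "op_norm A = onorm (\<lambda>v. A *v v)"

definition eigenspace :: "complex^'n^'n \<Rightarrow> complex \<Rightarrow> (complex^'n) set" where
  "eigenspace A \<mu> = {v. A *v v = \<mu> *s v}"

definition eigenvalues :: "complex^'n^'n \<Rightarrow> complex set" where
  "eigenvalues A = {\<mu>. \<exists>v\<in>eigenspace A \<mu>. v \<noteq> 0}"

text \<open>
  Functional calculus of a normal matrix \<open>A\<close> by its spectral resolution: \<open>f(A)\<close> is the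
  sum of \<open>f(\<mu>) P\<^sub>\<mu>\<close> over the eigenvalues, where \<open>P\<^sub>\<mu>\<close> is the orthogonal
  projection onto the eigenspace of \<open>\<mu>\<close>. The projection onto a subspace is
  \<^const>\<open>closest_point\<close>.
\<close>
definition fun_calc :: "(complex \<Rightarrow> complex) \<Rightarrow> complex^'n^'n \<Rightarrow> complex^'n \<Rightarrow> complex^'n" where
  "fun_calc f A v = (\<Sum>\<mu>\<in>eigenvalues A. f \<mu> *s closest_point (eigenspace A \<mu>) v)"

text \<open>
  \<open>\<langle>f(A)x, x\<rangle>\<close> for real \<open>x\<close>. The inner product of \<^typ>\<open>complex^'n\<close> in the library is
  the real part of the Hermitian one; the two agree here whenever \<open>f(A)\<close> is Hermitian.
\<close>
definition fun_calc_form :: "(complex \<Rightarrow> complex) \<Rightarrow> complex^'n^'n \<Rightarrow> real^'n \<Rightarrow> real" where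
  "fun_calc_form f A x = fun_calc f A (cvec x) \<bullet> cvec x"

definition z_cot :: "complex \<Rightarrow> complex" where
  "z_cot z = (if z = 0 then 1 else z * cot z)"


section \<open>Bessel functions\<close>

text \<open>The Bessel function of the first kind of real order \<open>\<nu>\<close> on the positive half-line.\<close>
definition bessel_J :: "real \<Rightarrow> real \<Rightarrow> real" where
  "bessel_J \<nu> x =
     (\<Sum>n. (-1) ^ n / (fact n * Gamma (real n + \<nu> + 1)) * (x / 2) powr (2 * real n + \<nu>))"

text \<open>
  \<open>bessel_zero k l\<close> is the \<open>l\<close>-th positive zero of \<open>bessel_J (k + 1/2)\<close> for
  \<open>l \<ge> 1\<close>; the value \<open>0\<close> at \<open>l = 0\<close> only starts the enumeration.
\<close>
primrec bessel_zero :: "nat \<Rightarrow> nat \<Rightarrow> real" where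
  "bessel_zero k 0 = 0"
| "bessel_zero k (Suc l) = Inf {x. x > bessel_zero k l \<and> bessel_J (real k + 1/2) x = 0}"

lemma bessel_J_half:
  assumes "x > 0"
  shows "bessel_J (1/2) x = sqrt (2 / (pi * x)) * sin x"
proof -
  have pos: "y \<notin> \<int>\<^sub>\<le>\<^sub>0" if "y > 0" for y :: real
    using that by (auto elim!: nonpos_Ints_cases)
  have G: "fact n * Gamma (real n + 1/2 + 1) = sqrt pi * fact (2*n+1) / 2^(2*n+1)" for n
  proof (induction n)
    case 0 show ?case using Gamma_plus1[OF pos, of "1/2"]
      by (simp add: Gamma_one_half_real)
  next
    case (Suc n)
    have "Gamma (real (Suc n) + 1/2 + 1) = (real n + 3/2) * Gamma (real n + 1/2 + 1)"
      using Gamma_plus1[OF pos, of "real n + 3/2"] by (simp add: add_ac)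
    then have "fact (Suc n) * Gamma (real (Suc n) + 1/2 + 1) =
      (real n + 1) * (real n + 3/2) * (fact n * Gamma (real n + 1/2 + 1))"
      by (simp add: algebra_simps)
    then show ?case unfolding Suc by (simp add: field_simps)
  qed
  have t: "(-1) ^ n / (fact n * Gamma (real n + 1/2 + 1)) * (x / 2) powr (2 * real n + 1/2)
     = sqrt (2 / (pi * x)) * ((-1)^n / fact (2*n+1) * x^(2*n+1))" for n
  proof -
    have p: "(x / 2) powr (2 * real n + 1/2) = (x/2)^(2*n) * sqrt (x/2)"
      using assms powr_realpow[of "x/2" "2*n"] by (simp add: powr_add powr_half_sqrt)
    have "sqrt (x/2) * sqrt (x/2) = x/2" using assms by simp
    then have c: "sqrt (x/2) * 2 / sqrt pi = sqrt (2 / (pi * x)) * x"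
      using assms by (simp add: real_sqrt_divide real_sqrt_mult field_simps)
    have "(a::real) / (b * f / (2 * w)) * (y / w * z) = a / f * y * (z * 2 / b)"
      if "w \<noteq> 0" for a b f w y z
      using that by (simp add: divide_simps)
    from this[of "2^(2*n)"]
    have "(-1) ^ n / (sqrt pi * fact (2*n+1) / 2^(2*n+1)) * ((x/2)^(2*n) * sqrt (x/2))
        = (-1) ^ n / fact (2*n+1) * x^(2*n) * (sqrt (x/2) * 2 / sqrt pi)"
      by (simp only: power_add power_divide power_one_right mult.commute[of _ 2]) simp
    also have "\<dots> = sqrt (2 / (pi * x)) * ((-1)^n / fact (2*n+1) * x^(2*n+1))"
      unfolding c by (simp del: fact_Suc)
    finally show ?thesis unfolding G p .
  qed
  have "(\<lambda>n. (-1)^n / fact (2*n+1) * x^(2*n+1)) sums sin x"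
    using sin_paired[of x] by simp
  from sums_unique[OF sums_mult[OF this, of "sqrt (2 / (pi * x))"]]
  show ?thesis unfolding bessel_J_def t by (rule sym)
qed

lemma bessel_zero_0_1: "bessel_zero 0 1 = pi"
proof -
  have e: "{x. x > 0 \<and> bessel_J (1/2) x = 0} = {x. x > 0 \<and> sin x = 0}"
    using bessel_J_half by auto
  have "Inf {x. x > 0 \<and> sin x = 0} = pi"
  proof (rule cInf_eq_minimum)
    show "pi \<le> y" if "y \<in> {x. x > 0 \<and> sin x = 0}" for y
      using that sin_gt_zero[of y] by fastforce
  qed simp
  then show ?thesis using e by simp
qed

definition R_fun :: "nat \<Rightarrow> complex \<Rightarrow> complex" where
  "R_fun k z = 2 * (\<Sum>l. z\<^sup>2 / ((complex_of_real (bessel_zero k (Suc l)))\<^sup>2 + z\<^sup>2))"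


section \<open>Reference sets and functions\<close>

definition Omega :: "('m::finite \<Rightarrow> real^'q^'q) \<Rightarrow> nat \<Rightarrow> (real^'m) set" where
  "Omega U k = {\<tau>. op_norm (U_mat U (cvec \<tau>)) < bessel_zero k 1}"

text \<open>
  An element \<open>(s\<^sub>1,\<dots>,s\<^sub>k)\<close> of the \<open>k\<close>-fold power of \<^typ>\<open>real^'q\<close> is an extensional
  function on \<open>{1..k}\<close>. For \<open>k = 0\<close> this is a single point, so that the infimum over it in
  \<open>Phi\<close> below is vacuous.
\<close>
definition tuples :: "nat \<Rightarrow> (nat \<Rightarrow> real^'q) set" where
  "tuples k = {1..k} \<rightarrow>\<^sub>E UNIV"

definition phi ::
  "('m::finite \<Rightarrow> real^'q^'q) \<Rightarrow> nat \<Rightarrow> ('q::finite, 'm) grp \<Rightarrow> (nat \<Rightarrow> real^'q) \<Rightarrow> real^'m \<Rightarrow> real" where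
  "phi U k g s \<tau> = (let x = fst g; t = snd g in
     if k = 0 then fun_calc_form z_cot (U_mat U (cvec \<tau>)) x + 4 * (t \<bullet> \<tau>)
     else (norm x)\<^sup>2 + (\<Sum>j=1..k. 2 * (2 * real j + 1) * (norm (s j))\<^sup>2)
        + 2 * fun_calc_form (R_fun k) (U_mat U (\<i> *s cvec \<tau>)) (s k)
        + 4 * ((t + (1 / sqrt 2) *\<^sub>R U_pair U x (s 1)
                  + (\<Sum>j=2..k. U_pair U (s (j - 1)) (s j))) \<bullet> \<tau>))"

text \<open>
  For \<^const>\<open>step_two_data\<close> the set \<^const>\<open>Omega\<close> is bounded and contains \<open>0\<close>, and the quadratic
  forms in \<^const>\<open>phi\<close> are bounded above on it, so the supremum is finite; it is at least
  \<open>phi U k g s 0 \<ge> 0\<close>, so the infimum is finite as well.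
\<close>
definition phi_star ::
  "('m::finite \<Rightarrow> real^'q^'q) \<Rightarrow> nat \<Rightarrow> ('q::finite, 'm) grp \<Rightarrow> (nat \<Rightarrow> real^'q) \<Rightarrow> real" where
  "phi_star U k g s = (SUP \<tau>\<in>Omega U k. phi U k g s \<tau>)"

definition Phi :: "('m::finite \<Rightarrow> real^'q^'q) \<Rightarrow> nat \<Rightarrow> ('q::finite, 'm) grp \<Rightarrow> real" where
  "Phi U k g = (INF s\<in>tuples k. phi_star U k g s)"

end

theory Submission
  imports Defs "HOL-Complex_Analysis.Complex_Analysis"
begin

text \<open>
  Expand the velocity of the horizontal part of a curve in shifted Legendre polynomials. With
  coefficients proportional to \<open>\<sigma>\<^sub>0, \<sigma>\<^sub>1, \<dots>\<close> and \<open>\<sigma>\<^sub>0 = x / sqrt 2\<close>, the energy becomes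
  \<open>\<Sum>\<^sub>j 2 (2 j + 1) |\<sigma>\<^sub>j|\<^sup>2\<close> and the end point condition becomes the tridiagonal constraint
  \<open>t + \<Sum>\<^sub>j \<langle>U \<sigma>\<^sub>j, \<sigma>\<^sub>j\<^sub>+\<^sub>1\<rangle> = 0\<close>, so that \<open>d(g)\<^sup>2\<close> is the infimum of the energy under this constraint. In the
  Lagrange function with multiplier \<open>\<tau>\<close>, minimising over all \<open>\<sigma>\<^sub>j\<close> with \<open>j > k\<close> is the continued fraction
  \<open>R\<^sub>k(w) (2 k + 3 + R\<^sub>k\<^sub>+\<^sub>1(w)) = - w\<close> of the Bessel quotient, in which \<open>w\<close> runs through the eigenvalues of
  \<open>U(\<tau>)\<^sup>2\<close>; what remains is \<open>\<phi>\<^sub>k\<close>. Weak duality gives \<open>\<Phi>\<^sub>k \<le> \<Phi>\<^sub>k\<^sub>+\<^sub>1\<close> and \<open>\<Phi>\<^sub>k \<le> d\<^sup>2\<close>.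

  If the minimax is attained at an interior \<open>\<theta>\<close>, strict convexity in the next variable shows that the
  extended sequence is again a minimax with the same value. For arbitrarily long sequences obtained this
  way, some term \<open>\<sigma>\<^sub>j\<close> satisfies \<open>j |\<sigma>\<^sub>j|\<^sup>2 \<rightarrow> 0\<close>, and maximality at \<open>\<theta>\<close> bounds the violation of the constraint
  at level \<open>j\<close> by \<open>C |\<sigma>\<^sub>j|\<^sup>2\<close>. A violation \<open>v\<close> is repaired by finitely many further terms at a cost
  \<open>O(j |v|)\<close>, which tends to \<open>0\<close>. If \<open>\<Phi>\<^sub>k = \<Phi>\<^sub>k\<^sub>+\<^sub>1\<close>, a minimiser of \<open>\<phi>\<^sub>k\<^sub>+\<^sub>1\<^sup>*\<close> attains the supremum on
  the compact closure of the smaller set, which lies inside the larger one.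
\<close>

section \<open>Bessel functions of half-integer order\<close>

text \<open>\<open>R_fun\<close> is a series over zeros that are themselves defined by successive
  infima, so little can be said about it before the partial fraction expansion of the Bessel
  quotient is available. That expansion comes by induction on k from the sine product: in the
  variable w = x^2 the function \<open>bes k\<close>, which is the hypergeometric series 0F1(; k +
  3/2; - w / 4), has a derivative proportional to \<open>bes (Suc k)\<close>, and its product has
  genus zero.

  The weights 2 (2 j + 1) act twice in the final estimate: they make a repair after index j
  expensive, and they make the energy bound force j |sigma_j|^2 to be small for some j.

  The control of a horizontal curve is only integrable, so its Legendre expansion carries no energy
  bound. For the lower bound on the distance the path is run at nearly constant speed and replaced
  by Bernstein polynomials, which respect the speed bound and whose velocities are finite Legendre
  sums. Only the end point condition is violated slightly, and \<open>Phi\<close> is Lipschitz in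
  t.\<close>

definition bes_coeff :: "nat \<Rightarrow> nat \<Rightarrow> real" where
  "bes_coeff k n = (-1) ^ n / (4 ^ n * fact n * pochhammer (real k + 3/2) n)"

text \<open>\<open>bes k (x\<^sup>2)\<close> is \<open>J\<^sub>k\<^sub>+\<^sub>1\<^sub>/\<^sub>2(x)\<close> divided by the leading term of its power series.\<close>
definition bes :: "nat \<Rightarrow> 'a::{real_normed_field,banach} \<Rightarrow> 'a" where
  "bes k w = (\<Sum>n. of_real (bes_coeff k n) * w ^ n)"

lemma pochhammer_ge_1: "(1::real) \<le> a \<Longrightarrow> 1 \<le> pochhammer a n"
  by (induction n) (auto simp: pochhammer_Suc intro: order_trans[OF _ mult_mono[of 1 _ 1]])

lemma bes_coeff_bound: "\<bar>bes_coeff k n\<bar> \<le> inverse (fact n)"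
proof -
  have "(1::real) \<le> 4 ^ n * pochhammer (real k + 3/2) n"
    by (rule order_trans[OF _ mult_mono[of 1 _ 1]]) (auto intro!: pochhammer_ge_1)
  then have "fact n * 1 \<le> fact n * (4 ^ n * pochhammer (real k + 3/2) n)"
    by (intro mult_left_mono) auto
  moreover have "0 \<le> pochhammer (real k + 3/2) n"
    using pochhammer_ge_1[of "real k + 3/2" n] by linarith
  ultimately show ?thesis
    by (simp add: bes_coeff_def abs_mult power_abs divide_simps mult.assoc mult.left_commute)
qed

lemma summable_bes:
  fixes w :: "'a::{real_normed_field,banach}"
  shows "summable (\<lambda>n. of_real (bes_coeff k n) * w ^ n)"
proof (rule summable_comparison_test'[OF summable_exp[of "norm w"]])
  fix n :: nat
  show "norm (of_real (bes_coeff k n) * w ^ n) \<le> inverse (fact n) * norm w ^ n"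
    using bes_coeff_bound[of k n] by (simp add: norm_mult norm_power mult_right_mono)
qed

lemma bes_0 [simp]: "bes k 0 = 1"
  unfolding bes_def by (subst powser_zero) (simp add: bes_coeff_def)

lemma diffs_bes_coeff:
  "real (Suc n) * bes_coeff k (Suc n) = - 1 / (2 * (2 * real k + 3)) * bes_coeff (Suc k) n"
proof -
  have 1: "pochhammer (real k + 3/2) (Suc n) = (real k + 3/2) * pochhammer (real (Suc k) + 3/2) n"
    by (simp add: pochhammer_rec add_ac)
  have "pochhammer (real (Suc k) + 3/2) n \<noteq> 0"
    using pochhammer_ge_1[of "real (Suc k) + 3/2" n] by linarith
  moreover have "(real k + 3/2) \<noteq> 0" "2 * real k + 3 \<noteq> 0" by linarith+
  ultimately show ?thesis
    unfolding bes_coeff_def 1 fact_Suc by (simp add: divide_simps del: of_nat_Suc)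
qed

lemma bes_deriv:
  fixes w :: "'a::{real_normed_field,banach}"
  shows "(bes k has_field_derivative of_real (- 1 / (2 * (2 * real k + 3))) * bes (Suc k) w) (at w)"
proof -
  have "((\<lambda>w. \<Sum>n. of_real (bes_coeff k n) * w ^ n) has_field_derivative
      (\<Sum>n. diffs (\<lambda>n. of_real (bes_coeff k n)) n * w ^ n)) (at w)"
    by (rule termdiffs_strong_converges_everywhere) (rule summable_bes)
  moreover have "diffs (\<lambda>n. of_real (bes_coeff k n)) n * w ^ n
     = of_real (- 1 / (2 * (2 * real k + 3))) * (of_real (bes_coeff (Suc k) n) * w ^ n)" for n
    unfolding diffs_def using arg_cong[OF diffs_bes_coeff[of n k], of "of_real :: real \<Rightarrow> 'a"]
    unfolding of_real_mult by (simp only: of_real_of_nat_eq mult.assoc[symmetric])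
  ultimately show ?thesis
    unfolding bes_def[abs_def] using suminf_mult[OF summable_bes[of "Suc k" w], of "of_real (- 1 / (2 * (2 * real k + 3)))"]
    by simp
qed

text \<open>Bessel's recurrence J_(nu-1) + J_(nu+1) = (2 nu / x) J_nu at nu = k + 3/2, in the
  normalisation with constant term 1.\<close>

lemma bes_rec:
  fixes w :: "'a::{real_normed_field,banach}"
  shows "bes k w = bes (Suc k) w - of_real (1 / ((2 * real k + 3) * (2 * real k + 5))) * w * bes (Suc (Suc k)) w"
proof -
  have c: "bes_coeff k (Suc n) = bes_coeff (Suc k) (Suc n)
       - bes_coeff (Suc (Suc k)) n * (1 / ((2 * real k + 3) * (2 * real k + 5)))" for n
  proof -
    define a where "a = real k + 3/2"
    define p where "p = pochhammer (a + 2) n"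
    have p: "p > 0" using pochhammer_ge_1[of "a+2" n] by (simp add: p_def a_def)
    have a: "a > 0" by (simp add: a_def)
    have 2: "pochhammer (a + 1) (Suc n) = (a + 1) * p"
      by (simp add: pochhammer_rec p_def add_ac)
    have 3: "pochhammer (a + 1) (Suc n) = pochhammer (a+1) n * (a + 1 + n)"
      by (simp add: pochhammer_Suc)
    have 1: "pochhammer a (Suc n) = a * pochhammer (a+1) n"
      by (simp add: pochhammer_rec)
    have 4: "pochhammer a (Suc n) = a * (a + 1) * p / (a + 1 + n)"
    proof -
      have "pochhammer (a+1) n = (a + 1) * p / (a + 1 + n)"
        using 2 3 a by (simp add: eq_divide_eq)
      then show ?thesis using 1 by simp
    qed
    have "1 / pochhammer a (Suc n) = 1 / pochhammer (a + 1) (Suc n) + (real n + 1) / (a * (a + 1) * p)"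
      unfolding 2 4 using a p by (simp add: divide_simps)
    then have "(-1) ^ Suc n / (4 ^ Suc n * fact (Suc n)) * (1 / pochhammer a (Suc n))
       = (-1) ^ Suc n / (4 ^ Suc n * fact (Suc n)) * (1 / pochhammer (a + 1) (Suc n) + (real n + 1) / (a * (a + 1) * p))"
      by simp
    moreover have "(-1) ^ Suc n / (4 ^ Suc n * fact (Suc n)) * ((real n + 1) / (a * (a + 1) * p))
       = - ((-1) ^ n / (4 ^ n * fact n * p) * (1 / ((2 * a) * (2 * a + 2))))"
      using a p by (simp add: divide_simps) (simp add: algebra_simps)
    ultimately have "(-1) ^ Suc n / (4 ^ Suc n * fact (Suc n)) * (1 / pochhammer a (Suc n))
       = (-1) ^ Suc n / (4 ^ Suc n * fact (Suc n)) * (1 / pochhammer (a + 1) (Suc n))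
         - (-1) ^ n / (4 ^ n * fact n * p) * (1 / ((2 * a) * (2 * a + 2)))"
      by (simp only: distrib_left)
    moreover have "2 * real k + 3 = 2 * a" "2 * real k + 5 = 2 * a + 2" "real k + 3/2 = a"
      "real (Suc k) + 3/2 = a + 1" "real (Suc (Suc k)) + 3/2 = a + 2" by (simp_all add: a_def)
    ultimately show ?thesis
      unfolding bes_coeff_def p_def by (simp only: divide_divide_eq_left times_divide_eq_right mult_1_right)
  qed
  let ?e = "of_real (1 / ((2 * real k + 3) * (2 * real k + 5))) :: 'a"
  have s: "(\<lambda>n. of_real (bes_coeff k (Suc n)) * w ^ Suc n) sums (bes k w - 1)" for k
    using summable_sums[OF summable_bes[of k w]] sums_Suc_iff[of "\<lambda>n. of_real (bes_coeff k n) * w ^ n" "bes k w - 1"]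
    by (simp add: bes_def bes_coeff_def)
  have "(\<lambda>n. of_real (bes_coeff (Suc k) (Suc n)) * w ^ Suc n
          - ?e * w * (of_real (bes_coeff (Suc (Suc k)) n) * w ^ n))
     sums ((bes (Suc k) w - 1) - ?e * w * bes (Suc (Suc k)) w)"
    by (intro sums_diff s sums_mult) (simp add: bes_def summable_sums summable_bes)
  moreover have "of_real (bes_coeff k (Suc n)) * w ^ Suc n = of_real (bes_coeff (Suc k) (Suc n)) * w ^ Suc n
          - ?e * w * (of_real (bes_coeff (Suc (Suc k)) n) * w ^ n)" for n
    unfolding c of_real_diff of_real_mult by (simp add: algebra_simps)
  ultimately have "bes k w - 1 = (bes (Suc k) w - 1) - ?e * w * bes (Suc (Suc k)) w"
    using s[of k] by (simp add: sums_unique2)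
  then show ?thesis by (simp add: algebra_simps)
qed

lemma bes_0_coeff: "bes_coeff 0 n = (-1) ^ n / fact (2 * n + 1)"
proof -
  have "4 ^ n * fact n * pochhammer (3/2) n = (fact (2 * n + 1) :: real)"
  proof (induction n)
    case (Suc n)
    have "4 ^ Suc n * fact (Suc n) * pochhammer (3/2) (Suc n)
      = (4 ^ n * fact n * pochhammer (3/2) n) * (4 * real (Suc n) * (3/2 + real n))"
      by (simp add: pochhammer_Suc del: of_nat_Suc)
    also have "\<dots> = (fact (2 * Suc n + 1) :: real)"
      unfolding Suc by (simp add: algebra_simps)
    finally show ?case .
  qed simp
  then show ?thesis by (simp add: bes_coeff_def)
qed

lemma bes_0_sin:
  fixes x :: complex
  shows "x * bes 0 (x\<^sup>2) = sin x"
proof -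
  have "(\<lambda>n. x * (of_real (bes_coeff 0 n) * (x\<^sup>2) ^ n)) sums (x * bes 0 (x\<^sup>2))"
    unfolding bes_def by (intro sums_mult summable_sums summable_bes)
  moreover have "(\<lambda>n. x * (of_real (bes_coeff 0 n) * (x\<^sup>2) ^ n)) = (\<lambda>n. of_real (sin_coeff (2*n+1)) * x ^ (2*n+1))"
    by (rule ext) (simp add: bes_0_coeff sin_coeff_def power_mult del: fact_Suc)
  moreover have "(\<lambda>n. of_real (sin_coeff n) * x ^ n) sums sin x"
    using sin_converges[of x] by (simp add: scaleR_conv_of_real)
  then have "(\<lambda>n. of_real (sin_coeff (2*n+1)) * x ^ (2*n+1)) sums sin x"
    by (subst sums_mono_reindex[where g="\<lambda>n. 2*n+1"])
       (auto simp: strict_mono_def sin_coeff_def image_iff elim!: oddE)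
  ultimately show ?thesis by (metis sums_unique2)
qed

lemma bes_of_real: "bes k (of_real w :: 'a::{real_normed_field,banach}) = of_real (bes k w)"
proof -
  have "(\<lambda>n. of_real (bes_coeff k n * w ^ n) :: 'a) sums of_real (bes k w)"
    using summable_sums[OF summable_bes[of k w]] by (intro sums_of_real) (simp add: bes_def)
  from sums_unique[OF this] show ?thesis by (simp add: bes_def)
qed

lemma bessel_J_bes:
  assumes "x > 0"
  shows "bessel_J (real k + 1/2) x = (x/2) powr (real k + 1/2) / Gamma (real k + 3/2) * bes k (x\<^sup>2)"
proof -
  have pos: "real k + 3/2 \<notin> \<int>\<^sub>\<le>\<^sub>0" by (auto elim!: nonpos_Ints_cases)
  have G: "Gamma (real k + 3/2) > 0" by (intro Gamma_real_pos) auto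
  have "(-1) ^ n / (fact n * Gamma (real n + (real k + 1/2) + 1)) * (x / 2) powr (2 * real n + (real k + 1/2))
     = (x/2) powr (real k + 1/2) / Gamma (real k + 3/2) * (bes_coeff k n * (x\<^sup>2) ^ n)" for n
  proof -
    have "(x / 2) powr (2 * real n + (real k + 1/2)) = (x\<^sup>2)^n / 4 ^ n * (x/2) powr (real k + 1/2)"
      using assms powr_realpow[of "x/2" "2*n"] by (simp add: powr_add power_divide power_mult)
    moreover have "Gamma (real n + (real k + 1/2) + 1) = Gamma (real k + 3/2) * pochhammer (real k + 3/2) n"
      using pochhammer_Gamma[OF pos, of n] less_imp_neq[OF G] by (simp add: add_ac)
    ultimately show ?thesis by (simp add: bes_coeff_def mult_ac)
  qed
  then show ?thesis
    unfolding bessel_J_def bes_def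
    using suminf_mult[OF summable_bes[of k "x\<^sup>2"], of "(x/2) powr (real k + 1/2) / Gamma (real k + 3/2)"] by simp
qed

section \<open>Products over positive zeros and their derivatives\<close>

lemma prod_deriv_tendsto:
  fixes z :: "nat \<Rightarrow> real" and F :: "real \<Rightarrow> real"
  assumes z: "\<And>l. z l > 0" "summable (\<lambda>l. 1 / z l)"
    and F: "\<And>w. (\<lambda>N. \<Prod>l<N. (1 - w / z l)) \<longlonglongrightarrow> F w"
    and F': "(F has_real_derivative F') (at w)"
  shows "(\<lambda>N. poly (pderiv (\<Prod>l<N. [:1, - 1 / z l:])) w) \<longlonglongrightarrow> F'"
proof -
  \<comment> \<open>Pointwise convergence on the real line says nothing about derivatives. The
    products are therefore taken at complex arguments, where locally uniform convergence carries
    over to derivatives, and the result is restricted to the real line.\<close>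
  define f where "f N x = (\<Prod>l<N. 1 - x / complex_of_real (z l))" for N x
  define f' where "f' N x = (\<Sum>l<N. - (1 / complex_of_real (z l)) * (\<Prod>j\<in>{..<N}-{l}. 1 - x / complex_of_real (z j)))" for N x
  define g where "g x = lim (\<lambda>N. f N x)" for x
  have der: "(f N has_field_derivative f' N x) (at x)" for N x
    unfolding f_def[abs_def] f'_def
    by (rule has_field_derivative_prod derivative_eq_intros refl | simp add: less_imp_neq[OF z(1), symmetric])+
  have uc: "uniformly_convergent_on (cball x 1) (\<lambda>N x. f N x)" for x
  proof -
    have "uniformly_convergent_on (cball x 1) (\<lambda>N x. \<Sum>n<N. norm (- x / complex_of_real (z n)))"
    proof (rule Weierstrass_m_test')
      show "norm (norm (- y / complex_of_real (z n))) \<le> (norm x + 1) * (1 / z n)" if "y \<in> cball x 1" for n y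
      proof -
        have "norm y \<le> norm x + 1"
          using that norm_triangle_ineq2[of y x] by (simp add: dist_norm norm_minus_commute)
        then show ?thesis using z(1)[of n] by (simp add: norm_divide divide_right_mono)
      qed
      show "summable (\<lambda>n. (norm x + 1) * (1 / z n))"
        by (intro summable_mult z)
    qed
    then have "uniformly_convergent_on (cball x 1) (\<lambda>N x. \<Prod>n<N. 1 + - x / complex_of_real (z n))"
      by (intro uniformly_convergent_on_prod)
         (auto intro!: continuous_intros simp: less_imp_neq[OF z(1), symmetric])
    then show ?thesis by (simp add: f_def)
  qed
  have "\<exists>g'. \<forall>x\<in>UNIV. (g has_field_derivative g' x) (at x) \<and> (\<lambda>n. f' n x) \<longlonglongrightarrow> g' x"
  proof (rule has_complex_derivative_uniform_sequence)
    fix x show "\<exists>d>0. cball x d \<subseteq> UNIV \<and> uniform_limit (cball x d) f g sequentially"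
      using uc[of x] unfolding g_def by (auto intro!: exI[of _ 1] simp: uniformly_convergent_uniform_limit_iff)
  qed (auto intro: der)
  then obtain g' where g': "(g has_field_derivative g' x) (at x)" "(\<lambda>n. f' n x) \<longlonglongrightarrow> g' x" for x
    by auto
  have g: "g (of_real x) = of_real (F x)" for x
  proof -
    have "(\<lambda>N. f N (of_real x)) \<longlonglongrightarrow> of_real (F x)"
      using tendsto_of_real[OF F[of x], where 'a=complex] by (simp add: f_def)
    then show ?thesis unfolding g_def by (rule limI)
  qed
  have "((\<lambda>x. g (of_real x)) has_vector_derivative g' (of_real w)) (at w)"
    using g'(1) by (rule has_vector_derivative_real_field)
  moreover have "((\<lambda>x. g (of_real x)) has_vector_derivative of_real F') (at w)"
    unfolding g using F' by (simp add: has_vector_derivative_of_real has_real_derivative_iff_has_vector_derivative)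
  ultimately have e: "g' (of_real w) = of_real F'"
    by (rule vector_derivative_unique_at)
  have "f' N (of_real w) = of_real (poly (pderiv (\<Prod>l<N. [:1, - 1 / z l:])) w)" for N
    unfolding f'_def pderiv_prod poly_sum poly_prod poly_mult
    by (simp add: poly_prod pderiv_pCons mult.commute)
  then have "(\<lambda>N. complex_of_real (poly (pderiv (\<Prod>l<N. [:1, - 1 / z l:])) w)) \<longlonglongrightarrow> of_real F'"
    using g'(2)[of "of_real w"] e by simp
  then show ?thesis by (simp add: tendsto_of_real_iff)
qed

text \<open>Canonical product of genus zero with simple positive zeros. It is stated through partial
  products because the zeros of the derivative will be limits of zeros of the derivatives of partial
  products.\<close>

definition hadamard :: "(nat \<Rightarrow> real) \<Rightarrow> (real \<Rightarrow> real) \<Rightarrow> bool" where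
  "hadamard z F \<longleftrightarrow> z 0 > 0 \<and> strict_mono z \<and> summable (\<lambda>l. 1 / z l) \<and>
     (\<forall>w. (\<lambda>N. \<Prod>l<N. (1 - w / z l)) \<longlonglongrightarrow> F w)"

lemma hadamardD:
  assumes "hadamard z F"
  shows "z l > 0" "strict_mono z" "summable (\<lambda>l. 1 / z l)" "(\<lambda>N. \<Prod>l<N. (1 - w / z l)) \<longlonglongrightarrow> F w"
  using assms strict_mono_less_eq[of z 0 l] unfolding hadamard_def by (auto intro: less_le_trans)

lemma hadamard_summable:
  assumes "hadamard z F"
  shows "summable (\<lambda>l. \<bar>1 / (z l - w)\<bar>)"
proof -
  have "filterlim z at_top sequentially"
  proof -
    have "(\<lambda>l. inverse (z l)) \<longlonglongrightarrow> 0"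
      using summable_LIMSEQ_zero[OF hadamardD(3)[OF assms]] by (simp add: inverse_eq_divide)
    then have "filterlim (\<lambda>l. inverse (inverse (z l))) at_top sequentially"
      by (rule filterlim_inverse_at_top) (simp add: hadamardD(1)[OF assms])
    then show ?thesis by simp
  qed
  then have "\<forall>\<^sub>F l in sequentially. z l \<ge> 2 * \<bar>w\<bar> + 1"
    by (simp add: filterlim_at_top)
  then have "\<forall>\<^sub>F l in sequentially. norm \<bar>1 / (z l - w)\<bar> \<le> 2 * (1 / z l)"
  proof eventually_elim
    case (elim l)
    then have "z l - w > 0" "z l - w \<ge> z l / 2" "z l > 0" by linarith+
    then show ?case by (simp add: divide_simps)
  qed
  then show ?thesis
    by (rule summable_comparison_test_ev) (intro summable_mult hadamardD(3)[OF assms])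
qed

text \<open>An absolutely convergent product without zero factors is nonzero; summability of 1 / z l
  is what excludes a product that diverges to 0.\<close>

lemma hadamard_zero_iff:
  assumes "hadamard z F"
  shows "F w = 0 \<longleftrightarrow> w \<in> range z"
proof
  note z = hadamardD[OF assms]
  assume "w \<in> range z"
  then obtain l where l: "w = z l" by auto
  have "eventually (\<lambda>N. (\<Prod>l<N. (1 - w / z l)) = 0) sequentially"
    using eventually_gt_at_top[of l]
  proof eventually_elim
    case (elim N)
    then show ?case using z(1)[of l] l by (auto simp: prod_zero_iff intro!: bexI[of _ l])
  qed
  then show "F w = 0"
    using tendsto_unique[OF _ z(4)[of w] tendsto_eventually] by auto
next
  note z = hadamardD[OF assms]
  assume 0: "F w = 0"
  show "w \<in> range z"
  proof (rule ccontr)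
    assume w: "w \<notin> range z"
    have n: "1 + - w / z l \<noteq> 0" for l
      using z(1)[of l] w by (auto simp: field_simps)
    have "summable (\<lambda>l. \<bar>- w / z l\<bar>)"
      using summable_mult[OF z(3), of "\<bar>w\<bar>"] z(1) by (simp add: abs_divide less_imp_le)
    then have cp: "convergent_prod (\<lambda>l. 1 + - w / z l)"
      using n by (intro summable_imp_convergent_prod_real) (auto simp: add_eq_0_iff)
    have "(\<lambda>N. \<Prod>l\<le>N. (1 + - w / z l)) \<longlonglongrightarrow> F w"
      using LIMSEQ_Suc[OF z(4)[of w]] by (simp add: lessThan_Suc_atMost)
    then have "prodinf (\<lambda>l. 1 + - w / z l) = F w"
      using convergent_prod_LIMSEQ[OF cp] by (rule LIMSEQ_unique[symmetric])
    then show False using prodinf_nonzero[OF cp n] 0 by simp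
  qed
qed

lemma partial_log_deriv:
  fixes z :: "nat \<Rightarrow> real"
  assumes "\<And>l. l < N \<Longrightarrow> z l \<noteq> 0" "\<And>l. l < N \<Longrightarrow> w \<noteq> z l"
  shows "poly (pderiv (\<Prod>l<N. [:1, - 1 / z l:])) w
      = - (\<Prod>l<N. (1 - w / z l)) * (\<Sum>l<N. 1 / (z l - w))"
proof -
  have "(\<Prod>j\<in>{..<N}-{l}. 1 - w / z j) * (- 1 / z l)
      = - (\<Prod>l<N. (1 - w / z l)) * (1 / (z l - w))" if "l < N" for l
  proof -
    have "(\<Prod>l<N. (1 - w / z l)) = (1 - w / z l) * (\<Prod>j\<in>{..<N}-{l}. 1 - w / z j)"
      using that by (intro prod.remove) auto
    moreover have e: "(1 - w / z l) * (1 / (z l - w)) = 1 / z l"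
      using assms[OF that] by (simp add: divide_simps)
    have "(1 - w / z l) * P * (1 / (z l - w)) = P * (1 / z l)" for P
      unfolding e[symmetric] by (simp only: mult_ac)
    ultimately show ?thesis by (simp only: mult_minus_left mult_minus_right minus_divide_left[symmetric])
  qed
  then show ?thesis
    unfolding pderiv_prod poly_sum poly_mult sum_distrib_left
    by (intro sum.cong) (simp_all add: poly_prod pderiv_pCons)
qed

text \<open>The partial fraction expansion of F' / F. It turns \<open>R_fun\<close>, a series over
  Bessel zeros, into a quotient of consecutive functions \<open>bes\<close>.\<close>

lemma hadamard_log_deriv:
  assumes h: "hadamard z F" and F': "(F has_real_derivative F') (at w)" and w: "w \<notin> range z"
  shows "F' = - F w * (\<Sum>l. 1 / (z l - w))"
proof -
  note z = hadamardD[OF h]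
  have z0: "z l \<noteq> 0" for l using z(1)[of l] by simp
  have e: "poly (pderiv (\<Prod>l<N. [:1, - 1 / z l:])) w
      = - (\<Prod>l<N. (1 - w / z l)) * (\<Sum>l<N. 1 / (z l - w))" for N
    by (rule partial_log_deriv[OF z0]) (use w in blast)
  have "(\<lambda>N. poly (pderiv (\<Prod>l<N. [:1, - 1 / z l:])) w) \<longlonglongrightarrow> F'"
    by (rule prod_deriv_tendsto[OF z(1,3,4) F'])
  moreover have "(\<lambda>N. poly (pderiv (\<Prod>l<N. [:1, - 1 / z l:])) w)
     \<longlonglongrightarrow> - F w * (\<Sum>l. 1 / (z l - w))"
    unfolding e by (intro tendsto_mult tendsto_minus z(4) summable_LIMSEQ summable_rabs_cancel[OF hadamard_summable[OF h]])
  ultimately show ?thesis by (rule LIMSEQ_unique)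
qed

lemma prod_one_minus_telescope:
  fixes c :: "nat \<Rightarrow> 'a::comm_ring_1"
  shows "(\<Prod>l<N. 1 - c l) = 1 - (\<Sum>l<N. c l * (\<Prod>j<l. 1 - c j))"
  by (induction N) (simp_all add: algebra_simps)

text \<open>Both the factors and their number change with N. Writing a product as 1 minus the sum of
  its successive drops turns the claim into dominated convergence of series, which is Tannery's
  theorem.\<close>

lemma tendsto_prod_dominated:
  fixes a :: "nat \<Rightarrow> nat \<Rightarrow> real"
  assumes a: "\<And>l. (\<lambda>N. a N l) \<longlonglongrightarrow> b l" and M: "\<And>N l. l < N \<Longrightarrow> \<bar>a N l\<bar> \<le> M l" "summable M"
    and L: "(\<lambda>N. \<Prod>l<N. 1 - a N l) \<longlonglongrightarrow> L"
  shows "(\<lambda>N. \<Prod>l<N. 1 - b l) \<longlonglongrightarrow> L"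
proof -
  define A where "A l N = (if l < N then a N l * (\<Prod>j<l. 1 - a N j) else 0)" for l N
  define B where "B l = b l * (\<Prod>j<l. 1 - b j)" for l
  have M0: "M l \<ge> 0" for l using M(1)[of l "Suc l"] by simp
  have bd: "norm (A l N) \<le> M l * exp (suminf M)" for l N
  proof (cases "l < N")
    case True
    have "\<bar>\<Prod>j<l. 1 - a N j\<bar> \<le> (\<Prod>j<l. 1 + M j)"
      unfolding abs_prod using M(1)[of _ N] True by (intro prod_mono) (auto intro!: order_trans[OF abs_triangle_ineq4])
    also have "\<dots> \<le> (\<Prod>j<l. exp (M j))"
      using M0 by (intro prod_mono) (auto intro: add_nonneg_nonneg)
    also have "\<dots> = exp (\<Sum>j<l. M j)" by (simp add: exp_sum)
    also have "\<dots> \<le> exp (suminf M)"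
      using sum_le_suminf[OF M(2), of "{..<l}"] M0 by simp
    finally have "\<bar>a N l\<bar> * \<bar>\<Prod>j<l. 1 - a N j\<bar> \<le> M l * exp (suminf M)"
      using M(1)[OF True] M0 by (intro mult_mono) auto
    then show ?thesis using True by (simp add: A_def abs_mult)
  qed (simp add: A_def M0)
  have lim: "(\<lambda>N. A l N) \<longlonglongrightarrow> B l" for l
  proof -
    have "(\<lambda>N. a N l * (\<Prod>j<l. 1 - a N j)) \<longlonglongrightarrow> B l"
      unfolding B_def by (intro tendsto_intros a)
    then show ?thesis
      by (rule Lim_transform_eventually) (use eventually_gt_at_top[of l] in eventually_elim, simp add: A_def)
  qed
  have ev: "\<forall>\<^sub>F (l, N) in at_top \<times>\<^sub>F sequentially. norm (A l N) \<le> M l * exp (suminf M)"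
    by (rule always_eventually) (auto simp only: split_paired_All prod.case intro: bd)
  have T: "summable (\<lambda>n. norm (B n)) \<and> ((\<lambda>N. suminf (\<lambda>l. A l N)) \<longlonglongrightarrow> suminf B)"
    using tannerys_theorem[OF lim ev summable_mult2[OF M(2)]] by simp
  have "suminf (\<lambda>l. A l N) = (\<Sum>l<N. A l N)" for N
    by (rule suminf_finite) (auto simp: A_def)
  then have sA: "suminf (\<lambda>l. A l N) = 1 - (\<Prod>l<N. 1 - a N l)" for N
    using prod_one_minus_telescope[of "a N" N] by (simp add: A_def)
  have "(\<lambda>N. 1 - (\<Prod>l<N. 1 - a N l)) \<longlonglongrightarrow> suminf B"
    using T unfolding sA by blast
  then have "suminf B = 1 - L"
    by (rule LIMSEQ_unique) (intro tendsto_intros L)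
  moreover have "(\<lambda>N. 1 - (\<Sum>l<N. B l)) \<longlonglongrightarrow> 1 - suminf B"
    using T by (intro tendsto_intros summable_LIMSEQ) (auto intro: summable_norm_cancel)
  moreover have "1 - (\<Sum>l<N. B l) = (\<Prod>l<N. 1 - b l)" for N
    using prod_one_minus_telescope[of b N] by (simp add: B_def)
  ultimately show ?thesis by simp
qed

text \<open>By Rolle's theorem the zeros of the derivatives of the partial products interlace with \<open>z\<close>;
  they converge to zeros of \<open>F'\<close>, and dominated convergence gives the product formula.\<close>
lemma hadamard_deriv:
  fixes F F' :: "real \<Rightarrow> real"
  assumes h: "hadamard z F" and F': "\<And>w. (F has_real_derivative F' w) (at w)"
    and simple: "\<And>l. F' (z l) \<noteq> 0"
  shows "\<exists>y. hadamard y (\<lambda>w. F' w / F' 0) \<and> (\<forall>l. z l < y l \<and> y l < z (Suc l))"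
proof -
  note z = hadamardD[OF h]
  define Q where "Q N = (\<Prod>l<N. [:1, - 1 / z l:])" for N
  define h where "h N w = (\<Sum>l<N. 1 / (z l - w))" for N w
  have Q: "poly (Q N) w = (\<Prod>l<N. 1 - w / z l)" for N w
    by (simp add: Q_def poly_prod)
  have lim: "(\<lambda>N. poly (pderiv (Q N)) w) \<longlonglongrightarrow> F' w" for w
    unfolding Q_def by (rule prod_deriv_tendsto[OF z(1,3,4) F'])
  have z0: "z l \<noteq> 0" for l using z(1)[of l] by simp
  have F0: "F' 0 \<noteq> 0"
  proof -
    have "0 \<notin> range z" using z(1) by (metis imageE less_irrefl)
    then have "F' 0 = - F 0 * (\<Sum>l. 1 / (z l - 0))"
      by (intro hadamard_log_deriv[OF h F'])
    moreover have "F 0 = 1" using z(4)[of 0] by (simp add: LIMSEQ_const_iff)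
    moreover have "(\<Sum>l. 1 / z l) > 0" using z by (intro suminf_pos) auto
    ultimately show ?thesis by simp
  qed
  have "\<exists>y. z l < y \<and> y < z (Suc l) \<and> poly (pderiv (Q N)) y = 0" if True: "Suc l < N" for N l
  proof -
    have zl: "z l < z (Suc l)" using z(2) by (simp add: strict_mono_Suc_iff)
    have "poly (Q N) (z j) = 0" if "j < N" for j
      unfolding Q by (rule prod_zero) (use that z0[of j] in \<open>auto intro: bexI[of _ j]\<close>)
    then have "poly (Q N) (z l) = 0" "poly (Q N) (z (Suc l)) = 0" using True by auto
    then show ?thesis using poly_MVT[OF zl, of "Q N"] zl by auto
  qed
  note ex = this
  define Y where "Y N l = (SOME y. z l < y \<and> y < z (Suc l) \<and> poly (pderiv (Q N)) y = 0)" for N l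
  have Y: "z l < Y N l \<and> Y N l < z (Suc l) \<and> poly (pderiv (Q N)) (Y N l) = 0" if "Suc l < N" for N l
    unfolding Y_def using ex[OF that] by (rule someI_ex)
  have le: "z i \<le> z j" if "i \<le> j" for i j using z(2) that by (simp add: strict_mono_less_eq)
  have gap: "j \<le> l \<and> z j \<le> z l \<or> Suc l \<le> j \<and> z (Suc l) \<le> z j" for j l
    using le by (cases "j \<le> l") auto
  have h0: "h N (Y N l) = 0" if "Suc l < N" for N l
  proof -
    have ne: "Y N l \<noteq> z j" for j using Y[OF that] gap[of j l] by linarith
    have "poly (pderiv (Q N)) (Y N l) = - poly (Q N) (Y N l) * h N (Y N l)"
      unfolding Q h_def unfolding Q_def by (rule partial_log_deriv) (use ne z0 in auto)
    moreover have "poly (Q N) (Y N l) \<noteq> 0"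
    proof -
      have "1 - Y N l / z j \<noteq> 0" for j using ne[of j] z0[of j] by simp
      then show ?thesis unfolding Q by (simp add: prod_zero_iff)
    qed
    ultimately show ?thesis using Y[OF that] by simp
  qed
  \<comment> \<open>\<open>h\<close> is minus the logarithmic derivative and increases inside the
    gap. Passing to N + 1 adds the positive term 1 / (z N - w), so \<open>h\<close> is already
    positive at the old zero and the new zero cannot lie to its right.\<close>
  have dec: "Y (Suc N) l \<le> Y N l" if "Suc l < N" for N l
  proof (rule ccontr)
    assume "\<not> Y (Suc N) l \<le> Y N l"
    then have lt: "Y N l < Y (Suc N) l" by simp
    have b: "z l < Y N l" "Y (Suc N) l < z (Suc l)" using Y[of l N] Y[of l "Suc N"] that by auto
    have "h (Suc N) (Y N l) \<le> h (Suc N) (Y (Suc N) l)"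
      unfolding h_def
    proof (rule sum_mono)
      fix j
      show "1 / (z j - Y N l) \<le> 1 / (z j - Y (Suc N) l)"
        using gap[of j l]
      proof
        assume "j \<le> l \<and> z j \<le> z l"
        then show ?thesis using b lt by (simp add: divide_simps)
      next
        assume "Suc l \<le> j \<and> z (Suc l) \<le> z j"
        then show ?thesis using b lt by (simp add: divide_simps)
      qed
    qed
    moreover have "h (Suc N) (Y N l) > 0"
    proof -
      have "z N - Y N l > 0" using Y[OF that] le[of "Suc l" N] that by linarith
      then show ?thesis using h0[OF that] by (simp add: h_def)
    qed
    ultimately show False using h0[of l "Suc N"] that by simp
  qed
  have "\<exists>y. (\<lambda>N. Y (Suc N) l) \<longlonglongrightarrow> y" for l
  proof -
    have "decseq (\<lambda>N. Y (N + (l + 2)) l)"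
      by (rule decseq_SucI) (use dec in simp)
    moreover have "z l \<le> Y (N + (l + 2)) l" for N
      using Y[of l "N + (l + 2)"] by simp
    ultimately obtain y where "(\<lambda>N. Y (N + (l + 2)) l) \<longlonglongrightarrow> y"
      using decseq_convergent by metis
    then have "(\<lambda>N. Y N l) \<longlonglongrightarrow> y" by (rule LIMSEQ_offset)
    then show ?thesis using LIMSEQ_Suc by blast
  qed
  then obtain y where y: "\<And>l. (\<lambda>N. Y (Suc N) l) \<longlonglongrightarrow> y l" by metis
  have yl: "z l \<le> y l" "y l \<le> z (Suc l)" for l
  proof -
    have ev: "eventually (\<lambda>N. z l \<le> Y (Suc N) l \<and> Y (Suc N) l \<le> z (Suc l)) sequentially"
      using eventually_gt_at_top[of l] by eventually_elim (use Y[of l] in force)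
    show "z l \<le> y l" by (rule tendsto_lowerbound[OF y]) (use ev in \<open>auto elim: eventually_mono\<close>)
    show "y l \<le> z (Suc l)" by (rule tendsto_upperbound[OF y]) (use ev in \<open>auto elim: eventually_mono\<close>)
  qed
  \<comment> \<open>Comparison at N + 1 points: the derivative of a product of N + 1 linear factors
    has degree at most N, it vanishes at the N points found in the gaps, and both sides agree at
    0.\<close>
  have fac: "poly (pderiv (Q (Suc N))) w = poly (pderiv (Q (Suc N))) 0 * (\<Prod>l<N. 1 - w / Y (Suc N) l)" for N w
  proof -
    define P where "P = [:poly (pderiv (Q (Suc N))) 0:] * (\<Prod>l<N. [:1, - 1 / Y (Suc N) l:])"
    define A where "A = insert 0 (Y (Suc N) ` {..<N})"
    have pos: "Y (Suc N) l > 0" if "l < N" for l using Y[of l "Suc N"] that z(1)[of l] by auto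
    have dd: "degree (\<Prod>l<n. [:1, - 1 / c l:]) \<le> n" for c :: "nat \<Rightarrow> real" and n
    proof -
      have "degree (\<Prod>l<n. [:1, - 1 / c l:]) \<le> (\<Sum>l<n. degree [:1, - 1 / c l:])"
        using degree_prod_sum_le[of "{..<n}" "\<lambda>l. [:1, - 1 / c l:]"] by (simp add: comp_def)
      also have "\<dots> \<le> (\<Sum>l<n. 1)" by (intro sum_mono) (simp add: degree_pCons_eq_if)
      finally show ?thesis by simp
    qed
    have "pderiv (Q (Suc N)) = P"
    proof (rule poly_eqI_degree[of A])
      fix x assume "x \<in> A"
      then consider "x = 0" | l where "l < N" "x = Y (Suc N) l" by (auto simp: A_def)
      then show "poly (pderiv (Q (Suc N))) x = poly P x"
      proof cases
        case 2
        have "(\<Prod>l<N. 1 - x / Y (Suc N) l) = 0"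
          by (rule prod_zero) (use 2 pos[of l] in \<open>auto intro: bexI[of _ l]\<close>)
        then have "poly P x = 0" by (simp add: P_def poly_prod)
        then show ?thesis using Y[of l "Suc N"] 2 by simp
      qed (simp add: P_def poly_prod)
    next
      have "inj_on (Y (Suc N)) {..<N}"
      proof (rule inj_onI, rule ccontr)
        fix i j assume ij: "i \<in> {..<N}" "j \<in> {..<N}" "Y (Suc N) i = Y (Suc N) j" "i \<noteq> j"
        have "\<not> a < b" if "a < N" "b < N" "Y (Suc N) a = Y (Suc N) b" for a b
          using Y[of a "Suc N"] Y[of b "Suc N"] that le[of "Suc a" b] by (intro notI) auto
        then show False using ij by (metis lessThan_iff linorder_neqE_nat)
      qed
      moreover have "0 \<notin> Y (Suc N) ` {..<N}" using pos by force
      ultimately have c: "card A = Suc N" by (simp add: A_def card_image)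
      show "degree (pderiv (Q (Suc N))) < card A"
        using dd[of z "Suc N"] unfolding c Q_def by (intro le_imp_less_Suc) (simp add: degree_pderiv)
      show "degree P < card A"
        unfolding c P_def using dd[of "Y (Suc N)" N] degree_mult_le[of "[:poly (pderiv (Q (Suc N))) 0:]" "\<Prod>l<N. [:1, - 1 / Y (Suc N) l:]"]
        by (simp del: mult_pCons_left)
    qed
    then have "poly (pderiv (Q (Suc N))) w = poly P w" by simp
    then show ?thesis by (simp add: P_def poly_prod)
  qed
  have prods: "(\<lambda>N. \<Prod>l<N. 1 - w / y l) \<longlonglongrightarrow> F' w / F' 0" for w
  proof (rule tendsto_prod_dominated[where a="\<lambda>N l. w / Y (Suc N) l" and M="\<lambda>l. \<bar>w\<bar> * (1 / z l)"])
    fix l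
    have "y l \<noteq> 0" using yl(1)[of l] z(1)[of l] by linarith
    then show "(\<lambda>N. w / Y (Suc N) l) \<longlonglongrightarrow> w / y l" by (intro tendsto_intros y)
  next
    fix N l :: nat assume "l < N"
    then have "0 < z l" "z l \<le> Y (Suc N) l" using Y[of l "Suc N"] z(1)[of l] by auto
    then show "\<bar>w / Y (Suc N) l\<bar> \<le> \<bar>w\<bar> * (1 / z l)"
      by (simp add: abs_divide divide_left_mono)
  next
    show "summable (\<lambda>l. \<bar>w\<bar> * (1 / z l))" by (intro summable_mult z)
  next
    have "(\<lambda>N. poly (pderiv (Q (Suc N))) w / poly (pderiv (Q (Suc N))) 0) \<longlonglongrightarrow> F' w / F' 0"
      by (intro tendsto_divide LIMSEQ_Suc lim F0)
    moreover have "eventually (\<lambda>N. poly (pderiv (Q (Suc N))) 0 \<noteq> 0) sequentially"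
      using tendsto_imp_eventually_ne[OF LIMSEQ_Suc[OF lim[of 0]] F0] .
    then have "eventually (\<lambda>N. poly (pderiv (Q (Suc N))) w / poly (pderiv (Q (Suc N))) 0
       = (\<Prod>l<N. 1 - w / Y (Suc N) l)) sequentially"
      by eventually_elim (subst fac, simp)
    ultimately show "(\<lambda>N. \<Prod>l<N. 1 - w / Y (Suc N) l) \<longlonglongrightarrow> F' w / F' 0"
      by (rule Lim_transform_eventually)
  qed
  \<comment> \<open>So far the limits are only known to lie in the closed gaps. As zeros of F' they
    cannot be end points, because F' does not vanish at the zeros of F; hence the interlacing is
    strict.\<close>
  have "F' (y l) = 0" for l
  proof -
    have "y l \<noteq> 0" using yl(1)[of l] z(1)[of l] by linarith
    have "eventually (\<lambda>N. (\<Prod>j<N. 1 - y l / y j) = 0) sequentially"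
      using eventually_gt_at_top[of l]
    proof eventually_elim
      case (elim N)
      then show ?case using \<open>y l \<noteq> 0\<close> by (intro prod_zero) (auto intro: bexI[of _ l])
    qed
    then have "F' (y l) / F' 0 = 0"
      using tendsto_unique[OF sequentially_bot prods[of "y l"] tendsto_eventually] by blast
    then show ?thesis using F0 by simp
  qed
  then have s: "z l < y l" "y l < z (Suc l)" for l
    using yl[of l] simple by (metis order_le_less)+
  have "hadamard y (\<lambda>w. F' w / F' 0)"
    unfolding hadamard_def
  proof (intro conjI allI prods)
    show "y 0 > 0" using s(1)[of 0] z(1)[of 0] by linarith
    show "strict_mono y" unfolding strict_mono_Suc_iff using s by (meson less_trans)
    have "norm (1 / y l) \<le> 1 / z l" for l
      using s(1)[of l] z(1)[of l] by (simp add: divide_simps)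
    then show "summable (\<lambda>l. 1 / y l)" by (rule summable_comparison_test'[OF z(3)])
  qed
  then show ?thesis using s by blast
qed

section \<open>The product formula for the Bessel functions\<close>

lemma hadamard_bes_0: "hadamard (\<lambda>l. (pi * real (Suc l))\<^sup>2) (bes 0)"
  unfolding hadamard_def
proof (intro conjI allI)
  show "strict_mono (\<lambda>l. (pi * real (Suc l))\<^sup>2)"
    by (auto simp: strict_mono_def intro!: power_strict_mono)
  have "summable (\<lambda>l. 1 / (real (Suc l))\<^sup>2)"
    using inverse_power_summable[of 2, where 'a=real] by (subst summable_Suc_iff) (simp add: inverse_eq_divide)
  then have "summable (\<lambda>l. 1 / pi\<^sup>2 * (1 / (real (Suc l))\<^sup>2))" by (rule summable_mult)
  then show "summable (\<lambda>l. 1 / (pi * real (Suc l))\<^sup>2)" by (simp add: power_mult_distrib)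
  fix w :: real
  show "(\<lambda>N. \<Prod>l<N. 1 - w / (pi * real (Suc l))\<^sup>2) \<longlonglongrightarrow> bes 0 w"
  proof (cases "w = 0")
    case False
    \<comment> \<open>A complex root, so that negative w is covered by the same sine product; the
      factor c is cancelled afterwards.\<close>
    define c where "c = csqrt (of_real w)"
    have c: "c\<^sup>2 = of_real w" "c \<noteq> 0" using False by (auto simp: c_def)
    have e: "of_real pi * (c / of_real pi) = c" by simp
    have "(\<lambda>n. c * (\<Prod>k=1..n. 1 - (c / of_real pi)\<^sup>2 / (of_nat k)\<^sup>2)) \<longlonglongrightarrow> c * bes 0 (of_real w)"
      using sin_product_formula_complex[of "c / of_real pi"] unfolding e bes_0_sin[symmetric] c .
    then have "(\<lambda>n. inverse c * (c * (\<Prod>k=1..n. 1 - (c / of_real pi)\<^sup>2 / (of_nat k)\<^sup>2))) \<longlonglongrightarrow> inverse c * (c * bes 0 (of_real w))"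
      by (rule tendsto_mult[OF tendsto_const])
    then have "(\<lambda>n. (\<Prod>k=1..n. 1 - (c / of_real pi)\<^sup>2 / (of_nat k)\<^sup>2)) \<longlonglongrightarrow> of_real (bes 0 w)"
      unfolding mult.assoc[symmetric] left_inverse[OF c(2)] mult_1_left bes_of_real .
    moreover have "(\<Prod>k=1..n. 1 - (c / of_real pi)\<^sup>2 / (of_nat k)\<^sup>2) = of_real (\<Prod>l<n. 1 - w / (pi * real (Suc l))\<^sup>2)" for n
    proof -
      have "(\<Prod>k=1..n. 1 - (c / of_real pi)\<^sup>2 / (of_nat k)\<^sup>2) = (\<Prod>l<n. 1 - (c / of_real pi)\<^sup>2 / (of_nat (Suc l))\<^sup>2)"
        by (rule prod.reindex_bij_witness[of _ Suc "\<lambda>k. k - 1"]) auto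
      also have "\<dots> = of_real (\<Prod>l<n. 1 - w / (pi * real (Suc l))\<^sup>2)"
        by (simp add: power_divide c power_mult_distrib)
      finally show ?thesis .
    qed
    ultimately show ?thesis by (simp only: tendsto_of_real_iff)
  qed simp
qed simp

lemma bes_0_deriv_cos:
  fixes x :: complex
  shows "bes 0 (x\<^sup>2) + x * (of_real (- 1/6) * bes (Suc 0) (x\<^sup>2) * (2 * x)) = cos x"
proof -
  have "((\<lambda>x. x * bes 0 (x\<^sup>2)) has_field_derivative
      bes 0 (x\<^sup>2) + x * (of_real (- 1/6) * bes (Suc 0) (x\<^sup>2) * (2 * x))) (at x)"
    by (auto intro!: derivative_eq_intros DERIV_chain2[OF bes_deriv])
  then show ?thesis unfolding bes_0_sin by (rule DERIV_unique) (rule DERIV_sin)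
qed

text \<open>A common zero of two neighbours propagates down the recurrence to k = 0, where it
  becomes a common zero of sine and cosine. As the derivative of \<open>bes k\<close> is a multiple
  of \<open>bes (Suc k)\<close>, this is the simplicity of the zeros.\<close>

lemma bes_no_common_zero:
  fixes w :: real
  shows "bes k w = 0 \<Longrightarrow> bes (Suc k) w \<noteq> 0"
proof (induction k)
  case 0
  show ?case
  proof
    assume 1: "bes (Suc 0) w = 0"
    define x where "x = csqrt (of_real w)"
    have x: "x\<^sup>2 = of_real w" by (simp add: x_def)
    have "sin x = 0" using bes_0_sin[of x] 0 by (simp add: x bes_of_real)
    moreover have "cos x = 0" using bes_0_deriv_cos[of x] 0 1 unfolding x bes_of_real by simp
    ultimately show False using sin_cos_squared_add[of x] by simp
  qed
next
  case (Suc k)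
  then show ?case using bes_rec[of k w] by auto
qed

lemma hadamard_bes_Suc:
  assumes h: "hadamard z (bes k)"
  shows "\<exists>y. hadamard y (bes (Suc k)) \<and> (\<forall>l. z l < y l \<and> y l < z (Suc l))"
proof -
  let ?c = "of_real (- 1 / (2 * (2 * real k + 3))) :: real"
  have c: "?c \<noteq> 0" by (simp add: add_nonneg_eq_0_iff)
  have "\<exists>y. hadamard y (\<lambda>w. ?c * bes (Suc k) w / (?c * bes (Suc k) 0)) \<and> (\<forall>l. z l < y l \<and> y l < z (Suc l))"
  proof (rule hadamard_deriv[OF h bes_deriv])
    fix l
    have "bes k (z l) = 0" using hadamard_zero_iff[OF h] by auto
    then show "?c * bes (Suc k) (z l) \<noteq> 0" using bes_no_common_zero c by simp
  qed
  moreover have "?c * bes (Suc k) w / (?c * bes (Suc k) 0) = bes (Suc k) w" for w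
    using c by simp
  ultimately show ?thesis by simp
qed

lemma hadamard_bes_ex: "\<exists>z. hadamard z (bes k)"
  by (induction k) (use hadamard_bes_0 hadamard_bes_Suc in blast)+

section \<open>Squared Bessel zeros and the real form of R_k\<close>

definition zero_sq :: "nat \<Rightarrow> nat \<Rightarrow> real" where
  "zero_sq k l = (bessel_zero k (Suc l))\<^sup>2"

lemma bessel_zero_eq_sqrt:
  assumes h: "hadamard z (bes k)"
  shows "bessel_zero k (Suc l) = sqrt (z l)"
proof -
  note z = hadamardD[OF h]
  have J: "x > 0 \<and> bessel_J (real k + 1/2) x = 0 \<longleftrightarrow> x > 0 \<and> x\<^sup>2 \<in> range z" for x
    using less_imp_neq[OF Gamma_real_pos[of "real k + 3/2"]]
    by (auto simp: bessel_J_bes hadamard_zero_iff[OF h])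
  have pos: "sqrt (z l) > 0" for l using z(1) by simp
  \<comment> \<open>Here b will be 0 or the previous zero. The infimum is a minimum because the
    zeros form an increasing sequence.\<close>
  have step: "Inf {x. x > b \<and> bessel_J (real k + 1/2) x = 0} = sqrt (z l)"
    if b: "b \<ge> 0" "b < sqrt (z l)" "\<And>j. sqrt (z j) > b \<Longrightarrow> l \<le> j" for b l
  proof -
    have e: "{x. x > b \<and> bessel_J (real k + 1/2) x = 0} = {x. x > b \<and> x\<^sup>2 \<in> range z}"
      using J b(1) by (metis le_less_trans)
    show ?thesis unfolding e
    proof (rule cInf_eq_minimum)
      show "sqrt (z l) \<in> {x. x > b \<and> x\<^sup>2 \<in> range z}" using b z(1)[of l] by simp
      fix x assume "x \<in> {x. x > b \<and> x\<^sup>2 \<in> range z}"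
      then obtain j where j: "x > b" "x\<^sup>2 = z j" by auto
      then have x: "x = sqrt (z j)" using b(1) by (metis real_sqrt_unique less_imp_le le_less_trans)
      with j b(3) have "l \<le> j" by simp
      then show "sqrt (z l) \<le> x" unfolding x using z(2) by (simp add: strict_mono_less_eq)
    qed
  qed
  show ?thesis
  proof (induction l)
    case 0
    show ?case using step[of 0 0] pos by simp
  next
    case (Suc l)
    have "sqrt (z l) < sqrt (z j) \<Longrightarrow> Suc l \<le> j" for j
      using z(2) by (simp add: strict_mono_less Suc_le_eq)
    then have "Inf {x. x > sqrt (z l) \<and> bessel_J (real k + 1/2) x = 0} = sqrt (z (Suc l))"
      using pos[of l] z(2) by (intro step) (auto simp: strict_mono_less)
    then show ?case using Suc by simp
  qed
qed

lemma hadamard_zero_sq: "hadamard (zero_sq k) (bes k)"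
proof -
  obtain z where z: "hadamard z (bes k)" using hadamard_bes_ex by blast
  have "zero_sq k = z"
    using bessel_zero_eq_sqrt[OF z] hadamardD(1)[OF z] by (auto simp: zero_sq_def less_imp_le simp del: bessel_zero.simps)
  then show ?thesis using z by simp
qed

lemmas zero_sq = hadamardD[OF hadamard_zero_sq]

lemma zero_sq_interlace: "zero_sq k l < zero_sq (Suc k) l"
proof -
  obtain y where y: "hadamard y (bes (Suc k))" "\<And>l. zero_sq k l < y l"
    using hadamard_bes_Suc[OF hadamard_zero_sq] by blast
  have "zero_sq (Suc k) l = y l"
    using bessel_zero_eq_sqrt[OF y(1)] hadamardD(1)[OF y(1)] by (simp add: zero_sq_def less_imp_le del: bessel_zero.simps)
  then show ?thesis using y(2) by simp
qed

lemma zero_sq_mono: "k \<le> n \<Longrightarrow> zero_sq k l \<le> zero_sq n l"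
  by (rule lift_Suc_mono_le[of "\<lambda>k. zero_sq k l"]) (auto simp: less_imp_le[OF zero_sq_interlace])

lemma bessel_zero_1: "bessel_zero k 1 = sqrt (zero_sq k 0)"
  using bessel_zero_eq_sqrt[OF hadamard_zero_sq, of k 0] by simp

lemma zero_sq_le: "zero_sq k 0 \<le> zero_sq k l"
  using zero_sq(2)[of k] by (simp add: strict_mono_less_eq)

text \<open>The substitution \<open>w = - z\<^sup>2\<close> in the series for \<open>R\<^sub>k(z)\<close>.\<close>
definition R_real :: "nat \<Rightarrow> real \<Rightarrow> real" where
  "R_real k w = - 2 * (\<Sum>l. w / (zero_sq k l - w))"

lemma summable_R_real: "summable (\<lambda>l. w / (zero_sq k l - w))"
  using summable_mult[OF summable_rabs_cancel[OF hadamard_summable[OF hadamard_zero_sq[of k], of w]], of w] by simp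

lemma R_fun_eq:
  assumes "z\<^sup>2 = - of_real w"
  shows "R_fun k z = of_real (R_real k w)"
proof -
  have "z\<^sup>2 / ((complex_of_real (bessel_zero k (Suc l)))\<^sup>2 + z\<^sup>2) = of_real (- (w / (zero_sq k l - w)))" for l
    unfolding assms zero_sq_def by simp
  moreover have "(\<lambda>l. complex_of_real (- (w / (zero_sq k l - w)))) sums of_real (- (\<Sum>l. w / (zero_sq k l - w)))"
    by (intro sums_of_real sums_minus summable_sums summable_R_real)
  ultimately show ?thesis
    unfolding R_fun_def R_real_def using sums_unique by fastforce
qed

lemma R_real_0 [simp]: "R_real k 0 = 0"
  by (simp add: R_real_def)

lemma R_real_bes:
  assumes "w < zero_sq k 0"
  shows "bes k w \<noteq> 0" "R_real k w * bes k w * (2 * real k + 3) = - w * bes (Suc k) w"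
proof -
  have w: "w \<notin> range (zero_sq k)"
    using zero_sq_le[of k] assms by (auto simp: not_le[symmetric])
  then show "bes k w \<noteq> 0" using hadamard_zero_iff[OF hadamard_zero_sq] by blast
  have "- 1 / (2 * (2 * real k + 3)) * bes (Suc k) w = - bes k w * (\<Sum>l. 1 / (zero_sq k l - w))"
    using hadamard_log_deriv[OF hadamard_zero_sq bes_deriv w] by simp
  moreover have "(\<Sum>l. w / (zero_sq k l - w)) = w * (\<Sum>l. 1 / (zero_sq k l - w))"
    using suminf_mult[OF summable_rabs_cancel[OF hadamard_summable[OF hadamard_zero_sq[of k], of w]], of w] by simp
  ultimately have "R_real k w * bes k w = - 2 * w * (1 / (2 * (2 * real k + 3)) * bes (Suc k) w)"
    unfolding R_real_def by (simp add: algebra_simps)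
  moreover have "- 2 * w * (1 / (2 * c) * b) * c = - w * b" if "c \<noteq> 0" for b c :: real
    using that by simp
  ultimately show "R_real k w * bes k w * (2 * real k + 3) = - w * bes (Suc k) w"
    by (simp only:)
qed

text \<open>The three-term recurrence divided by two consecutive values of \<open>bes\<close>, which
  are nonzero below the first zero. Iteration gives the continued fraction.\<close>

lemma R_real_rec:
  assumes w: "w < zero_sq k 0"
  shows "R_real k w * (2 * real k + 3 + R_real (Suc k) w) = - w"
proof -
  have w': "w < zero_sq (Suc k) 0" using w zero_sq_interlace[of k 0] by simp
  define a where "a = 2 * real k + 3"
  have a: "a > 0" by (simp add: a_def add_nonneg_pos)
  note A = R_real_bes[OF w, folded a_def]
  note B = R_real_bes[OF w']
  have a2: "2 * real (Suc k) + 3 = a + 2" "2 * real k + 5 = a + 2" by (simp_all add: a_def)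
  have C: "a * (a + 2) * bes k w = a * (a + 2) * bes (Suc k) w - w * bes (Suc (Suc k)) w"
  proof -
    have "bes k w = bes (Suc k) w - 1 / (a * (a + 2)) * w * bes (Suc (Suc k)) w"
      using bes_rec[of k w] unfolding a_def[symmetric] a2 by simp
    then have "a * (a + 2) * bes k w = a * (a + 2) * (bes (Suc k) w - 1 / (a * (a + 2)) * w * bes (Suc (Suc k)) w)"
      by simp
    then show ?thesis using a by (simp add: right_diff_distrib add_nonneg_eq_0_iff)
  qed
  have "(R_real k w * (a + R_real (Suc k) w)) * (bes k w * a * (bes (Suc k) w * (a + 2)))
     = (R_real k w * bes k w * a) * (a * bes (Suc k) w * (a + 2) + R_real (Suc k) w * bes (Suc k) w * (a + 2))"
    by (simp add: algebra_simps)
  also have "\<dots> = - w * bes (Suc k) w * (a * (a + 2) * bes (Suc k) w - w * bes (Suc (Suc k)) w)"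
    unfolding A(2) B(2)[unfolded a2] by (simp add: algebra_simps)
  also have "\<dots> = - w * (bes k w * a * (bes (Suc k) w * (a + 2)))"
    unfolding C[symmetric] by (simp add: algebra_simps)
  finally have "(R_real k w * (a + R_real (Suc k) w)) * (bes k w * a * (bes (Suc k) w * (a + 2)))
     = - w * (bes k w * a * (bes (Suc k) w * (a + 2)))" .
  moreover have "bes k w * a * (bes (Suc k) w * (a + 2)) \<noteq> 0"
    using A(1) B(1) a by simp
  ultimately show ?thesis unfolding a_def by (metis mult_right_cancel)
qed

text \<open>Termwise: each summand w / (z - w) increases with w and decreases as z moves to the
  right, and interlacing moves every zero to the right when the index grows.\<close>

lemma R_real_mono:
  assumes "k \<le> n" "0 \<le> w" "w \<le> w'" "w' < zero_sq k 0"
  shows "R_real k w' \<le> R_real n w"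
proof -
  have "w / (zero_sq n l - w) \<le> w' / (zero_sq k l - w')" for l
    using assms zero_sq_le[of k l] zero_sq_mono[OF assms(1), of l] by (intro frac_le) auto
  then show ?thesis
    unfolding R_real_def by (simp add: suminf_le summable_R_real)
qed

lemma R_real_nonpos:
  assumes "0 \<le> w" "w < zero_sq k 0"
  shows "R_real k w \<le> 0"
  using R_real_mono[of k k 0 w] assms by simp

text \<open>This is the curvature of the minimisation in \<open>rho_minimum\<close>. Its sign is
  read off the recurrence: the product with the nonpositive R_k equals - w < 0.\<close>

lemma R_real_denom_pos:
  assumes "0 \<le> w" "w < zero_sq k 0"
  shows "2 * real k + 3 + R_real (Suc k) w > 0"
proof (cases "w = 0")
  case False
  then have "R_real k w * (2 * real k + 3 + R_real (Suc k) w) < 0"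
    using R_real_rec[OF assms(2)] assms(1) by simp
  then show ?thesis using R_real_nonpos[OF assms] by (simp add: mult_less_0_iff)
qed (simp add: add_nonneg_pos)

lemma R_real_0_cot:
  assumes "0 < \<bar>x\<bar>" "\<bar>x\<bar> < pi"
  shows "R_real 0 (x\<^sup>2) = x * cot x - 1"
proof -
  have lt: "x\<^sup>2 < zero_sq 0 0"
    using power_strict_mono[OF assms(2), of 2] by (simp add: zero_sq_def bessel_zero_0_1[simplified])
  have s: "x * bes 0 (x\<^sup>2) = sin x"
    using bes_0_sin[of "of_real x"] bes_of_real[of 0 "x\<^sup>2", where 'a=complex]
    by (metis of_real_eq_iff of_real_mult of_real_power sin_of_real)
  have "complex_of_real (bes 0 (x\<^sup>2) + x * (- 1/6 * bes (Suc 0) (x\<^sup>2) * (2 * x))) = of_real (cos x)"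
    using bes_0_deriv_cos[of "of_real x"] bes_of_real[of 0 "x\<^sup>2", where 'a=complex] bes_of_real[of "Suc 0" "x\<^sup>2", where 'a=complex]
    by (simp add: cos_of_real)
  then have c: "bes 0 (x\<^sup>2) + x * (- 1/6 * bes (Suc 0) (x\<^sup>2) * (2 * x)) = cos x"
    by (simp only: of_real_eq_iff)
  have b: "bes 0 (x\<^sup>2) \<noteq> 0" by (rule R_real_bes(1)[OF lt])
  have x: "x \<noteq> 0" using assms by auto
  have "R_real 0 (x\<^sup>2) * bes 0 (x\<^sup>2) * 3 = - x\<^sup>2 * bes (Suc 0) (x\<^sup>2)"
    using R_real_bes(2)[OF lt] by simp
  then have "R_real 0 (x\<^sup>2) * bes 0 (x\<^sup>2) = cos x - bes 0 (x\<^sup>2)"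
    using c by (simp add: power2_eq_square algebra_simps)
  then have "R_real 0 (x\<^sup>2) = (cos x - bes 0 (x\<^sup>2)) / bes 0 (x\<^sup>2)"
    using b by (simp add: eq_divide_eq)
  also have "\<dots> = x * cot x - 1"
    unfolding cot_def s[symmetric] using b x by (simp add: divide_simps)
  finally show ?thesis .
qed

section \<open>Spectral calculus of skew-symmetric matrices\<close>

text \<open>To be applied to the symmetric operator - T^2 of a real skew matrix T. The functions
  \<open>R_fun k\<close> and z cot z are even, so at - T and i T they depend on T^2 only, and a real
  orthonormal basis suffices for the complex functional calculus. The subspace S serves the
  induction on the dimension.\<close>

definition eigenbasis :: "('a::euclidean_space \<Rightarrow> 'a) \<Rightarrow> 'a set \<Rightarrow> ('a \<Rightarrow> real) \<Rightarrow> 'a set \<Rightarrow> bool" where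
  "eigenbasis f B lam S \<longleftrightarrow> finite B \<and> B \<subseteq> S \<and> (\<forall>b\<in>B. \<forall>c\<in>B. b \<bullet> c = (if b = c then 1 else 0)) \<and>
     (\<forall>b\<in>B. f b = lam b *\<^sub>R b) \<and> (\<forall>x\<in>S. x = (\<Sum>b\<in>B. (x \<bullet> b) *\<^sub>R b))"

lemma symmetric_eigenvector_ex:
  fixes f :: "'a::euclidean_space \<Rightarrow> 'a"
  assumes lin: "linear f" and sym: "\<And>x y. f x \<bullet> y = x \<bullet> f y"
    and S: "subspace S" "f ` S \<subseteq> S" "S \<noteq> {0}"
  shows "\<exists>v\<in>S. norm v = 1 \<and> (\<exists>l. f v = l *\<^sub>R v)"
proof -
  interpret linear f by (rule lin)
  obtain x where x: "x \<in> S" "x \<noteq> 0" using S(1,3) subspace_0 by blast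
  have "compact (S \<inter> sphere 0 1)"
    by (intro closed_Int_compact closed_subspace S compact_sphere)
  moreover have "x /\<^sub>R norm x \<in> S \<inter> sphere 0 1"
    using x S(1) by (simp add: subspace_scale)
  moreover have "continuous_on (S \<inter> sphere 0 1) (\<lambda>x. f x \<bullet> x)"
    using linear_continuous_on[of f] lin by (intro continuous_intros) (simp add: linear_conv_bounded_linear)
  ultimately obtain v where v: "v \<in> S" "norm v = 1" and max: "\<And>y. y \<in> S \<Longrightarrow> norm y = 1 \<Longrightarrow> f y \<bullet> y \<le> f v \<bullet> v"
    using continuous_attains_sup[of "S \<inter> sphere 0 1" "\<lambda>x. f x \<bullet> x"] by fastforce
  define l where "l = f v \<bullet> v"
  have max': "f y \<bullet> y \<le> l * (y \<bullet> y)" if "y \<in> S" for y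
  proof (cases "y = 0")
    case False
    have "f (y /\<^sub>R norm y) \<bullet> (y /\<^sub>R norm y) \<le> l"
      unfolding l_def using that S(1) False by (intro max) (auto simp: subspace_scale)
    then have "(f y \<bullet> y) / (norm y)\<^sup>2 \<le> l"
      by (simp add: scale power2_eq_square divide_inverse mult_ac)
    then show ?thesis using False by (simp add: divide_le_eq power2_norm_eq_inner)
  qed (simp add: zero)
  \<comment> \<open>The residual lies in S and is orthogonal to v. A move from the maximiser v in
    its direction would raise the Rayleigh quotient to first order, so it must vanish.\<close>
  define w where "w = f v - l *\<^sub>R v"
  have wS: "w \<in> S" unfolding w_def using v(1) S by (intro subspace_diff subspace_scale) auto
  have vv: "v \<bullet> v = 1" using v(2) by (simp add: norm_eq_1)
  have wv: "w \<bullet> v = 0" by (simp add: w_def l_def inner_diff_left vv)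
  have fw: "f v \<bullet> w = w \<bullet> w" by (simp add: w_def inner_diff_left inner_diff_right l_def vv inner_commute)
  have "2 * t * (w \<bullet> w) + t\<^sup>2 * (f w \<bullet> w - l * (w \<bullet> w)) \<le> 0" for t
  proof -
    have "f (v + t *\<^sub>R w) \<bullet> (v + t *\<^sub>R w) \<le> l * ((v + t *\<^sub>R w) \<bullet> (v + t *\<^sub>R w))"
      using S(1) v(1) wS by (intro max') (simp add: subspace_add subspace_scale)
    moreover have "f w \<bullet> v = w \<bullet> w" using sym[of w v] fw by (simp add: inner_commute)
    ultimately show ?thesis
      using wv fw vv by (simp add: add scale inner_add_left inner_add_right inner_commute[of v w] l_def[symmetric] algebra_simps power2_eq_square)
  qed
  note q = this
  have "w = 0"
  proof (rule ccontr)
    assume "w \<noteq> 0"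
    then have pos: "w \<bullet> w > 0" by simp
    \<comment> \<open>After division by t, the first order gain is 2 (w \<bullet> w); with t c = w
      \<bullet> w the second order term is at least - (w \<bullet> w).\<close>
    define c where "c = \<bar>f w \<bullet> w - l * (w \<bullet> w)\<bar> + 1"
    define t where "t = (w \<bullet> w) / c"
    have c: "c > 0" by (simp add: c_def)
    have t: "t > 0" using pos c by (simp add: t_def)
    have "t * (2 * (w \<bullet> w) + t * (f w \<bullet> w - l * (w \<bullet> w))) \<le> 0"
      using q[of t] by (simp add: algebra_simps power2_eq_square)
    then have "2 * (w \<bullet> w) + t * (f w \<bullet> w - l * (w \<bullet> w)) \<le> 0"
      using t by (simp add: mult_le_0_iff)
    moreover have "t * (f w \<bullet> w - l * (w \<bullet> w)) \<ge> - (t * c)"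
    proof -
      have "t * (f w \<bullet> w - l * (w \<bullet> w)) \<ge> t * (- c)"
        using t by (intro mult_left_mono) (auto simp: c_def)
      then show ?thesis by simp
    qed
    moreover have "t * c = w \<bullet> w" using c by (simp add: t_def)
    ultimately show False using pos by linarith
  qed
  then show ?thesis using v by (auto simp: w_def)
qed

lemma eigenbasis_ex:
  fixes f :: "'a::euclidean_space \<Rightarrow> 'a"
  assumes lin: "linear f" and sym: "\<And>x y. f x \<bullet> y = x \<bullet> f y"
    and "subspace S" "f ` S \<subseteq> S"
  shows "\<exists>B lam. eigenbasis f B lam S"
  using assms(3,4)
proof (induction "dim S" arbitrary: S rule: less_induct)
  case (less S)
  show ?case
  proof (cases "S = {0}")
    case True
    then show ?thesis by (intro exI[of _ "{}"]) (auto simp: eigenbasis_def)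
  next
    case False
    then obtain v l where v: "v \<in> S" "norm v = 1" "f v = l *\<^sub>R v"
      using symmetric_eigenvector_ex[OF lin sym less.prems] by blast
    have vv: "v \<bullet> v = 1" using v(2) by (simp add: norm_eq_1)
    define S' where "S' = {x \<in> S. x \<bullet> v = 0}"
    have sub: "subspace S'"
      using less.prems(1) unfolding S'_def subspace_def by (auto simp: inner_add_left)
    have inv: "f ` S' \<subseteq> S'"
      using less.prems(2) by (auto simp: S'_def sym v(3))
    have "dim S' < dim S"
    proof (rule ccontr)
      assume "\<not> dim S' < dim S"
      then have "S' = S"
        by (intro subspace_dim_equal sub less.prems(1)) (auto simp: S'_def)
      then have "v \<in> S'" using v(1) by simp
      then show False using vv by (simp add: S'_def)
    qed
    from less.hyps[OF this sub inv] obtain B lam where B: "eigenbasis f B lam S'" by blast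
    define lam' where "lam' b = (if b = v then l else lam b)" for b
    have vB: "v \<notin> B" using B vv by (auto simp: eigenbasis_def S'_def)
    have Bv: "b \<bullet> v = 0" "v \<bullet> b = 0" if "b \<in> B" for b
      using B that by (auto simp: eigenbasis_def S'_def inner_commute)
    have "eigenbasis f (insert v B) lam' S"
      unfolding eigenbasis_def
    proof (intro conjI ballI)
      show "finite (insert v B)" "insert v B \<subseteq> S" using B v(1) by (auto simp: eigenbasis_def S'_def)
      fix b assume b: "b \<in> insert v B"
      show "f b = lam' b *\<^sub>R b" using b B v(3) by (auto simp: eigenbasis_def lam'_def)
      fix c assume c: "c \<in> insert v B"
      show "b \<bullet> c = (if b = c then 1 else 0)"
        using b c B Bv vv by (auto simp: eigenbasis_def)
    next
      fix x assume x: "x \<in> S"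
      define y where "y = x - (x \<bullet> v) *\<^sub>R v"
      have "y \<in> S'" using x v(1) less.prems(1) vv
        by (auto simp: S'_def y_def inner_diff_left intro!: subspace_diff subspace_scale)
      then have "y = (\<Sum>b\<in>B. (y \<bullet> b) *\<^sub>R b)" using B by (auto simp: eigenbasis_def)
      also have "\<dots> = (\<Sum>b\<in>B. (x \<bullet> b) *\<^sub>R b)"
        by (intro sum.cong) (auto simp: y_def inner_diff_left Bv)
      finally show "x = (\<Sum>b\<in>insert v B. (x \<bullet> b) *\<^sub>R b)"
        using vB B by (simp add: eigenbasis_def y_def algebra_simps)
    qed
    then show ?thesis by blast
  qed
qed

lemma eigenbasis_inner:
  assumes "eigenbasis f B lam UNIV"
  shows "x \<bullet> y = (\<Sum>b\<in>B. (x \<bullet> b) * (y \<bullet> b))"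
proof -
  have "x \<bullet> y = (\<Sum>b\<in>B. (x \<bullet> b) *\<^sub>R b) \<bullet> y"
    using assms by (simp add: eigenbasis_def)
  then show ?thesis by (simp add: inner_sum_left inner_sum_right inner_commute)
qed

lemma eigenbasis_sum_component:
  assumes "eigenbasis f B lam UNIV" "b \<in> B"
  shows "(\<Sum>c\<in>B. g c *\<^sub>R c) \<bullet> b = g b"
proof -
  have "(\<Sum>c\<in>B. g c *\<^sub>R c) \<bullet> b = (\<Sum>c\<in>B. if c = b then g b else 0)"
    unfolding inner_sum_left using assms by (intro sum.cong) (auto simp: eigenbasis_def)
  then show ?thesis using assms by (simp add: eigenbasis_def)
qed

section \<open>Complex eigenspaces of a real skew matrix\<close>

lemma linear_cvec: "linear cvec"
  by (rule linearI) (simp_all add: cvec_def vec_eq_iff complex_eq_iff)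

lemma inner_cvec: "cvec x \<bullet> cvec y = x \<bullet> y"
  by (simp add: inner_vec_def cvec_def inner_complex_def)

definition cmat :: "real^'n^'m \<Rightarrow> complex^'n^'m" where
  "cmat T = (\<chi> a b. complex_of_real (T $ a $ b))"

lemma cmat_mult_cvec: "cmat T *v cvec x = cvec (T *v x)"
  by (simp add: cmat_def cvec_def matrix_vector_mult_def vec_eq_iff)

lemma cvec_inner_smult: "(c *s v) \<bullet> w = v \<bullet> (cnj c *s (w :: complex^'n))"
  unfolding inner_vec_def by (intro sum.cong) (auto simp: inner_complex_def algebra_simps)

lemma of_real_smult: "complex_of_real r *s v = r *\<^sub>R v"
  by (simp add: vec_eq_iff complex_eq_iff)

lemma skew_component:
  fixes T :: "'a::ring_1^'n^'n"
  assumes "transpose T = - T"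
  shows "T $ j $ i = - (T $ i $ j)"
  using arg_cong[OF assms, of "\<lambda>A. A $ i $ j"] by (simp add: transpose_def)

lemma of_real_mult_inner:
  "(complex_of_real r * z) \<bullet> w = r * (z \<bullet> w)" "z \<bullet> (complex_of_real r * w) = r * (z \<bullet> w)"
  by (simp_all add: scaleR_conv_of_real[symmetric])

lemma skew_cmat_inner:
  fixes T :: "real^'n^'n"
  assumes "transpose T = - T"
  shows "(cmat T *v v) \<bullet> w = - (v \<bullet> (cmat T *v w))"
proof -
  have "(cmat T *v v) \<bullet> w = (\<Sum>i\<in>UNIV. \<Sum>j\<in>UNIV. T $ i $ j * (v $ j \<bullet> w $ i))"
    unfolding inner_vec_def matrix_vector_mult_def cmat_def
    by (simp add: inner_sum_left of_real_mult_inner)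
  also have "\<dots> = (\<Sum>j\<in>UNIV. \<Sum>i\<in>UNIV. - (T $ j $ i * (v $ j \<bullet> w $ i)))"
    by (subst sum.swap, intro sum.cong refl, subst skew_component[OF assms], simp)
  also have "\<dots> = - (v \<bullet> (cmat T *v w))"
    unfolding inner_vec_def matrix_vector_mult_def cmat_def
    by (simp add: inner_sum_right of_real_mult_inner sum_negf)
  finally show ?thesis .
qed

lemma skew_inner:
  fixes T :: "real^'n^'n"
  assumes "transpose T = - T"
  shows "(T *v x) \<bullet> y = - (x \<bullet> (T *v y))"
  using skew_cmat_inner[OF assms, of "cvec x" "cvec y"] by (simp add: cmat_mult_cvec inner_cvec)

lemma matrix_vector_mul_linear_complex: "linear (\<lambda>v. (A :: complex^'n^'m) *v v)"
  by (intro bounded_linear.linear matrix_vector_mul_bounded_linear)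

lemma subspace_eigenspace: "subspace (eigenspace A \<kappa>)"
proof -
  have e: "A *v (c *\<^sub>R v) = c *\<^sub>R (A *v v)" for c v
    using linear_scale[OF matrix_vector_mul_linear_complex] .
  have e': "c *\<^sub>R (\<kappa> *s v) = \<kappa> *s (c *\<^sub>R v)" for c v
    by (simp add: vec_eq_iff)
  show ?thesis
    by (simp add: subspace_def eigenspace_def matrix_vector_right_distrib vector_add_ldistrib e e')
qed

lemma eigenspace_smult: "v \<in> eigenspace A \<kappa> \<Longrightarrow> c *s v \<in> eigenspace A \<kappa>"
  by (simp add: eigenspace_def vector_scalar_commute vector_smult_assoc mult.commute)

lemma closest_point_subspace_eqI:
  fixes E :: "'a::euclidean_space set"
  assumes "subspace E" "p \<in> E" "\<And>w. w \<in> E \<Longrightarrow> (v - p) \<bullet> w = 0"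
  shows "closest_point E v = p"
proof (rule closest_point_unique[symmetric])
  show "\<forall>z\<in>E. dist v p \<le> dist v z"
  proof
    fix z assume "z \<in> E"
    then have "(v - p) \<bullet> (p - z) = 0" using assms by (intro assms(3)) (auto intro: subspace_diff)
    then have "(norm (v - z))\<^sup>2 = (norm (v - p))\<^sup>2 + (norm (p - z))\<^sup>2"
      using norm_add_Pythagorean[of "v - p" "p - z"] by (simp add: orthogonal_def)
    then have "(norm (v - p))\<^sup>2 \<le> (norm (v - z))\<^sup>2" by simp
    then show "dist v p \<le> dist v z" unfolding dist_norm by (rule power2_le_imp_le) simp
  qed
qed (use assms in \<open>auto simp: closed_subspace subspace_imp_convex\<close>)

lemma closest_point_subspace:
  fixes E :: "'a::euclidean_space set"
  assumes E: "subspace E"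
  shows "closest_point E v \<in> E" "w \<in> E \<Longrightarrow> (v - closest_point E v) \<bullet> w = 0"
proof -
  show cp: "closest_point E v \<in> E"
    using E by (intro closest_point_in_set closed_subspace) (auto dest: subspace_0)
  assume w: "w \<in> E"
  have "(v - closest_point E v) \<bullet> (x - closest_point E v) \<le> 0" if "x \<in> E" for x
    using E that by (intro closest_point_dot closed_subspace subspace_imp_convex)
  from this[of "closest_point E v + w"] this[of "closest_point E v - w"]
  show "(v - closest_point E v) \<bullet> w = 0"
    using E cp w by (simp add: subspace_add subspace_diff)
qed

lemma closest_point_subspace_add:
  fixes E :: "'a::euclidean_space set"
  assumes E: "subspace E"
  shows "closest_point E (v + w) = closest_point E v + closest_point E w"
proof (rule closest_point_subspace_eqI[OF E])
  show "closest_point E v + closest_point E w \<in> E"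
    by (intro subspace_add[OF E] closest_point_subspace[OF E])
  fix u assume "u \<in> E"
  then have "(v - closest_point E v) \<bullet> u + (w - closest_point E w) \<bullet> u = 0"
    by (simp only: closest_point_subspace(2)[OF E] add_0)
  then show "(v + w - (closest_point E v + closest_point E w)) \<bullet> u = 0"
    by (simp add: inner_diff_left inner_add_left)
qed

text \<open>The inner product is only the real part of the Hermitian one. Real orthogonality to an
  eigenspace still has its complex meaning, because the eigenspace contains every complex multiple
  of its vectors; hence the projection commutes with complex scalars.\<close>

lemma closest_point_eigenspace_smult:
  "closest_point (eigenspace A \<kappa>) (c *s v) = c *s closest_point (eigenspace A \<kappa>) v"
proof (rule closest_point_subspace_eqI)
  note E = closest_point_subspace[OF subspace_eigenspace[of A \<kappa>]]
  show "c *s closest_point (eigenspace A \<kappa>) v \<in> eigenspace A \<kappa>"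
    by (intro eigenspace_smult E)
  fix w assume "w \<in> eigenspace A \<kappa>"
  then have "(v - closest_point (eigenspace A \<kappa>) v) \<bullet> (cnj c *s w) = 0"
    by (intro E eigenspace_smult)
  then show "(c *s v - c *s closest_point (eigenspace A \<kappa>) v) \<bullet> w = 0"
    by (simp add: cvec_inner_smult[symmetric] vector_ssub_ldistrib)
qed (rule subspace_eigenspace)

lemma fun_calc_add: "fun_calc g A (v + w) = fun_calc g A v + fun_calc g A w"
  by (simp add: fun_calc_def closest_point_subspace_add subspace_eigenspace vector_add_ldistrib sum.distrib)

lemma fun_calc_smult:
  fixes v :: "complex^'n"
  shows "fun_calc g A (c *s v) = c *s fun_calc g A v"
proof -
  have "a *s (c *s w) = c *s (a *s w)" for a :: complex and w :: "complex^'n"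
    by (simp only: vector_smult_assoc mult.commute)
  then show ?thesis
    unfolding fun_calc_def closest_point_eigenspace_smult vec.scale_sum_right by (intro sum.cong refl)
qed

lemma linear_fun_calc: "linear (fun_calc g A)"
  by (rule linearI) (rule fun_calc_add, metis fun_calc_smult of_real_smult)

context
  fixes T :: "real^'n^'n"
  assumes skew: "transpose T = - T"
begin

lemma eigenspace_skew_inner:
  assumes "v \<in> eigenspace (cmat T) \<kappa>" "w \<in> eigenspace (cmat T) \<kappa>'" "\<kappa> + cnj \<kappa>' \<noteq> 0"
  shows "v \<bullet> w = 0"
proof -
  \<comment> \<open>The skew relation annihilates the real inner product of w with (\<kappa> + cnj
    \<kappa>') times an eigenvector. Dividing v by this number beforehand leaves v itself.\<close>
  define u where "u = (1 / (\<kappa> + cnj \<kappa>')) *s v"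
  have "u \<in> eigenspace (cmat T) \<kappa>" unfolding u_def by (rule eigenspace_smult) fact
  then have "(\<kappa> *s u) \<bullet> w = - ((cnj \<kappa>' *s u) \<bullet> w)"
    using skew_cmat_inner[OF skew, of u w] assms(2) by (simp add: eigenspace_def cvec_inner_smult)
  then have "((\<kappa> + cnj \<kappa>') *s u) \<bullet> w = 0"
    by (simp add: vector_sadd_rdistrib inner_add_left)
  moreover have "(\<kappa> + cnj \<kappa>') *s u = v"
    using assms(3) by (simp add: u_def vector_smult_assoc)
  ultimately show ?thesis by simp
qed

lemma eigenspace_skew_orthogonal:
  assumes "v \<in> eigenspace (cmat T) \<kappa>" "w \<in> eigenspace (cmat T) \<kappa>'" "\<kappa> \<noteq> \<kappa>'"
  shows "v \<bullet> w = 0"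
proof (cases "w = 0")
  case False
  then have "\<kappa>' + cnj \<kappa>' = 0"
    using eigenspace_skew_inner[OF assms(2,2)] by auto
  then have "cnj \<kappa>' = - \<kappa>'" by (simp add: eq_neg_iff_add_eq_0 add.commute)
  then show ?thesis using assms by (intro eigenspace_skew_inner) auto
qed simp

lemma finite_eigenvalues_skew: "finite (eigenvalues (cmat T))"
proof -
  define v where "v \<kappa> = (SOME v. v \<in> eigenspace (cmat T) \<kappa> \<and> v \<noteq> 0)" for \<kappa>
  have v: "v \<kappa> \<in> eigenspace (cmat T) \<kappa>" "v \<kappa> \<noteq> 0" if "\<kappa> \<in> eigenvalues (cmat T)" for \<kappa>
    using someI_ex[of "\<lambda>v. v \<in> eigenspace (cmat T) \<kappa> \<and> v \<noteq> 0"] that unfolding v_def eigenvalues_def by auto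
  have orth: "v \<kappa> \<bullet> v \<kappa>' = 0" if "\<kappa> \<in> eigenvalues (cmat T)" "\<kappa>' \<in> eigenvalues (cmat T)" "\<kappa> \<noteq> \<kappa>'" for \<kappa> \<kappa>'
    using eigenspace_skew_orthogonal[OF v(1)[OF that(1)] v(1)[OF that(2)] that(3)] .
  have "inj_on v (eigenvalues (cmat T))"
  proof (rule inj_onI, rule ccontr)
    fix \<kappa> \<kappa>' assume a: "\<kappa> \<in> eigenvalues (cmat T)" "\<kappa>' \<in> eigenvalues (cmat T)" "v \<kappa> = v \<kappa>'" "\<kappa> \<noteq> \<kappa>'"
    then have "v \<kappa> \<bullet> v \<kappa> = 0" using orth[of \<kappa> \<kappa>'] by simp
    then show False using v(2)[OF a(1)] by simp
  qed
  moreover have "independent (v ` eigenvalues (cmat T))"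
    using orth v(2) by (intro pairwise_orthogonal_independent) (force simp: pairwise_def orthogonal_def)+
  ultimately show ?thesis using independent_imp_finite finite_imageD by blast
qed

lemma fun_calc_eigenvector:
  assumes v: "v \<in> eigenspace (cmat T) \<kappa>"
  shows "fun_calc g (cmat T) v = g \<kappa> *s v"
proof (cases "v = 0")
  case True
  then show ?thesis using linear_0[OF linear_fun_calc] by simp
next
  case False
  have cp: "closest_point (eigenspace (cmat T) \<mu>) v = (if \<mu> = \<kappa> then v else 0)" for \<mu>
    using v eigenspace_skew_orthogonal[OF v]
    by (intro closest_point_subspace_eqI subspace_eigenspace) (auto intro: subspace_0 subspace_eigenspace)
  have "fun_calc g (cmat T) v = (\<Sum>\<mu>\<in>eigenvalues (cmat T). if \<mu> = \<kappa> then g \<kappa> *s v else 0)"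
    unfolding fun_calc_def cp by (intro sum.cong) auto
  moreover have "\<kappa> \<in> eigenvalues (cmat T)" using v False by (auto simp: eigenvalues_def)
  ultimately show ?thesis by (simp add: finite_eigenvalues_skew)
qed

lemma skew_square_inner: "- (T *v (T *v x)) \<bullet> y = (T *v x) \<bullet> (T *v y)"
  using skew_inner[OF skew, of "T *v x" y] by simp

lemma eigenbasis_skew_nonneg:
  assumes "eigenbasis (\<lambda>x. - (T *v (T *v x))) B lam UNIV" "b \<in> B"
  shows "(norm (T *v b))\<^sup>2 = lam b"
proof -
  have "- (T *v (T *v b)) = lam b *\<^sub>R b" "b \<bullet> b = 1" using assms unfolding eigenbasis_def by auto
  then show ?thesis using skew_square_inner[of b b] by (simp add: power2_norm_eq_inner)
qed

text \<open>A basis vector b is an eigenvector of T^2 but in general not of T. For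
  \<open>lam b\<close> > 0, b is half the sum of the two complex vectors b + (1/k) T b, where k is i
  sqrt (lam b) or its negative, and these are eigenvectors of T. As g takes the same real value at
  both, the functional calculus acts on b as the scalar \<open>G (lam b)\<close>.\<close>

lemma fun_calc_eigenbasis:
  assumes B: "eigenbasis (\<lambda>x. - (T *v (T *v x))) B lam UNIV"
    and g: "\<And>b. b \<in> B \<Longrightarrow> g (\<i> * sqrt (lam b)) = of_real (G (lam b))"
      "\<And>b. b \<in> B \<Longrightarrow> g (- (\<i> * sqrt (lam b))) = of_real (G (lam b))"
  shows "fun_calc g (cmat T) (cvec x) \<bullet> cvec x = (\<Sum>b\<in>B. G (lam b) * (x \<bullet> b)\<^sup>2)"
proof -
  have b: "fun_calc g (cmat T) (cvec b) = G (lam b) *\<^sub>R cvec b" if "b \<in> B" for b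
  proof (cases "lam b = 0")
    case True
    then have "T *v b = 0" using eigenbasis_skew_nonneg[OF B that] by simp
    then have "cvec b \<in> eigenspace (cmat T) 0"
      using linear_0[OF linear_cvec] by (simp add: eigenspace_def cmat_mult_cvec)
    from fun_calc_eigenvector[OF this, of g] show ?thesis
      using g(1)[OF that] True by (simp add: of_real_smult)
  next
    case False
    define \<kappa> where "\<kappa> = \<i> * sqrt (lam b)"
    have lam: "lam b > 0"
      using False zero_le_power2[of "norm (T *v b)"] unfolding eigenbasis_skew_nonneg[OF B that] by linarith
    have k: "\<kappa> \<noteq> 0" "\<kappa> * \<kappa> = - of_real (lam b)"
    proof -
      show "\<kappa> \<noteq> 0" using lam by (simp add: \<kappa>_def)
      have "complex_of_real (sqrt (lam b)) * of_real (sqrt (lam b)) = of_real (lam b)"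
        using lam unfolding of_real_mult[symmetric] by simp
      then have "(\<i> * \<i>) * (complex_of_real (sqrt (lam b)) * of_real (sqrt (lam b))) = - of_real (lam b)"
        by simp
      then show "\<kappa> * \<kappa> = - of_real (lam b)" unfolding \<kappa>_def by (simp only: mult.assoc mult.left_commute)
    qed
    have "- (T *v (T *v b)) = lam b *\<^sub>R b" using B that by (auto simp: eigenbasis_def)
    then have TT: "T *v (T *v b) = - lam b *\<^sub>R b" unfolding minus_equation_iff[of "T *v (T *v b)"] by simp
    have E: "cvec b + (1/k) *s cvec (T *v b) \<in> eigenspace (cmat T) k" if k: "k \<noteq> 0" "k * k = - of_real (lam b)" for k
    proof -
      have "(1 / k) *s (- of_real (lam b) *s cvec b) = k *s cvec b"
        unfolding k(2)[symmetric] vector_smult_assoc using k(1) by simp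
      moreover have "cvec (T *v (T *v b)) = - of_real (lam b) *s cvec b"
        unfolding TT linear_scale[OF linear_cvec] of_real_smult[symmetric] by simp
      ultimately have "cmat T *v (cvec b + (1/k) *s cvec (T *v b)) = cvec (T *v b) + k *s cvec b"
        unfolding matrix_vector_right_distrib vector_scalar_commute cmat_mult_cvec by simp
      also have "\<dots> = k *s (cvec b + (1/k) *s cvec (T *v b))"
        unfolding vector_add_ldistrib vector_smult_assoc using k(1) by (simp add: add.commute)
      finally show ?thesis by (simp add: eigenspace_def)
    qed
    have e: "2 *\<^sub>R cvec b = (cvec b + (1/\<kappa>) *s cvec (T *v b)) + (cvec b + (1/(-\<kappa>)) *s cvec (T *v b))"
      by (simp add: vec_eq_iff scaleR_2)
    then have "fun_calc g (cmat T) (2 *\<^sub>R cvec b)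
        = of_real (G (lam b)) *s (cvec b + (1/\<kappa>) *s cvec (T *v b)) + of_real (G (lam b)) *s (cvec b + (1/(-\<kappa>)) *s cvec (T *v b))"
      using fun_calc_eigenvector[OF E[of \<kappa>], of g] fun_calc_eigenvector[OF E[of "- \<kappa>"], of g] k g[OF that]
      by (simp only: fun_calc_add \<kappa>_def minus_mult_minus neg_equal_0_iff_equal simp_thms)
    also have "\<dots> = G (lam b) *\<^sub>R (2 *\<^sub>R cvec b)"
      unfolding e of_real_smult scaleR_add_right ..
    finally have "fun_calc g (cmat T) (2 *\<^sub>R cvec b) = G (lam b) *\<^sub>R (2 *\<^sub>R cvec b)" .
    then have "2 *\<^sub>R fun_calc g (cmat T) (cvec b) = 2 *\<^sub>R (G (lam b) *\<^sub>R cvec b)"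
      unfolding linear_scale[OF linear_fun_calc] by (simp only: scaleR_left_commute)
    then show ?thesis by (rule scaleR_left_imp_eq[rotated]) simp
  qed
  have "x = (\<Sum>b\<in>B. (x \<bullet> b) *\<^sub>R b)" using B unfolding eigenbasis_def by blast
  then have "cvec x = cvec (\<Sum>b\<in>B. (x \<bullet> b) *\<^sub>R b)" by (rule arg_cong)
  also have "\<dots> = (\<Sum>b\<in>B. (x \<bullet> b) *\<^sub>R cvec b)"
    by (simp only: linear_sum[OF linear_cvec] linear_scale[OF linear_cvec])
  finally have "cvec x = (\<Sum>b\<in>B. (x \<bullet> b) *\<^sub>R cvec b)" .
  then have "fun_calc g (cmat T) (cvec x) = (\<Sum>b\<in>B. (x \<bullet> b) *\<^sub>R (G (lam b) *\<^sub>R cvec b))"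
    by (simp only: linear_sum[OF linear_fun_calc] linear_scale[OF linear_fun_calc] b cong: sum.cong)
  then show ?thesis
    by (simp add: inner_sum_left inner_cvec power2_eq_square inner_commute[of _ x] mult_ac)
qed

end

text \<open>Serves to reduce both U(tau) = i T and U(i tau) = - T to the one skew matrix T, so that
  spectral facts are established for skew matrices only.\<close>

lemma fun_calc_scalar_mult:
  assumes c: "c \<noteq> 0" and C: "\<And>v. C *v v = c *s (A *v v)"
  shows "fun_calc g C = fun_calc (\<lambda>\<kappa>. g (c * \<kappa>)) A"
proof -
  have es: "eigenspace C (c * \<kappa>) = eigenspace A \<kappa>" for \<kappa>
  proof -
    have "c *s (A *v v) = (c * \<kappa>) *s v \<longleftrightarrow> A *v v = \<kappa> *s v" for v
      using c vec.scale_cancel_left[of c "A *v v" "\<kappa> *s v"] by (simp add: vector_smult_assoc)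
    then show ?thesis by (simp add: eigenspace_def C)
  qed
  have ev: "eigenvalues C = (\<lambda>\<kappa>. c * \<kappa>) ` eigenvalues A"
  proof (intro set_eqI iffI)
    fix \<mu> assume "\<mu> \<in> eigenvalues C"
    moreover have m: "\<mu> = c * (\<mu> / c)" using c by simp
    ultimately have "\<mu> / c \<in> eigenvalues A"
      using es[of "\<mu> / c"] by (simp add: eigenvalues_def)
    then show "\<mu> \<in> (\<lambda>\<kappa>. c * \<kappa>) ` eigenvalues A"
      using m by (rule rev_image_eqI)
  next
    fix \<mu> assume "\<mu> \<in> (\<lambda>\<kappa>. c * \<kappa>) ` eigenvalues A"
    then show "\<mu> \<in> eigenvalues C" by (auto simp: eigenvalues_def es)
  qed
  have "inj_on (\<lambda>\<kappa>. c * \<kappa>) (eigenvalues A)" using c by (auto simp: inj_on_def)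
  then show ?thesis
    by (intro ext) (simp add: fun_calc_def ev sum.reindex es)
qed

section \<open>The quadratic form of \<open>R\<^sub>k(U(i\<tau>))\<close>\<close>

text \<open>The real skew matrix behind \<open>U_tilde\<close>; it keeps all later estimates over
  the reals.\<close>

definition T_mat :: "('m::finite \<Rightarrow> real^'q^'q) \<Rightarrow> real^'m \<Rightarrow> real^'q^'q" where
  "T_mat U \<tau> = (\<chi> a b. \<Sum>j\<in>UNIV. \<tau> $ j * U j $ a $ b)"

definition freq :: "('m::finite \<Rightarrow> real^'q^'q) \<Rightarrow> real^'m \<Rightarrow> real" where
  "freq U \<tau> = op_norm (U_mat U (cvec \<tau>))"

definition rho :: "('m::finite \<Rightarrow> real^'q^'q) \<Rightarrow> nat \<Rightarrow> real^'m \<Rightarrow> real^'q \<Rightarrow> real" where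
  "rho U k \<tau> s = fun_calc_form (R_fun k) (U_mat U (\<i> *s cvec \<tau>)) s"

lemma T_mat_mult_eq: "T_mat U \<tau> *v x = (\<Sum>j\<in>UNIV. \<tau> $ j *\<^sub>R (U j *v x))"
proof -
  have "(\<Sum>i\<in>UNIV. (\<Sum>j\<in>UNIV. \<tau> $ j * U j $ a $ i) * x $ i) = (\<Sum>j\<in>UNIV. \<tau> $ j * (\<Sum>i\<in>UNIV. U j $ a $ i * x $ i))" for a
    by (simp add: sum_distrib_left sum_distrib_right mult.assoc) (rule sum.swap)
  then show ?thesis by (simp add: vec_eq_iff T_mat_def matrix_vector_mult_def sum_component)
qed

lemma T_mat_add: "T_mat U (\<tau> + \<sigma>) *v x = T_mat U \<tau> *v x + T_mat U \<sigma> *v x"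
  by (simp add: T_mat_mult_eq scaleR_add_left sum.distrib)

lemma T_mat_scaleR: "T_mat U (c *\<^sub>R \<tau>) *v x = c *\<^sub>R (T_mat U \<tau> *v x)"
  by (simp add: T_mat_mult_eq scaleR_sum_right)

lemma U_pair_inner: "U_pair U x y \<bullet> \<tau> = (T_mat U \<tau> *v x) \<bullet> y"
  by (simp add: U_pair_def T_mat_mult_eq inner_vec_def[of _ \<tau>] inner_sum_left mult.commute)

lemma U_mat_real: "U_mat U (cvec \<tau>) *v v = \<i> *s (cmat (T_mat U \<tau>) *v v)"
proof -
  have "U_mat U (cvec \<tau>) $ a $ b = \<i> * cmat (T_mat U \<tau>) $ a $ b" for a b
    by (simp add: U_mat_def U_tilde_def cmat_def T_mat_def cvec_def)
  then show ?thesis by (simp add: vec_eq_iff matrix_vector_mult_def sum_distrib_left mult.assoc)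
qed

lemma U_mat_imag: "U_mat U (\<i> *s cvec \<tau>) *v v = (- 1) *s (cmat (T_mat U \<tau>) *v v)"
proof -
  have "U_mat U (\<i> *s cvec \<tau>) $ a $ b = - cmat (T_mat U \<tau>) $ a $ b" for a b
    by (simp add: U_mat_def U_tilde_def cmat_def T_mat_def cvec_def mult.assoc sum_distrib_left[symmetric])
  then show ?thesis by (simp add: vec_eq_iff matrix_vector_mult_def sum_negf)
qed

lemma norm_T_mat_le:
  fixes U :: "'m::finite \<Rightarrow> real^'q^'q"
  shows "norm (T_mat U \<tau> *v x) \<le> freq U \<tau> * norm x"
proof -
  have "norm (U_mat U (cvec \<tau>) *v cvec x) \<le> freq U \<tau> * norm (cvec x)"
    unfolding freq_def op_norm_def by (rule onorm) (rule matrix_vector_mul_bounded_linear)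
  moreover have "norm (cvec y) = norm y" for y :: "real^'q"
    by (simp add: norm_eq_sqrt_inner inner_cvec)
  moreover have "norm (\<i> *s v) = norm v" for v :: "complex^'q"
    by (simp add: norm_vec_def norm_mult)
  ultimately show ?thesis by (simp add: U_mat_real cmat_mult_cvec)
qed

lemma freq_nonneg: "0 \<le> freq U \<tau>"
  unfolding freq_def op_norm_def by (rule onorm_pos_le) (rule matrix_vector_mul_bounded_linear)

lemma U_mat_real_add: "U_mat U (cvec (\<tau> + \<sigma>)) *v v = U_mat U (cvec \<tau>) *v v + U_mat U (cvec \<sigma>) *v v"
proof -
  have "U_mat U (cvec (\<tau> + \<sigma>)) = U_mat U (cvec \<tau>) + U_mat U (cvec \<sigma>)"
    by (simp add: vec_eq_iff U_mat_def U_tilde_def cvec_def algebra_simps sum.distrib)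
  then show ?thesis by (simp add: matrix_vector_mult_add_rdistrib)
qed

lemma U_mat_real_scaleR: "U_mat U (cvec (c *\<^sub>R \<tau>)) *v v = c *\<^sub>R (U_mat U (cvec \<tau>) *v v)"
proof -
  have 1: "cvec (c *\<^sub>R \<tau>) $ j = of_real c * cvec \<tau> $ j" for j
    by (simp add: cvec_def)
  have "U_mat U (cvec (c *\<^sub>R \<tau>)) $ a $ b = of_real c * (U_mat U (cvec \<tau>) $ a $ b)" for a b
    by (simp add: U_mat_def U_tilde_def 1 sum_distrib_left mult_ac)
  then have "U_mat U (cvec (c *\<^sub>R \<tau>)) $ a $ b = c *\<^sub>R (U_mat U (cvec \<tau>) $ a $ b)" for a b
    unfolding scaleR_conv_of_real[of c "U_mat U (cvec \<tau>) $ a $ b"] .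
  then show ?thesis by (simp add: vec_eq_iff matrix_vector_mult_def scaleR_sum_right)
qed

lemma freq_add: "freq U (\<tau> + \<sigma>) \<le> freq U \<tau> + freq U \<sigma>"
  unfolding freq_def op_norm_def U_mat_real_add
  by (intro onorm_triangle matrix_vector_mul_bounded_linear)

lemma freq_scaleR: "freq U (c *\<^sub>R \<tau>) = \<bar>c\<bar> * freq U \<tau>"
  unfolding freq_def op_norm_def U_mat_real_scaleR
  by (intro onorm_scaleR matrix_vector_mul_bounded_linear)

lemma convex_on_freq:
  fixes U :: "'m::finite \<Rightarrow> real^'q^'q"
  shows "convex_on UNIV (freq U)"
  unfolding convex_on_def
proof (intro conjI ballI allI impI)
  fix \<tau> \<sigma> :: "real^'m" and u v :: real
  assume "0 \<le> u" "0 \<le> v"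
  then show "freq U (u *\<^sub>R \<tau> + v *\<^sub>R \<sigma>) \<le> u * freq U \<tau> + v * freq U \<sigma>"
    using freq_add[of U "u *\<^sub>R \<tau>" "v *\<^sub>R \<sigma>"] by (simp add: freq_scaleR)
qed simp

lemma continuous_on_freq: "continuous_on UNIV (freq U)"
  by (rule convex_on_continuous[OF open_UNIV convex_on_freq])

lemma Omega_eq: "Omega U k = {\<tau>. freq U \<tau> < bessel_zero k 1}"
  by (simp add: Omega_def freq_def)

lemma bessel_zero_1_pos: "bessel_zero k 1 > 0"
  unfolding bessel_zero_1 using zero_sq(1)[of k 0] by simp

lemma bessel_zero_1_less: "bessel_zero k 1 < bessel_zero (Suc k) 1"
  unfolding bessel_zero_1 using zero_sq_interlace[of k 0] by simp

lemma open_Omega: "open (Omega U k)"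
  unfolding Omega_eq by (intro open_Collect_less continuous_on_freq continuous_on_const)

lemma convex_Omega: "convex (Omega U k)"
proof (rule convexI)
  fix \<tau> \<sigma> and u v :: real
  assume a: "\<tau> \<in> Omega U k" "\<sigma> \<in> Omega U k" "0 \<le> u" "0 \<le> v" "u + v = 1"
  have "freq U (u *\<^sub>R \<tau> + v *\<^sub>R \<sigma>) \<le> u * freq U \<tau> + v * freq U \<sigma>"
    using convex_on_freq[of U] a by (simp add: convex_on_def)
  also have "\<dots> < bessel_zero k 1"
    using a by (intro convex_bound_lt) (auto simp: Omega_eq)
  finally show "u *\<^sub>R \<tau> + v *\<^sub>R \<sigma> \<in> Omega U k" by (simp add: Omega_eq)
qed

lemma zero_in_Omega: "0 \<in> Omega U k"
  using freq_scaleR[of U 0 0] bessel_zero_1_pos by (simp add: Omega_eq)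

lemma closure_Omega_subset: "closure (Omega U k) \<subseteq> Omega U (Suc k)"
proof -
  have "closed {\<tau>. freq U \<tau> \<le> bessel_zero k 1}"
    by (intro closed_Collect_le continuous_on_freq continuous_on_const)
  then have "closure (Omega U k) \<subseteq> {\<tau>. freq U \<tau> \<le> bessel_zero k 1}"
    by (rule closure_minimal[rotated]) (auto simp: Omega_eq)
  then show ?thesis using bessel_zero_1_less[of k] by (auto simp: Omega_eq)
qed

lemma Omega_mono: "k \<le> n \<Longrightarrow> Omega U k \<subseteq> Omega U n"
  by (rule lift_Suc_mono_le) (use closure_Omega_subset closure_subset in blast)+

lemma Omega_freq_sq: "\<tau> \<in> Omega U k \<Longrightarrow> (freq U \<tau>)\<^sup>2 < zero_sq k 0"
  using power_strict_mono[of "freq U \<tau>" "bessel_zero k 1" 2] freq_nonneg[of U \<tau>]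
  by (simp add: Omega_eq zero_sq_def del: bessel_zero.simps)

lemma eigenbasis_norm:
  assumes "eigenbasis f B lam UNIV"
  shows "(norm x)\<^sup>2 = (\<Sum>b\<in>B. (x \<bullet> b)\<^sup>2)"
  unfolding power2_norm_eq_inner eigenbasis_inner[OF assms, of x x] by (simp add: power2_eq_square)

text \<open>T commutes with G(- T^2) and is skew, so both sides are the quadratic form of G(- T^2)
  (- T^2) at s. The identity trades a factor \<open>lam\<close> against T s; the minimisation over
  the next component and the resolvent formula both rest on it.\<close>

lemma eigenbasis_commute_sum:
  fixes T :: "real^'n^'n"
  assumes skew: "transpose T = - T" and B: "eigenbasis (\<lambda>x. - (T *v (T *v x))) B lam UNIV"
  shows "(\<Sum>b\<in>B. G (lam b) * lam b * (s \<bullet> b)\<^sup>2) = (\<Sum>b\<in>B. G (lam b) * ((T *v s) \<bullet> b)\<^sup>2)"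
proof -
  define P where "P = (\<Sum>c\<in>B. (G (lam c) * (s \<bullet> c)) *\<^sub>R c)"
  have eig: "- (T *v (T *v b)) = lam b *\<^sub>R b" if "b \<in> B" for b
    using B that by (auto simp: eigenbasis_def)
  have linT: "linear (\<lambda>x. T *v x)" by (rule matrix_vector_mul_linear)
  \<comment> \<open>Entries of T between eigenvectors of T^2 vanish unless the eigenvalues agree, so
    G may be evaluated at either one.\<close>
  have off: "G (lam c) * ((T *v c) \<bullet> b) = G (lam b) * ((T *v c) \<bullet> b)" if "b \<in> B" "c \<in> B" for b c
  proof -
    have "lam b * ((T *v c) \<bullet> b) = (T *v c) \<bullet> (- (T *v (T *v b)))"
      unfolding eig[OF that(1)] by simp
    also have "\<dots> = (- (T *v (T *v (T *v c)))) \<bullet> b"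
      using skew_square_inner[OF skew, of "T *v c" b] skew_square_inner[OF skew, of b "T *v c"] by (simp add: inner_commute)
    also have "- (T *v (T *v (T *v c))) = T *v (- (T *v (T *v c)))"
      using linear_neg[OF linT] by simp
    also have "\<dots> \<bullet> b = lam c * ((T *v c) \<bullet> b)"
      unfolding eig[OF that(2)] linear_scale[OF linT] by simp
    finally show ?thesis by (cases "lam b = lam c") auto
  qed
  have TP: "(T *v P) \<bullet> b = G (lam b) * ((T *v s) \<bullet> b)" if b: "b \<in> B" for b
  proof -
    have s: "s = (\<Sum>c\<in>B. (s \<bullet> c) *\<^sub>R c)" using B unfolding eigenbasis_def by blast
    have "(T *v s) \<bullet> b = (T *v (\<Sum>c\<in>B. (s \<bullet> c) *\<^sub>R c)) \<bullet> b"
      by (rule arg_cong[OF s])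
    also have "\<dots> = (\<Sum>c\<in>B. (s \<bullet> c) * ((T *v c) \<bullet> b))"
      by (simp add: linear_sum[OF linT] linear_scale[OF linT] inner_sum_left)
    finally have 1: "(T *v s) \<bullet> b = (\<Sum>c\<in>B. (s \<bullet> c) * ((T *v c) \<bullet> b))" .
    have "(T *v P) \<bullet> b = (\<Sum>c\<in>B. (s \<bullet> c) * (G (lam c) * ((T *v c) \<bullet> b)))"
      unfolding P_def by (simp add: linear_sum[OF linT] linear_scale[OF linT] inner_sum_left mult_ac)
    also have "\<dots> = (\<Sum>c\<in>B. (s \<bullet> c) * (G (lam b) * ((T *v c) \<bullet> b)))"
      using off[OF b] by (intro sum.cong) auto
    also have "\<dots> = G (lam b) * ((T *v s) \<bullet> b)"
      unfolding 1 sum_distrib_left by (intro sum.cong) auto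
    finally show ?thesis .
  qed
  have Pb: "P \<bullet> b = G (lam b) * (s \<bullet> b)" if "b \<in> B" for b
    unfolding P_def by (rule eigenbasis_sum_component[OF B that])
  have "(\<Sum>b\<in>B. G (lam b) * ((T *v s) \<bullet> b)\<^sup>2) = (\<Sum>b\<in>B. ((T *v P) \<bullet> b) * ((T *v s) \<bullet> b))"
    by (intro sum.cong) (auto simp: TP power2_eq_square)
  also have "\<dots> = (T *v P) \<bullet> (T *v s)" by (rule eigenbasis_inner[OF B, symmetric])
  also have "\<dots> = P \<bullet> (- (T *v (T *v s)))"
    using skew_square_inner[OF skew, of s P] by (simp add: inner_commute)
  also have "\<dots> = (\<Sum>b\<in>B. (P \<bullet> b) * ((- (T *v (T *v s))) \<bullet> b))" by (rule eigenbasis_inner[OF B])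
  also have "\<dots> = (\<Sum>b\<in>B. G (lam b) * lam b * (s \<bullet> b)\<^sup>2)"
  proof (intro sum.cong refl)
    fix b assume b: "b \<in> B"
    have "(- (T *v (T *v s))) \<bullet> b = s \<bullet> (- (T *v (T *v b)))"
      using skew_square_inner[OF skew, of s b] skew_square_inner[OF skew, of b s] by (simp add: inner_commute)
    then show "(P \<bullet> b) * ((- (T *v (T *v s))) \<bullet> b) = G (lam b) * lam b * (s \<bullet> b)\<^sup>2"
      unfolding eig[OF b] by (simp add: Pb[OF b] power2_eq_square)
  qed
  finally show ?thesis by simp
qed

lemma transpose_T_mat:
  assumes "step_two_data U"
  shows "transpose (T_mat U \<tau>) = - T_mat U \<tau>"
proof -
  have "U j $ b $ a = - (U j $ a $ b)" for j a b
    using assms by (intro skew_component) (auto simp: step_two_data_def)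
  note neg = this
  have "T_mat U \<tau> $ b $ a = - (T_mat U \<tau> $ a $ b)" for a b
  proof -
    have "\<tau> $ j * U j $ b $ a = - (\<tau> $ j * U j $ a $ b)" for j
      using neg[of j b a] by simp
    then show ?thesis by (simp add: T_mat_def sum_negf)
  qed
  then have "transpose (T_mat U \<tau>) $ a $ b = (- T_mat U \<tau>) $ a $ b" for a b
    unfolding transpose_def vec_lambda_beta vector_uminus_component .
  then show ?thesis unfolding vec_eq_iff by blast
qed

definition spectral :: "('m::finite \<Rightarrow> real^'q^'q) \<Rightarrow> real^'m \<Rightarrow> (real^'q) set \<Rightarrow> (real^'q \<Rightarrow> real) \<Rightarrow> bool" where
  "spectral U \<tau> B lam \<longleftrightarrow> eigenbasis (\<lambda>x. - (T_mat U \<tau> *v (T_mat U \<tau> *v x))) B lam UNIV"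

context
  fixes U :: "'m::finite \<Rightarrow> real^'q^'q"
  assumes U: "step_two_data U"
begin

lemmas skew = transpose_T_mat[OF U]

lemma spectral_ex: "\<exists>B lam. spectral U \<tau> B lam"
  unfolding spectral_def
proof (rule eigenbasis_ex)
  show "linear (\<lambda>x. - (T_mat U \<tau> *v (T_mat U \<tau> *v x)))"
    by (rule linearI) (simp_all add: matrix_vector_right_distrib matrix_vector_mult_scaleR)
  fix x y
  show "(- (T_mat U \<tau> *v (T_mat U \<tau> *v x))) \<bullet> y = x \<bullet> (- (T_mat U \<tau> *v (T_mat U \<tau> *v y)))"
    using skew_square_inner[OF skew, of \<tau> x y] skew_square_inner[OF skew, of \<tau> y x] by (simp add: inner_commute)
qed auto

lemma spectral_lam:
  assumes "spectral U \<tau> B lam" "b \<in> B"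
  shows "0 \<le> lam b" "lam b \<le> (freq U \<tau>)\<^sup>2"
proof -
  have e: "(norm (T_mat U \<tau> *v b))\<^sup>2 = lam b"
    by (rule eigenbasis_skew_nonneg[OF skew]) (use assms in \<open>auto simp: spectral_def\<close>)
  show "0 \<le> lam b" unfolding e[symmetric] by simp
  have "b \<bullet> b = 1" using assms unfolding spectral_def eigenbasis_def by auto
  then have "norm b = 1" by (simp add: norm_eq_1)
  then have "norm (T_mat U \<tau> *v b) \<le> freq U \<tau>" using norm_T_mat_le[of U \<tau> b] by simp
  then show "lam b \<le> (freq U \<tau>)\<^sup>2" unfolding e[symmetric] by (intro power_mono) auto
qed

lemma spectral_lam_less:
  assumes "spectral U \<tau> B lam" "b \<in> B" "\<tau> \<in> Omega U k"
  shows "lam b < zero_sq k 0"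
  using spectral_lam(2)[OF assms(1,2)] Omega_freq_sq[OF assms(3)] by linarith

lemma rho_eq:
  assumes "spectral U \<tau> B lam"
  shows "rho U k \<tau> s = (\<Sum>b\<in>B. R_real k (lam b) * (s \<bullet> b)\<^sup>2)"
proof -
  have "rho U k \<tau> s = fun_calc (\<lambda>\<kappa>. R_fun k (- 1 * \<kappa>)) (cmat (T_mat U \<tau>)) (cvec s) \<bullet> cvec s"
    unfolding rho_def fun_calc_form_def by (subst fun_calc_scalar_mult[OF _ U_mat_imag]) auto
  also have "\<dots> = (\<Sum>b\<in>B. R_real k (lam b) * (s \<bullet> b)\<^sup>2)"
  proof (rule fun_calc_eigenbasis[OF skew, where G="R_real k"])
    show "eigenbasis (\<lambda>x. - (T_mat U \<tau> *v (T_mat U \<tau> *v x))) B lam UNIV"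
      using assms by (simp add: spectral_def)
    fix b assume "b \<in> B"
    then have "0 \<le> lam b" by (rule spectral_lam[OF assms])
    then have "(complex_of_real (sqrt (lam b)))\<^sup>2 = of_real (lam b)" by (simp flip: of_real_power)
    then have "(\<i> * sqrt (lam b))\<^sup>2 = - of_real (lam b)" by (simp add: power_mult_distrib)
    then show "R_fun k (- 1 * (\<i> * sqrt (lam b))) = of_real (R_real k (lam b))"
      "R_fun k (- 1 * - (\<i> * sqrt (lam b))) = of_real (R_real k (lam b))"
      by (auto intro!: R_fun_eq)
  qed
  finally show ?thesis .
qed

text \<open>By x cot x = 1 + R_0 the function phi_0, defined separately through the cotangent,
  becomes the case k = 0 of the formula shared by all phi_k. On \<open>Omega U 0\<close> the roots
  of the eigenvalues stay below pi, where this identity is available.\<close>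

lemma z_cot_form:
  assumes "\<tau> \<in> Omega U 0"
  shows "fun_calc_form z_cot (U_mat U (cvec \<tau>)) x = (norm x)\<^sup>2 + rho U 0 \<tau> x"
proof -
  obtain B lam where B: "spectral U \<tau> B lam" using spectral_ex by blast
  have "fun_calc_form z_cot (U_mat U (cvec \<tau>)) x = fun_calc (\<lambda>\<kappa>. z_cot (\<i> * \<kappa>)) (cmat (T_mat U \<tau>)) (cvec x) \<bullet> cvec x"
    unfolding fun_calc_form_def by (subst fun_calc_scalar_mult[OF _ U_mat_real]) auto
  also have "\<dots> = (\<Sum>b\<in>B. (1 + R_real 0 (lam b)) * (x \<bullet> b)\<^sup>2)"
  proof (rule fun_calc_eigenbasis[OF skew, where G="\<lambda>w. 1 + R_real 0 w"])
    show "eigenbasis (\<lambda>x. - (T_mat U \<tau> *v (T_mat U \<tau> *v x))) B lam UNIV"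
      using B by (simp add: spectral_def)
    fix b assume b: "b \<in> B"
    have l: "0 \<le> lam b" by (rule spectral_lam[OF B b])
    have "lam b < pi\<^sup>2" using spectral_lam_less[OF B b assms] by (simp add: zero_sq_def bessel_zero_0_1[simplified])
    then have "sqrt (lam b) < pi" using l real_sqrt_less_iff[of "lam b" "pi\<^sup>2"] by simp
    have z: "z_cot (of_real y) = of_real (1 + R_real 0 (lam b))" if "y\<^sup>2 = lam b" "\<bar>y\<bar> < pi" for y
    proof (cases "y = 0")
      case False
      then have "R_real 0 (lam b) = y * cot y - 1" using R_real_0_cot[of y] that by simp
      then show ?thesis using False by (simp add: z_cot_def cot_of_real)
    qed (use that in \<open>simp add: z_cot_def\<close>)
    have m: "\<i> * (\<i> * sqrt (lam b)) = complex_of_real (- sqrt (lam b))"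
      "\<i> * - (\<i> * sqrt (lam b)) = complex_of_real (sqrt (lam b))" by (simp_all add: mult.assoc[symmetric])
    show "z_cot (\<i> * (\<i> * sqrt (lam b))) = of_real (1 + R_real 0 (lam b))"
      "z_cot (\<i> * - (\<i> * sqrt (lam b))) = of_real (1 + R_real 0 (lam b))"
      unfolding m by (rule z; use l \<open>sqrt (lam b) < pi\<close> in simp)+
  qed
  also have "\<dots> = (norm x)\<^sup>2 + rho U 0 \<tau> x"
    unfolding eigenbasis_norm[OF B[unfolded spectral_def]] rho_eq[OF B]
    by (simp only: distrib_right sum.distrib mult_1_left)
  finally show ?thesis .
qed

lemma rho_nonpos:
  assumes "\<tau> \<in> Omega U k" "k \<le> n"
  shows "rho U n \<tau> s \<le> 0"
proof -
  obtain B lam where B: "spectral U \<tau> B lam" using spectral_ex by blast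
  have n: "\<tau> \<in> Omega U n" using Omega_mono[OF assms(2)] assms(1) by blast
  show ?thesis
    unfolding rho_eq[OF B]
  proof (rule sum_nonpos)
    fix b assume b: "b \<in> B"
    show "R_real n (lam b) * (s \<bullet> b)\<^sup>2 \<le> 0"
      using R_real_nonpos[OF spectral_lam(1)[OF B b] spectral_lam_less[OF B b n]]
      by (rule mult_nonpos_nonneg) simp
  qed
qed

text \<open>The bound does not depend on the level n. This keeps the constant of
  \<open>defect_bound\<close> fixed while the level grows and the multiplier stays the same.\<close>

lemma rho_lower:
  assumes "\<tau> \<in> Omega U k" "k \<le> n"
  shows "R_real k ((freq U \<tau>)\<^sup>2) * (norm s)\<^sup>2 \<le> rho U n \<tau> s"
proof -
  obtain B lam where B: "spectral U \<tau> B lam" using spectral_ex by blast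
  have "R_real k ((freq U \<tau>)\<^sup>2) * (norm s)\<^sup>2 = (\<Sum>b\<in>B. R_real k ((freq U \<tau>)\<^sup>2) * (s \<bullet> b)\<^sup>2)"
    unfolding eigenbasis_norm[OF B[unfolded spectral_def]] by (rule sum_distrib_left)
  also have "\<dots> \<le> rho U n \<tau> s"
    unfolding rho_eq[OF B]
  proof (rule sum_mono)
    fix b assume b: "b \<in> B"
    show "R_real k ((freq U \<tau>)\<^sup>2) * (s \<bullet> b)\<^sup>2 \<le> R_real n (lam b) * (s \<bullet> b)\<^sup>2"
      by (rule mult_right_mono[OF R_real_mono[OF assms(2) spectral_lam[OF B b] Omega_freq_sq[OF assms(1)]] zero_le_power2])
  qed
  finally show ?thesis .
qed

lemma rho_zero [simp]: "rho U k 0 s = 0"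
proof -
  obtain B lam where B: "spectral U 0 B lam" using spectral_ex by blast
  have "freq U 0 = 0" using freq_scaleR[of U 0 0] by simp
  then have "R_real k (lam b) * (s \<bullet> b)\<^sup>2 = 0" if "b \<in> B" for b
    using spectral_lam[OF B that] by simp
  then show ?thesis unfolding rho_eq[OF B] by (intro sum.neutral ballI)
qed

lemma rho_scaleR: "rho U k \<tau> (c *\<^sub>R s) = c\<^sup>2 * rho U k \<tau> s"
proof -
  obtain B lam where B: "spectral U \<tau> B lam" using spectral_ex by blast
  show ?thesis unfolding rho_eq[OF B] sum_distrib_left
    by (intro sum.cong refl) (simp add: power_mult_distrib)
qed

lemma continuous_rho: "continuous_on UNIV (rho U k \<tau>)"
proof -
  obtain B lam where B: "spectral U \<tau> B lam" using spectral_ex by blast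
  have "rho U k \<tau> = (\<lambda>s. \<Sum>b\<in>B. R_real k (lam b) * (s \<bullet> b)\<^sup>2)" by (intro ext rho_eq[OF B])
  then show ?thesis by (simp only:) (intro continuous_intros)
qed

text \<open>Minimising over the next component \<open>s'\<close> turns \<open>R\<^sub>k\<^sub>+\<^sub>1\<close> into \<open>R\<^sub>k\<close>; this is the
  continued fraction of the Bessel quotient.\<close>
lemma rho_minimum:
  assumes \<tau>: "\<tau> \<in> Omega U k"
  shows "\<exists>s0 c. c > 0 \<and>
    (\<forall>s'. rho U k \<tau> s + c * (norm (s' - s0))\<^sup>2
         \<le> (2 * real k + 3) * (norm s')\<^sup>2 + 2 * ((T_mat U \<tau> *v s) \<bullet> s') + rho U (Suc k) \<tau> s') \<and>
    (2 * real k + 3) * (norm s0)\<^sup>2 + 2 * ((T_mat U \<tau> *v s) \<bullet> s0) + rho U (Suc k) \<tau> s0 = rho U k \<tau> s"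
proof -
  obtain B lam where B: "spectral U \<tau> B lam" using spectral_ex by blast
  note B' = B[unfolded spectral_def]
  have fin: "finite B" using B' by (simp add: eigenbasis_def)
  define m where "m b = 2 * real k + 3 + R_real (Suc k) (lam b)" for b
  define y where "y = T_mat U \<tau> *v s"
  have m: "m b > 0" if "b \<in> B" for b
    unfolding m_def by (intro R_real_denom_pos spectral_lam[OF B that] spectral_lam_less[OF B that \<tau>])
  \<comment> \<open>The recurrence is solved by dividing by m and not by \<open>lam b\<close>, so
    the eigenvalue 0 is included; the factor \<open>lam b\<close> is then moved into T s by
    commutation.\<close>
  have Rk: "R_real k (lam b) = (- 1 / m b) * lam b" if "b \<in> B" for b
  proof -
    have "R_real k (lam b) * m b = - lam b"
      unfolding m_def by (rule R_real_rec[OF spectral_lam_less[OF B that \<tau>]])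
    then have "R_real k (lam b) = - lam b / m b"
      using m[OF that] by (intro eq_divide_imp) auto
    then show ?thesis by simp
  qed
  have rk: "rho U k \<tau> s = (\<Sum>b\<in>B. (- 1 / m b) * (y \<bullet> b)\<^sup>2)"
  proof -
    have "rho U k \<tau> s = (\<Sum>b\<in>B. (- 1 / m b) * lam b * (s \<bullet> b)\<^sup>2)"
      unfolding rho_eq[OF B] by (intro sum.cong) (auto simp: Rk)
    also have "\<dots> = (\<Sum>b\<in>B. (- 1 / m b) * (y \<bullet> b)\<^sup>2)"
      unfolding y_def m_def
      by (rule eigenbasis_commute_sum[OF skew B', of "\<lambda>w. - 1 / (2 * real k + 3 + R_real (Suc k) w)"])
    finally show ?thesis .
  qed
  define s0 where "s0 = (\<Sum>b\<in>B. (- (y \<bullet> b) / m b) *\<^sub>R b)"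
  have s0: "s0 \<bullet> b = - (y \<bullet> b) / m b" if "b \<in> B" for b
    unfolding s0_def by (rule eigenbasis_sum_component[OF B' that])
  define F where "F s' = (2 * real k + 3) * (norm s')\<^sup>2 + 2 * (y \<bullet> s') + rho U (Suc k) \<tau> s'" for s'
  have F: "F s' - rho U k \<tau> s = (\<Sum>b\<in>B. m b * ((s' - s0) \<bullet> b)\<^sup>2)" for s'
  proof -
    have "F s' - rho U k \<tau> s = (\<Sum>b\<in>B. (2 * real k + 3) * (s' \<bullet> b)\<^sup>2 + 2 * ((y \<bullet> b) * (s' \<bullet> b))
        + R_real (Suc k) (lam b) * (s' \<bullet> b)\<^sup>2 - (- 1 / m b) * (y \<bullet> b)\<^sup>2)"
      unfolding F_def rk unfolding rho_eq[OF B] eigenbasis_norm[OF B'] eigenbasis_inner[OF B', of y s']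
      by (simp only: sum_distrib_left sum.distrib[symmetric] sum_subtractf[symmetric])
    also have "\<dots> = (\<Sum>b\<in>B. m b * ((s' - s0) \<bullet> b)\<^sup>2)"
    proof (intro sum.cong refl)
      fix b assume b: "b \<in> B"
      have "m b * (u + v / m b)\<^sup>2 = m b * u\<^sup>2 + 2 * (v * u) - (- 1 / m b) * v\<^sup>2" for u v
        using m[OF b] by (simp add: power2_eq_square field_simps)
      from this[of "s' \<bullet> b" "y \<bullet> b"]
      show "(2 * real k + 3) * (s' \<bullet> b)\<^sup>2 + 2 * ((y \<bullet> b) * (s' \<bullet> b))
        + R_real (Suc k) (lam b) * (s' \<bullet> b)\<^sup>2 - (- 1 / m b) * (y \<bullet> b)\<^sup>2 = m b * ((s' - s0) \<bullet> b)\<^sup>2"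
        unfolding inner_diff_left s0[OF b] by (simp add: m_def distrib_right)
    qed
    finally show ?thesis .
  qed
  \<comment> \<open>The least curvature over all eigendirections gives the modulus of strict
    convexity; the inserted 1 keeps the set nonempty.\<close>
  define c where "c = Min (insert 1 (m ` B))"
  have c: "c > 0" "\<And>b. b \<in> B \<Longrightarrow> c \<le> m b" using fin m by (auto simp: c_def)
  have "rho U k \<tau> s + c * (norm (s' - s0))\<^sup>2 \<le> F s'" for s'
  proof -
    have "c * (norm (s' - s0))\<^sup>2 = (\<Sum>b\<in>B. c * ((s' - s0) \<bullet> b)\<^sup>2)"
      unfolding eigenbasis_norm[OF B'] by (rule sum_distrib_left)
    also have "\<dots> \<le> (\<Sum>b\<in>B. m b * ((s' - s0) \<bullet> b)\<^sup>2)"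
      by (intro sum_mono mult_right_mono c) auto
    finally show ?thesis using F[of s'] by linarith
  qed
  moreover have "F s0 = rho U k \<tau> s" using F[of s0] by simp
  ultimately show ?thesis unfolding F_def y_def using c(1) by blast
qed

lemma rho_sums:
  assumes "spectral U \<tau> B lam"
  shows "(\<lambda>l. - 2 * (\<Sum>b\<in>B. lam b / (zero_sq k l - lam b) * (s \<bullet> b)\<^sup>2)) sums rho U k \<tau> s"
proof -
  have "(\<lambda>l. \<Sum>b\<in>B. lam b / (zero_sq k l - lam b) * (s \<bullet> b)\<^sup>2) sums
      (\<Sum>b\<in>B. (\<Sum>l. lam b / (zero_sq k l - lam b)) * (s \<bullet> b)\<^sup>2)"
    by (intro sums_sum sums_mult2 summable_sums summable_R_real)
  from sums_mult[OF this, of "- 2"] show ?thesis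
    unfolding rho_eq[OF assms] R_real_def sum_distrib_left mult.assoc[symmetric] .
qed

text \<open>Each term of the series for \<open>R\<^sub>k\<close> is, up to the constant \<open>- (norm s)\<^sup>2\<close>, the maximum
  over \<open>y\<close> of a function that is convex in \<open>\<tau>\<close>; this gives the concavity of \<^const>\<open>rho\<close>.\<close>
lemma resolvent_variational:
  fixes y :: "real^'q"
  assumes B: "spectral U \<tau> B lam" and z: "\<And>b. b \<in> B \<Longrightarrow> lam b < z" "0 < z"
  shows "z * (2 * (s \<bullet> y) - z * (norm y)\<^sup>2 + (norm (T_mat U \<tau> *v y))\<^sup>2) - (norm s)\<^sup>2
      \<le> (\<Sum>b\<in>B. lam b / (z - lam b) * (s \<bullet> b)\<^sup>2)" (is "_ \<le> ?S")
    and "\<exists>y. z * (2 * (s \<bullet> y) - z * (norm y)\<^sup>2 + (norm (T_mat U \<tau> *v y))\<^sup>2) - (norm s)\<^sup>2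
      = (\<Sum>b\<in>B. lam b / (z - lam b) * (s \<bullet> b)\<^sup>2)"
proof -
  let ?F = "\<lambda>y. z * (2 * (s \<bullet> y) - z * (norm y)\<^sup>2 + (norm (T_mat U \<tau> *v y))\<^sup>2) - (norm s)\<^sup>2"
  note B' = B[unfolded spectral_def]
  have Ty: "(norm (T_mat U \<tau> *v y))\<^sup>2 = (\<Sum>b\<in>B. lam b * (y \<bullet> b)\<^sup>2)" for y
    using eigenbasis_commute_sum[OF skew B', of "\<lambda>_. 1" y] by (simp add: eigenbasis_norm[OF B'])
  have e: "?S - ?F y = (\<Sum>b\<in>B. z * (z - lam b) * ((s \<bullet> b) / (z - lam b) - y \<bullet> b)\<^sup>2)" for y
  proof -
    have "?S - ?F y = (\<Sum>b\<in>B. lam b / (z - lam b) * (s \<bullet> b)\<^sup>2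
        - (z * (2 * ((s \<bullet> b) * (y \<bullet> b)) - z * (y \<bullet> b)\<^sup>2 + lam b * (y \<bullet> b)\<^sup>2) - (s \<bullet> b)\<^sup>2))"
      unfolding Ty unfolding eigenbasis_norm[OF B'] eigenbasis_inner[OF B', of s y]
      by (simp only: sum_distrib_left sum.distrib[symmetric] sum_subtractf[symmetric])
    also have "\<dots> = (\<Sum>b\<in>B. z * (z - lam b) * ((s \<bullet> b) / (z - lam b) - y \<bullet> b)\<^sup>2)"
    proof (intro sum.cong refl)
      fix b assume "b \<in> B"
      then have d: "z - lam b \<noteq> 0" using z(1)[of b] by simp
      have "l / d * u\<^sup>2 - ((d + l) * (2 * (u * v) - (d + l) * v\<^sup>2 + l * v\<^sup>2) - u\<^sup>2) = (d + l) * d * (u / d - v)\<^sup>2"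
        if "d \<noteq> 0" for d l u v :: real
      proof -
        have "(d + l) * d * (u / d - v)\<^sup>2 = (d + l) * (u\<^sup>2 / d - 2 * (u * v) + d * v\<^sup>2)"
          using that by (simp add: power2_eq_square field_simps)
        also have "\<dots> = l / d * u\<^sup>2 - ((d + l) * (2 * (u * v) - (d + l) * v\<^sup>2 + l * v\<^sup>2) - u\<^sup>2)"
          using that by (simp add: power2_eq_square field_simps)
        finally show ?thesis ..
      qed
      from this[OF d, of "lam b" "s \<bullet> b" "y \<bullet> b"]
      show "lam b / (z - lam b) * (s \<bullet> b)\<^sup>2
        - (z * (2 * ((s \<bullet> b) * (y \<bullet> b)) - z * (y \<bullet> b)\<^sup>2 + lam b * (y \<bullet> b)\<^sup>2) - (s \<bullet> b)\<^sup>2)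
        = z * (z - lam b) * ((s \<bullet> b) / (z - lam b) - y \<bullet> b)\<^sup>2"
        by (simp only: diff_add_cancel)
    qed
    finally show ?thesis .
  qed
  show "?F y \<le> ?S"
  proof -
    have "0 \<le> ?S - ?F y" unfolding e
    proof (rule sum_nonneg)
      fix b assume "b \<in> B"
      then show "0 \<le> z * (z - lam b) * ((s \<bullet> b) / (z - lam b) - y \<bullet> b)\<^sup>2"
        using z(1)[of b] z(2) by simp
    qed
    then show ?thesis by simp
  qed
  \<comment> \<open>The resolvent (z + T^2)^(-1) applied to s, which makes every square in the
    difference vanish.\<close>
  define y0 where "y0 = (\<Sum>b\<in>B. ((s \<bullet> b) / (z - lam b)) *\<^sub>R b)"
  have "y0 \<bullet> b = (s \<bullet> b) / (z - lam b)" if "b \<in> B" for b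
    unfolding y0_def by (rule eigenbasis_sum_component[OF B' that])
  then have "?S - ?F y0 = 0" unfolding e by (intro sum.neutral) simp
  then show "\<exists>y. ?F y = ?S" by (intro exI[of _ y0]) simp
qed

lemma norm_sq_convex:
  fixes a b :: "'a::real_inner"
  assumes "0 \<le> u" "0 \<le> v" "u + v = 1"
  shows "(norm (u *\<^sub>R a + v *\<^sub>R b))\<^sup>2 \<le> u * (norm a)\<^sup>2 + v * (norm b)\<^sup>2"
proof -
  have v: "v = 1 - u" using assms by simp
  have "u * (norm a)\<^sup>2 + v * (norm b)\<^sup>2 - (norm (u *\<^sub>R a + v *\<^sub>R b))\<^sup>2 = u * v * (norm (a - b))\<^sup>2"
    unfolding v power2_norm_eq_inner
    by (simp add: inner_add_left inner_add_right inner_diff_left inner_diff_right inner_commute algebra_simps)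
  moreover have "0 \<le> u * v * (norm (a - b))\<^sup>2" using assms by simp
  ultimately show ?thesis by linarith
qed

lemma rho_concave:
  assumes t: "\<tau>1 \<in> Omega U k" "\<tau>2 \<in> Omega U k" and uv: "0 \<le> u" "0 \<le> v" "u + v = 1"
  shows "u * rho U k \<tau>1 s + v * rho U k \<tau>2 s \<le> rho U k (u *\<^sub>R \<tau>1 + v *\<^sub>R \<tau>2) s"
proof -
  define \<tau> where "\<tau> = u *\<^sub>R \<tau>1 + v *\<^sub>R \<tau>2"
  have t': "\<tau> \<in> Omega U k" unfolding \<tau>_def using convexD[OF convex_Omega] t uv by blast
  obtain B lam where B: "spectral U \<tau> B lam" using spectral_ex by blast
  obtain B1 lam1 where B1: "spectral U \<tau>1 B1 lam1" using spectral_ex by blast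
  obtain B2 lam2 where B2: "spectral U \<tau>2 B2 lam2" using spectral_ex by blast
  have less: "lm b < zero_sq k l" if "spectral U \<sigma> C lm" "b \<in> C" "\<sigma> \<in> Omega U k" for \<sigma> C lm b l
    using spectral_lam_less[OF that] zero_sq_le[of k l] by linarith
  have pos: "0 < zero_sq k l" for l by (rule zero_sq(1))
  have le: "(\<Sum>b\<in>B. lam b / (zero_sq k l - lam b) * (s \<bullet> b)\<^sup>2)
      \<le> u * (\<Sum>b\<in>B1. lam1 b / (zero_sq k l - lam1 b) * (s \<bullet> b)\<^sup>2)
      + v * (\<Sum>b\<in>B2. lam2 b / (zero_sq k l - lam2 b) * (s \<bullet> b)\<^sup>2)" (is "?S \<le> u * ?S1 + v * ?S2") for l
  proof -
    define z where "z = zero_sq k l"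
    define F where "F \<sigma> y = z * (2 * (s \<bullet> y) - z * (norm y)\<^sup>2 + (norm (T_mat U \<sigma> *v y))\<^sup>2) - (norm s)\<^sup>2" for \<sigma> y
    \<comment> \<open>The maximiser y for the convex combination is used as a competitor at both end
      points; F is convex in the multiplier because T_mat is linear in it and z > 0. The comparison
      is made separately for each zero, since y depends on it.\<close>
    obtain y where y: "F \<tau> y = ?S"
      using resolvent_variational(2)[OF B less[OF B _ t'] pos, of l s] unfolding F_def z_def by blast
    have "(norm (T_mat U \<tau> *v y))\<^sup>2 \<le> u * (norm (T_mat U \<tau>1 *v y))\<^sup>2 + v * (norm (T_mat U \<tau>2 *v y))\<^sup>2"
      unfolding \<tau>_def T_mat_add T_mat_scaleR by (rule norm_sq_convex[OF uv])
    then have "z * (norm (T_mat U \<tau> *v y))\<^sup>2 \<le> z * (u * (norm (T_mat U \<tau>1 *v y))\<^sup>2 + v * (norm (T_mat U \<tau>2 *v y))\<^sup>2)"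
      using pos[of l] unfolding z_def by (intro mult_left_mono) auto
    moreover have v: "v = 1 - u" using uv by simp
    ultimately have "F \<tau> y \<le> u * F \<tau>1 y + v * F \<tau>2 y"
      unfolding F_def v by (simp add: algebra_simps)
    also have "\<dots> \<le> u * ?S1 + v * ?S2"
    proof (intro add_mono mult_left_mono uv)
      show "F \<tau>1 y \<le> ?S1" unfolding F_def z_def
        by (rule resolvent_variational(1)[OF B1 less[OF B1 _ t(1)] pos])
      show "F \<tau>2 y \<le> ?S2" unfolding F_def z_def
        by (rule resolvent_variational(1)[OF B2 less[OF B2 _ t(2)] pos])
    qed
    finally show ?thesis unfolding y .
  qed
  have "u * rho U k \<tau>1 s + v * rho U k \<tau>2 s \<le> rho U k \<tau> s"
  proof (rule sums_le)
    show "(\<lambda>l. u * (- 2 * (\<Sum>b\<in>B1. lam1 b / (zero_sq k l - lam1 b) * (s \<bullet> b)\<^sup>2))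
        + v * (- 2 * (\<Sum>b\<in>B2. lam2 b / (zero_sq k l - lam2 b) * (s \<bullet> b)\<^sup>2))) sums (u * rho U k \<tau>1 s + v * rho U k \<tau>2 s)"
      by (intro sums_add sums_mult rho_sums[OF B1] rho_sums[OF B2])
    show "(\<lambda>l. - 2 * (\<Sum>b\<in>B. lam b / (zero_sq k l - lam b) * (s \<bullet> b)\<^sup>2)) sums rho U k \<tau> s"
      by (rule rho_sums[OF B])
    fix l
    show "u * (- 2 * (\<Sum>b\<in>B1. lam1 b / (zero_sq k l - lam1 b) * (s \<bullet> b)\<^sup>2))
        + v * (- 2 * (\<Sum>b\<in>B2. lam2 b / (zero_sq k l - lam2 b) * (s \<bullet> b)\<^sup>2))
        \<le> - 2 * (\<Sum>b\<in>B. lam b / (zero_sq k l - lam b) * (s \<bullet> b)\<^sup>2)"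
      using le[of l] by linarith
  qed
  then show ?thesis unfolding \<tau>_def .
qed

end

section \<open>Shifted Legendre polynomials\<close>

text \<open>Bonnet's recurrence for P_j(2 r - 1), the Legendre polynomials transported to the unit
  interval.\<close>

fun legendre :: "nat \<Rightarrow> real poly" where
  "legendre 0 = 1"
| "legendre (Suc 0) = [:-1, 2:]"
| "legendre (Suc (Suc j)) = smult (1 / (real j + 2))
     (smult (2 * real j + 3) ([:-1, 2:] * legendre (Suc j)) - smult (real j + 1) (legendre j))"

abbreviation L :: "nat \<Rightarrow> real \<Rightarrow> real" where "L j r \<equiv> poly (legendre j) r"
abbreviation L' :: "nat \<Rightarrow> real \<Rightarrow> real" where "L' j r \<equiv> poly (pderiv (legendre j)) r"

lemma legendre_rec_poly:
  "smult (real j + 2) (legendre (Suc (Suc j)))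
     = smult (2 * real j + 3) ([:-1, 2:] * legendre (Suc j)) - smult (real j + 1) (legendre j)"
proof -
  have "(real j + 2) * (1 / (real j + 2)) = 1" by (simp add: add_nonneg_eq_0_iff)
  then show ?thesis unfolding legendre.simps(3) smult_smult by (simp only: smult_1_left)
qed

declare legendre.simps(3) [simp del]

lemma legendre_rec: "(real j + 2) * L (Suc (Suc j)) r = (2 * real j + 3) * (2 * r - 1) * L (Suc j) r - (real j + 1) * L j r"
  using arg_cong[OF legendre_rec_poly[of j], of "\<lambda>p. poly p r"] by (simp add: algebra_simps)

lemma legendre_rec_deriv: "(real j + 2) * L' (Suc (Suc j)) r =
    (2 * real j + 3) * (2 * L (Suc j) r + (2 * r - 1) * L' (Suc j) r) - (real j + 1) * L' j r"
  using arg_cong[OF legendre_rec_poly[of j], of "\<lambda>p. poly (pderiv p) r"]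
  unfolding pderiv_smult pderiv_diff pderiv_mult by (simp add: pderiv_pCons algebra_simps)

text \<open>Proved together because the induction step for each identity uses both. Their
  combination gives the derivative of the difference of the polynomials j + 2 and j, and with it the
  antiderivative \<open>legendre_int\<close>.\<close>

lemma legendre_deriv_aux:
  "L' (Suc j) r = (2 * r - 1) * L' j r + 2 * (real j + 1) * L j r \<and>
   (2 * r - 1) * L' (Suc j) r = L' j r + 2 * (real j + 1) * L (Suc j) r"
proof (induction j)
  case 0
  show ?case by (simp add: pderiv_pCons algebra_simps)
next
  case (Suc j)
  let ?x = "2 * r - 1"
  have A: "L' (Suc j) r = ?x * L' j r + 2 * (real j + 1) * L j r"
    and B: "?x * L' (Suc j) r = L' j r + 2 * (real j + 1) * L (Suc j) r" using Suc by auto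
  have "(real j + 2) * L' (Suc (Suc j)) r = (real j + 2) * (?x * L' (Suc j) r + 2 * (real j + 2) * L (Suc j) r)"
  proof -
    have "L' j r = ?x * L' (Suc j) r - 2 * (real j + 1) * L (Suc j) r" using B by linarith
    then show ?thesis unfolding legendre_rec_deriv by (simp only:) (simp add: algebra_simps)
  qed
  then have A': "L' (Suc (Suc j)) r = ?x * L' (Suc j) r + 2 * (real j + 2) * L (Suc j) r"
    by (simp add: add_nonneg_eq_0_iff)
  then have C: "L' (Suc (Suc j)) r = L' j r + 2 * (2 * real j + 3) * L (Suc j) r"
    using B by (simp add: algebra_simps)
  have "?x * L' (Suc (Suc j)) r = ?x * L' j r + 2 * ((2 * real j + 3) * ?x * L (Suc j) r)"
    unfolding C by (simp add: algebra_simps)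
  also have "(2 * real j + 3) * ?x * L (Suc j) r = (real j + 2) * L (Suc (Suc j)) r + (real j + 1) * L j r"
    using legendre_rec[of j r] by linarith
  also have "?x * L' j r = L' (Suc j) r - 2 * (real j + 1) * L j r" using A by linarith
  finally have "?x * L' (Suc (Suc j)) r = L' (Suc j) r + 2 * (real j + 2) * L (Suc (Suc j)) r"
    by (simp add: algebra_simps)
  then show ?case using A' by (simp add: add.commute)
qed

lemma legendre_deriv_diff: "L' (Suc (Suc j)) r - L' j r = 2 * (2 * real j + 3) * L (Suc j) r"
  using legendre_deriv_aux[of j r] legendre_deriv_aux[of "Suc j" r] by (simp add: algebra_simps)

lemma legendre_1: "L j 1 = 1"
proof (induction j rule: legendre.induct)
  case (3 j)
  then have "(real j + 2) * L (Suc (Suc j)) 1 = (real j + 2) * 1" using legendre_rec[of j 1] by (simp add: algebra_simps)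
  then show ?case by (simp add: add_nonneg_eq_0_iff)
qed auto

lemma legendre_0: "L j 0 = (-1) ^ j"
proof (induction j rule: legendre.induct)
  case (3 j)
  then have "(real j + 2) * L (Suc (Suc j)) 0 = (real j + 2) * (-1) ^ j" using legendre_rec[of j 0] by (simp add: algebra_simps)
  then show ?case by (simp add: add_nonneg_eq_0_iff)
qed auto

lemma degree_legendre: "degree (legendre j) \<le> j"
proof (induction j rule: legendre.induct)
  case (3 j)
  have "degree ([:-1, 2:] * legendre (Suc j)) \<le> Suc (Suc j)"
    using degree_mult_le[of "[:-1, 2:]" "legendre (Suc j)"] 3 by (simp del: mult_pCons_left)
  then have "degree (smult (2 * real j + 3) ([:-1, 2:] * legendre (Suc j))) \<le> Suc (Suc j)"
    by (rule order_trans[OF degree_smult_le])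
  moreover have "degree (smult (real j + 1) (legendre j)) \<le> Suc (Suc j)"
    using degree_smult_le[of "real j + 1" "legendre j"] 3 by linarith
  ultimately show ?case
    unfolding legendre.simps(3) by (intro order_trans[OF degree_smult_le degree_diff_le])
qed auto

lemma coeff_legendre: "poly.coeff (legendre j) j \<noteq> 0"
proof (induction j rule: legendre.induct)
  case (3 j)
  have "poly.coeff (legendre j) (Suc (Suc j)) = 0" "poly.coeff (legendre (Suc j)) (Suc (Suc j)) = 0"
    using degree_legendre[of j] degree_legendre[of "Suc j"] by (auto intro!: coeff_eq_0)
  then have "poly.coeff (legendre (Suc (Suc j))) (Suc (Suc j)) =
      (2 * real j + 3) * 2 * poly.coeff (legendre (Suc j)) (Suc j) / (real j + 2)"
    unfolding legendre.simps(3) by simp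
  then show ?case using 3 by (simp add: add_nonneg_eq_0_iff)
qed auto

lemma legendre_span:
  assumes "degree p \<le> n"
  shows "\<exists>c. \<forall>r. poly p r = (\<Sum>j\<le>n. c j * L j r)"
  using assms
proof (induction n arbitrary: p)
  case 0
  then obtain a where "p = [:a:]" by (metis degree_eq_zeroE le_zero_eq)
  then show ?case by (intro exI[of _ "\<lambda>_. a"]) simp
next
  case (Suc n)
  define a where "a = poly.coeff p (Suc n) / poly.coeff (legendre (Suc n)) (Suc n)"
  define p' where "p' = p - smult a (legendre (Suc n))"
  have "degree p' \<le> n"
  proof (rule degree_le, intro allI impI)
    fix i assume i: "n < i"
    show "poly.coeff p' i = 0"
    proof (cases "i = Suc n")
      case False
      with i Suc.prems degree_legendre[of "Suc n"] show ?thesis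
        by (simp add: p'_def coeff_eq_0)
    qed (simp add: p'_def a_def coeff_legendre)
  qed
  from Suc.IH[OF this] obtain c where c: "\<And>r. poly p' r = (\<Sum>j\<le>n. c j * L j r)" by blast
  have "poly p r = (\<Sum>j\<le>Suc n. (c(Suc n := a)) j * L j r)" for r
  proof -
    have "(\<Sum>j\<le>n. (c(Suc n := a)) j * L j r) = poly p' r" unfolding c by (intro sum.cong) auto
    then show ?thesis by (simp add: p'_def)
  qed
  then show ?case by blast
qed

text \<open>The antiderivative of \<^term>\<open>legendre j\<close> that vanishes at \<open>0\<close>.\<close>
definition legendre_int :: "nat \<Rightarrow> real poly" where
  "legendre_int j = (if j = 0 then [:0, 1:] else smult (1 / (2 * (2 * real j + 1))) (legendre (Suc j) - legendre (j - 1)))"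

lemma pderiv_legendre_int: "pderiv (legendre_int j) = legendre j"
proof (cases j)
  case (Suc i)
  have "poly (pderiv (legendre_int j)) r = poly (legendre j) r" for r
  proof -
    have "poly (pderiv (legendre_int j)) r = (L' (Suc (Suc i)) r - L' i r) / (2 * (2 * real i + 3))"
      by (simp add: legendre_int_def Suc pderiv_smult pderiv_diff add.commute)
    then show ?thesis unfolding legendre_deriv_diff Suc by (simp add: add_nonneg_eq_0_iff)
  qed
  then show ?thesis by (simp add: poly_eq_poly_eq_iff[symmetric] fun_eq_iff)
qed (simp add: legendre_int_def pderiv_pCons)

lemma legendre_int_0: "poly (legendre_int j) 0 = 0"
  by (cases j) (simp_all add: legendre_int_def legendre_0)

lemma legendre_int_1: "poly (legendre_int j) 1 = (if j = 0 then 1 else 0)"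
  by (simp add: legendre_int_def legendre_1)

section \<open>Integrals of products of Legendre polynomials and their antiderivatives\<close>

definition pint :: "real poly \<Rightarrow> real" where
  "pint p = integral {0..1} (poly p)"

lemma integrable_poly: "poly (p :: real poly) integrable_on {a..b}"
  by (intro integrable_continuous_real continuous_intros)

lemma has_integral_pint: "(poly p has_integral pint p) {0..1}"
  unfolding pint_def by (rule integrable_integral[OF integrable_poly])

lemma pint_add: "pint (p + q) = pint p + pint q"
  unfolding pint_def poly_add by (rule integral_add[OF integrable_poly integrable_poly])

lemma pint_diff: "pint (p - q) = pint p - pint q"
  unfolding pint_def poly_diff by (rule integral_diff[OF integrable_poly integrable_poly])

lemma pint_smult: "pint (smult c p) = c * pint p"
  unfolding pint_def poly_smult by simp

lemma pint_pderiv: "pint (pderiv p) = poly p 1 - poly p 0"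
  unfolding pint_def
  by (intro integral_unique fundamental_theorem_of_calculus)
     (auto intro!: DERIV_subset[OF poly_DERIV] simp flip: has_real_derivative_iff_has_vector_derivative)

text \<open>Integration by parts: for j \<ge> 1 the antiderivative vanishes at both ends and
  combines the polynomials j - 1 and j + 1, while the degree of f drops. Because these neighbours
  appear, the induction runs over all j.\<close>

lemma legendre_orthogonal:
  "degree f \<le> d \<Longrightarrow> d < j \<Longrightarrow> pint (legendre j * f) = 0"
proof (induction d arbitrary: f j)
  case 0
  then obtain a where "f = [:a:]" by (metis degree_eq_zeroE le_zero_eq)
  moreover have "pint (legendre j) = 0"
    using pint_pderiv[of "legendre_int j"] 0 by (simp add: pderiv_legendre_int legendre_int_0 legendre_int_1)
  ultimately show ?case by (simp add: pint_smult mult.commute[of "legendre j"])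
next
  case (Suc d)
  then obtain i where i: "j = Suc i" "d < i" by (cases j) auto
  have d: "degree (pderiv f) \<le> d" using Suc.prems(1) by (simp add: degree_pderiv)
  have "pint (pderiv (legendre_int j * f)) = 0"
    unfolding pint_pderiv using i by (simp add: legendre_int_0 legendre_int_1)
  then have "pint (legendre_int j * pderiv f) + pint (legendre j * f) = 0"
    by (simp add: pderiv_mult pderiv_legendre_int pint_add mult.commute)
  moreover have "pint (legendre_int j * pderiv f) = 0"
    using Suc.IH[OF d, of "Suc j"] Suc.IH[OF d, of i] i
    by (simp add: legendre_int_def left_diff_distrib pint_smult pint_diff)
  ultimately show ?case by simp
qed

lemma pint_legendre_mult:
  "pint (legendre i * legendre j) = (if i = j then 1 / (2 * real j + 1) else 0)"
proof -
  have neq: "pint (legendre i * legendre j) = 0" if "i < j" for i j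
    using legendre_orthogonal[OF degree_legendre that] by (simp add: mult.commute)
  have "pint (legendre j * legendre j) = 1 / (2 * real j + 1)"
  proof (cases j)
    case (Suc i)
    let ?p = "legendre j"
    \<comment> \<open>The integral of (x p^2)', with x = 2 r - 1, is 2 by the end point values. This
      identity turns the term with x p p' into 2 j times the integral of p^2, because p is
      orthogonal to polynomials of lower degree.\<close>
    have "[:-1, 2:] * pderiv ?p = pderiv (legendre i) + smult (2 * real j) ?p"
    proof -
      have "poly ([:-1, 2:] * pderiv ?p) r = poly (pderiv (legendre i) + smult (2 * real j) ?p) r" for r
        using legendre_deriv_aux[of i r] unfolding Suc by (simp add: algebra_simps)
      then show ?thesis by (simp only: poly_eq_poly_eq_iff[symmetric] fun_eq_iff simp_thms)
    qed
    then have "?p * ([:-1, 2:] * pderiv ?p) = ?p * pderiv (legendre i) + smult (2 * real j) (?p * ?p)"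
      by (simp only: distrib_left mult_smult_right)
    moreover have "pint (?p * pderiv (legendre i)) = 0"
      using degree_legendre[of i] unfolding Suc by (intro legendre_orthogonal[of _ i]) (auto simp: degree_pderiv)
    ultimately have 1: "pint (?p * ([:-1, 2:] * pderiv ?p)) = 2 * real j * pint (?p * ?p)"
      by (simp only: pint_add pint_smult)
    have "pderiv ([:-1, 2:] * (?p * ?p)) = smult 2 (?p * ?p) + smult 2 (?p * ([:-1, 2:] * pderiv ?p))"
    proof -
      have "poly (pderiv ([:-1, 2:] * (?p * ?p))) r = poly (smult 2 (?p * ?p) + smult 2 (?p * ([:-1, 2:] * pderiv ?p))) r" for r
        unfolding pderiv_mult by (simp add: pderiv_pCons algebra_simps)
      then show ?thesis by (simp only: poly_eq_poly_eq_iff[symmetric] fun_eq_iff simp_thms)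
    qed
    then have "pint (pderiv ([:-1, 2:] * (?p * ?p))) = 2 * pint (?p * ?p) + 2 * (2 * real j * pint (?p * ?p))"
      by (simp only: pint_add pint_smult 1)
    moreover have "pint (pderiv ([:-1, 2:] * (?p * ?p))) = 2"
      unfolding pint_pderiv by (simp add: legendre_0 legendre_1 flip: power_add)
    ultimately have "pint (?p * ?p) * (2 * real j + 1) = 1" by (simp add: algebra_simps)
    then show ?thesis by (simp add: eq_divide_eq add_nonneg_eq_0_iff)
  qed (use pint_pderiv[of "[:0, 1:]"] in \<open>simp add: pderiv_pCons one_pCons\<close>)
  then show ?thesis using neq[of i j] neq[of j i] by (auto simp: mult.commute neq_iff)
qed

text \<open>An antiderivative couples only to the neighbouring polynomials, with opposite signs;
  this is the source of the tridiagonal constraint. The exceptional entry 1/2 at (0, 0), from the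
  antiderivative that does not vanish at 1, disappears against a skew form.\<close>

lemma pint_legendre_int_mult:
  "pint (legendre_int i * legendre j) =
     (if j = Suc i then 1 / (2 * (2 * real i + 1) * (2 * real j + 1)) else
      if i = Suc j then - 1 / (2 * (2 * real i + 1) * (2 * real j + 1)) else
      if i = 0 \<and> j = 0 then 1 / 2 else 0)"
proof (cases i)
  case 0
  have "[:0, 1:] = smult (1/2) (legendre (Suc 0) + legendre 0)" by (simp add: one_pCons)
  then have "legendre_int i * legendre j = smult (1/2) (legendre (Suc 0) * legendre j + legendre 0 * legendre j)"
    by (simp only: legendre_int_def 0 simp_thms if_True mult_smult_left distrib_right)
  then have "pint (legendre_int i * legendre j) = 1/2 * (pint (legendre (Suc 0) * legendre j) + pint (legendre 0 * legendre j))"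
    by (simp only: pint_smult pint_add)
  then show ?thesis unfolding pint_legendre_mult 0 by auto
next
  case (Suc n)
  have "legendre_int i * legendre j = smult (1 / (2 * (2 * real i + 1))) (legendre (Suc i) * legendre j - legendre n * legendre j)"
    by (simp add: legendre_int_def Suc left_diff_distrib)
  then have "pint (legendre_int i * legendre j) = 1 / (2 * (2 * real i + 1)) * (pint (legendre (Suc i) * legendre j) - pint (legendre n * legendre j))"
    by (simp only: pint_smult pint_diff)
  then show ?thesis unfolding pint_legendre_mult Suc by auto
qed

section \<open>Horizontal curves and their Legendre coefficients\<close>

text \<open>The tags at which \<open>f\<close> is not differentiable lie in an open set of small measure, where absolute continuity applies.\<close>
lemma abs_cont_on_has_integral:
  fixes f :: "real \<Rightarrow> 'a::euclidean_space"
  assumes ac: "abs_cont_on f {a..b}" and ab: "a \<le> b"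
    and N: "negligible N"
    and der: "\<And>r. r \<in> {a..b} - N \<Longrightarrow> (f has_vector_derivative f' r) (at r within {a..b})"
  shows "(f' has_integral (f b - f a)) {a..b}"
proof -
  define g where "g r = (if r \<in> N then 0 else f' r)" for r
  have "(g has_integral (f b - f a)) {a..b}"
    unfolding has_integral_real
  proof (intro allI impI)
    fix e :: real assume e: "e > 0"
    \<comment> \<open>Half of the error is spread over the interval; the summand 1 covers a =
      b.\<close>
    define \<eta> where "\<eta> = e / (2 * (b - a + 1))"
    have \<eta>: "\<eta> > 0" using e ab by (simp add: \<eta>_def)
    obtain \<delta> where \<delta>: "\<delta> > 0" and acD: "\<And>D. D division_of \<Union>D \<Longrightarrow> \<Union>D \<subseteq> {a..b} \<Longrightarrow>
        (\<Sum>K\<in>D. measure lborel K) < \<delta> \<Longrightarrow> (\<Sum>K\<in>D. norm (f (Sup K) - f (Inf K))) < e / 2"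
      using ac e unfolding abs_cont_on_def by (meson half_gt_zero)
    obtain T where T: "open T" "N \<subseteq> T" "T \<in> lmeasurable" "measure lebesgue T < \<delta>"
    proof -
      have N': "N \<in> lmeasurable" "measure lebesgue N = 0"
        using N by (auto simp: negligible_iff_measure)
      then obtain T where T: "open T" "N \<subseteq> T" "T - N \<in> lmeasurable" "emeasure lebesgue (T - N) < ennreal \<delta>"
        using sets_lebesgue_outer_open[of N \<delta>] \<delta> by blast
      have U: "T = (T - N) \<union> N" using T(2) by blast
      have "T \<in> lmeasurable" by (subst U) (intro fmeasurable.Un T N')
      moreover have "measure lebesgue T \<le> measure lebesgue (T - N) + measure lebesgue N"
        by (subst U) (intro measure_Un_le fmeasurableD T N')
      moreover have "measure lebesgue (T - N) < \<delta>"
        using T(3,4) \<delta> by (simp add: emeasure_eq_measure2 ennreal_less_iff)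
      ultimately show ?thesis using T(1,2) N'(2) that[of T] by simp
    qed
    \<comment> \<open>The gauge has two regimes: around a tag in N the interval stays inside the
      small open set T, around any other tag the linear approximation has relative error at most
      \<eta>.\<close>
    have "\<exists>d>0. if r \<in> N then ball r d \<subseteq> T else
        (\<forall>y\<in>{a..b}. \<bar>y - r\<bar> < d \<longrightarrow> norm (f y - f r - (y - r) *\<^sub>R f' r) \<le> \<eta> * \<bar>y - r\<bar>)" if "r \<in> {a..b}" for r
    proof (cases "r \<in> N")
      case True
      then have "r \<in> T" using T by blast
      then show ?thesis using T(1) True by (simp add: open_contains_ball)
    next
      case False
      then have "(f has_derivative (\<lambda>x. x *\<^sub>R f' r)) (at r within {a..b})"
        using der[of r] that by (simp add: has_vector_derivative_def)
      then show ?thesis using False \<eta> unfolding has_derivative_within_alt by (auto simp: real_norm_def)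
    qed
    note ex = this
    define P where "P r d \<longleftrightarrow> (if r \<in> N then ball r d \<subseteq> T else
        (\<forall>y\<in>{a..b}. \<bar>y - r\<bar> < d \<longrightarrow> norm (f y - f r - (y - r) *\<^sub>R f' r) \<le> \<eta> * \<bar>y - r\<bar>))" for r d
    define d where "d r = (if r \<in> {a..b} then SOME d. d > 0 \<and> P r d else 1)" for r
    have dP: "d r > 0 \<and> P r (d r)" if "r \<in> {a..b}" for r
    proof -
      have "\<exists>d. d > 0 \<and> P r d" unfolding P_def by (rule ex[OF that])
      from someI_ex[OF this] show ?thesis using that by (simp add: d_def)
    qed
    note d = dP[unfolded P_def]
    have d0: "d r > 0" for r using d[of r] by (cases "r \<in> {a..b}") (auto simp: d_def)
    show "\<exists>\<gamma>. gauge \<gamma> \<and> (\<forall>D. D tagged_division_of {a..b} \<and> \<gamma> fine D \<longrightarrow>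
        norm ((\<Sum>(x, k)\<in>D. measure lborel k *\<^sub>R g x) - (f b - f a)) < e)"
    proof (intro exI[of _ "\<lambda>r. ball r (d r)"] conjI allI impI)
      show "gauge (\<lambda>r. ball r (d r))" using d0 by (rule gauge_ball_dependent[rule_format])
      fix p assume p: "p tagged_division_of {a..b} \<and> (\<lambda>r. ball r (d r)) fine p"
      then have ptag: "p tagged_division_of {a..b}" and fine: "\<And>x K. (x, K) \<in> p \<Longrightarrow> K \<subseteq> ball x (d x)"
        by (auto simp: fine_def)
      have fin: "finite p" using ptag by (rule tagged_division_of_finite)
      have pK: "\<exists>u v. u \<le> v \<and> K = {u..v} \<and> x \<in> K \<and> K \<subseteq> {a..b}" if "(x, K) \<in> p" for x K
      proof -
        have x: "x \<in> K" "K \<subseteq> {a..b}" "\<exists>u v. K = cbox u v"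
          using tagged_division_ofD(2-4)[OF ptag that] by auto
        then obtain u v where "K = {u..v}" by auto
        with x show ?thesis by (intro exI[of _ u] exI[of _ v]) auto
      qed
      define A where "A = {xk \<in> p. fst xk \<in> N}"
      have A: "A \<subseteq> p" "finite A" using fin by (auto simp: A_def)
      have "p tagged_partial_division_of {a..b}"
        using ptag by (simp add: tagged_division_of_def)
      then have Apart: "A tagged_partial_division_of {a..b}"
        using A(1) by (rule tagged_partial_division_subset)
      note Atag = tagged_partial_division_of_Union_self[OF Apart]
      note Adiv = division_of_tagged_division[OF Atag]
      let ?D = "snd ` A"
      have tot: "f b - f a = (\<Sum>(x,K)\<in>p. f (Sup K) - f (Inf K))" "b - a = (\<Sum>(x,K)\<in>p. Sup K - Inf K)"
        using additive_tagged_division_1[OF ab ptag, of f] additive_tagged_division_1[OF ab ptag, of "\<lambda>x. x"] by auto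
      have "(\<Sum>(x, k)\<in>p. measure lborel k *\<^sub>R g x) - (f b - f a) = (\<Sum>(x,K)\<in>p. measure lborel K *\<^sub>R g x - (f (Sup K) - f (Inf K)))"
        unfolding tot by (simp add: sum_subtractf split_def)
      also have "norm \<dots> \<le> (\<Sum>(x,K)\<in>p. \<eta> * (Sup K - Inf K) + (if x \<in> N then norm (f (Sup K) - f (Inf K)) else 0))"
      proof (rule sum_norm_le, clarify)
        fix x K assume xK: "(x, K) \<in> p"
        then obtain u v where uv: "u \<le> v" "K = {u..v}" "x \<in> K" "K \<subseteq> {a..b}" using pK by blast
        have S: "Sup K = v" "Inf K = u" using uv by auto
        show "norm (measure lborel K *\<^sub>R g x - (f (Sup K) - f (Inf K)))
            \<le> \<eta> * (Sup K - Inf K) + (if x \<in> N then norm (f (Sup K) - f (Inf K)) else 0)"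
        proof (cases "x \<in> N")
          case True
          then show ?thesis using \<eta> uv(1) unfolding S by (simp add: g_def norm_minus_commute)
        next
          case False
          have x: "x \<in> {a..b}" "u \<in> {a..b}" "v \<in> {a..b}" "u \<le> x" "x \<le> v" using uv by auto
          have "u \<in> K" "v \<in> K" using uv by auto
          then have "u \<in> ball x (d x)" "v \<in> ball x (d x)" using fine[OF xK] by blast+
          then have b: "\<bar>u - x\<bar> < d x" "\<bar>v - x\<bar> < d x" by (auto simp: dist_real_def)
          have 1: "norm (f u - f x - (u - x) *\<^sub>R f' x) \<le> \<eta> * \<bar>u - x\<bar>" "norm (f v - f x - (v - x) *\<^sub>R f' x) \<le> \<eta> * \<bar>v - x\<bar>"
          proof -
            have "\<And>y. y \<in> {a..b} \<Longrightarrow> \<bar>y - x\<bar> < d x \<Longrightarrow> norm (f y - f x - (y - x) *\<^sub>R f' x) \<le> \<eta> * \<bar>y - x\<bar>"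
              using d[OF x(1)] False by (simp only: if_False)
            then show "norm (f u - f x - (u - x) *\<^sub>R f' x) \<le> \<eta> * \<bar>u - x\<bar>" "norm (f v - f x - (v - x) *\<^sub>R f' x) \<le> \<eta> * \<bar>v - x\<bar>"
              using x b by blast+
          qed
          have "norm ((v - u) *\<^sub>R f' x - (f v - f u)) = norm ((f u - f x - (u - x) *\<^sub>R f' x) - (f v - f x - (v - x) *\<^sub>R f' x))"
            by (simp add: algebra_simps)
          also have "\<dots> \<le> norm (f u - f x - (u - x) *\<^sub>R f' x) + norm (f v - f x - (v - x) *\<^sub>R f' x)"
            by (rule norm_triangle_ineq4)
          also have "\<dots> \<le> \<eta> * \<bar>u - x\<bar> + \<eta> * \<bar>v - x\<bar>" using 1 by (rule add_mono)
          also have "\<dots> = \<eta> * (v - u)" using x by (simp add: algebra_simps)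
          finally show ?thesis using False uv unfolding S by (simp add: g_def)
        qed
      qed
      also have "\<dots> = \<eta> * (b - a) + (\<Sum>(x,K)\<in>p. if x \<in> N then norm (f (Sup K) - f (Inf K)) else 0)"
        unfolding tot(2) by (simp add: sum.distrib sum_distrib_left split_def)
      also have "(\<Sum>(x,K)\<in>p. if x \<in> N then norm (f (Sup K) - f (Inf K)) else 0) = (\<Sum>(x,K)\<in>A. norm (f (Sup K) - f (Inf K)))"
      proof -
        have "(\<Sum>xk\<in>p. if fst xk \<in> N then norm (f (Sup (snd xk)) - f (Inf (snd xk))) else 0)
            = (\<Sum>xk\<in>A. norm (f (Sup (snd xk)) - f (Inf (snd xk))))"
          unfolding A_def by (rule sum.inter_filter[OF fin, symmetric])
        then show ?thesis by (simp only: split_def)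
      qed
      also have "\<dots> = (\<Sum>K\<in>?D. norm (f (Sup K) - f (Inf K)))"
      proof -
        \<comment> \<open>Passing from tagged pairs to intervals loses multiplicity only for
          degenerate intervals, where the increment is 0. The empty set gets the value 0 because its
          Sup and Inf are unspecified.\<close>
        define dd where "dd K = (if K = {} then 0 else norm (f (Sup K) - f (Inf K)))" for K
        have "(\<Sum>(x,K)\<in>A. norm (f (Sup K) - f (Inf K))) = (\<Sum>(x,K)\<in>A. dd K)"
        proof (rule sum.cong[OF refl], clarify)
          fix x K assume "(x, K) \<in> A"
          then have "x \<in> K" using pK[of x K] A(1) by blast
          then show "norm (f (Sup K) - f (Inf K)) = dd K" by (auto simp: dd_def)
        qed
        also have "\<dots> = (\<Sum>K\<in>?D. dd K)"
        proof (rule sum.over_tagged_division_lemma[OF Atag])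
          fix u v :: real assume "box u v = {}"
          then show "dd (cbox u v) = 0" by (cases "u = v") (auto simp: dd_def)
        qed
        also have "\<dots> = (\<Sum>K\<in>?D. norm (f (Sup K) - f (Inf K)))"
          using division_ofD(3)[OF Adiv] by (intro sum.cong) (auto simp: dd_def)
        finally show ?thesis .
      qed
      also have "\<dots> < e / 2"
      proof (rule acD)
        have DU: "\<Union>?D \<subseteq> T"
        proof
          fix y assume "y \<in> \<Union>?D"
          then obtain x K where xK: "(x, K) \<in> p" "x \<in> N" "y \<in> K" by (auto simp: A_def)
          then have "x \<in> {a..b}" using pK[OF xK(1)] by auto
          then have "ball x (d x) \<subseteq> T" using d[of x] xK(2) by simp
          then show "y \<in> T" using xK(3) fine[OF xK(1)] by blast
        qed
        show "?D division_of \<Union>?D" by (rule Adiv)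
        show "\<Union>?D \<subseteq> {a..b}"
        proof
          fix y assume "y \<in> \<Union>?D"
          then obtain x K where "(x, K) \<in> p" "y \<in> K" by (auto simp: A_def)
          then show "y \<in> {a..b}" using pK[of x K] by blast
        qed
        have "(\<Sum>K\<in>?D. measure lborel K) = (\<Sum>K\<in>?D. measure lebesgue K)"
        proof (rule sum.cong[OF refl])
          fix K assume "K \<in> ?D"
          then obtain u v where "K = cbox u v" using division_ofD(4)[OF Adiv] by blast
          then show "measure lborel K = measure lebesgue K" by simp
        qed
        also have "\<dots> = measure lebesgue (\<Union>?D)"
          using content_division[OF Adiv] by simp
        also have "\<dots> \<le> measure lebesgue T"
          by (intro measure_mono_fmeasurable DU T(3) fmeasurableD[OF lmeasurable_division[OF Adiv]])
        finally show "(\<Sum>K\<in>?D. measure lborel K) < \<delta>" using T(4) by linarith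
      qed
      finally have "norm ((\<Sum>(x, k)\<in>p. measure lborel k *\<^sub>R g x) - (f b - f a)) < \<eta> * (b - a) + e / 2" by simp
      moreover have "\<eta> * (b - a) \<le> e / 2"
      proof -
        have "\<eta> * (b - a) \<le> \<eta> * (b - a + 1)" using \<eta> by (intro mult_left_mono) auto
        also have "\<dots> = e / 2" using ab by (simp add: \<eta>_def) (simp add: divide_simps)
        finally show ?thesis .
      qed
      ultimately show "norm ((\<Sum>(x, k)\<in>p. measure lborel k *\<^sub>R g x) - (f b - f a)) < e" by linarith
    qed
  qed
  then show ?thesis
    by (rule has_integral_spike[OF N, rotated]) (auto simp: g_def)
qed

lemma abs_cont_on_subset: "abs_cont_on f S \<Longrightarrow> T \<subseteq> S \<Longrightarrow> abs_cont_on f T"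
  unfolding abs_cont_on_def by (meson order_trans)

lemma hfield_sum:
  "(\<Sum>l\<in>UNIV. (v $ l) *\<^sub>R hfield U l g) = (v, (1/2) *\<^sub>R U_pair U (fst g) v)"
proof -
  have "(\<Sum>l\<in>UNIV. (v $ l) *\<^sub>R axis l (1::real)) = v"
    by (simp add: vec_eq_iff sum_component axis_def if_distrib cong: if_cong)
  moreover have "(\<Sum>l\<in>UNIV. (v $ l) *\<^sub>R (\<chi> j. (1/2) * (\<Sum>i\<in>UNIV. U j $ l $ i * fst g $ i))) = (1/2) *\<^sub>R U_pair U (fst g) v"
    by (simp add: vec_eq_iff sum_component U_pair_def inner_vec_def matrix_vector_mult_def sum_distrib_left mult_ac)
  ultimately show ?thesis
    by (simp add: prod_eq_iff hfield_def fst_sum snd_sum)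
qed

section \<open>Curves with finite Legendre expansions\<close>

definition leg_vel :: "nat \<Rightarrow> (nat \<Rightarrow> 'a::real_vector) \<Rightarrow> real \<Rightarrow> 'a" where
  "leg_vel n a r = (\<Sum>j\<le>n. L j r *\<^sub>R a j)"

definition leg_path :: "nat \<Rightarrow> (nat \<Rightarrow> 'a::real_vector) \<Rightarrow> real \<Rightarrow> 'a" where
  "leg_path n a r = (\<Sum>j\<le>n. poly (legendre_int j) r *\<^sub>R a j)"

lemma leg_path_deriv:
  fixes a :: "nat \<Rightarrow> 'a::real_normed_vector"
  shows "(leg_path n a has_vector_derivative leg_vel n a r) (at r within S)"
proof -
  have "((\<lambda>r. poly (legendre_int j) r *\<^sub>R a j) has_vector_derivative L j r *\<^sub>R a j) (at r within S)" for j
  proof -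
    have "(poly (legendre_int j) has_real_derivative L j r) (at r within S)"
      using poly_DERIV[of "legendre_int j" r] unfolding pderiv_legendre_int by (rule has_field_derivative_at_within)
    then show ?thesis
      unfolding has_real_derivative_iff_has_vector_derivative
      by (rule bounded_linear.has_vector_derivative[OF bounded_linear_scaleR_left])
  qed
  then show ?thesis unfolding leg_path_def[abs_def] leg_vel_def by (intro has_vector_derivative_sum)
qed

lemma leg_path_0: "leg_path n a 0 = 0"
  by (simp add: leg_path_def legendre_int_0)

lemma leg_path_1: "leg_path n a 1 = a 0"
proof -
  have "leg_path n a 1 = (\<Sum>j\<le>n. if j = 0 then a 0 else 0)"
    unfolding leg_path_def by (intro sum.cong) (auto simp: legendre_int_1)
  then show ?thesis by simp
qed

lemma continuous_leg_vel:
  fixes a :: "nat \<Rightarrow> 'a::real_normed_vector"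
  shows "continuous_on S (leg_vel n a)"
  unfolding leg_vel_def[abs_def] by (intro continuous_intros)

lemma continuous_leg_path:
  fixes a :: "nat \<Rightarrow> 'a::real_normed_vector"
  shows "continuous_on S (leg_path n a)"
  unfolding leg_path_def[abs_def] by (intro continuous_intros)

lemma leg_vel_has_integral:
  fixes a :: "nat \<Rightarrow> 'a::banach"
  shows "(leg_vel n a has_integral a 0) {0..1}"
  using fundamental_theorem_of_calculus[OF zero_le_one leg_path_deriv, of n a]
  by (simp add: leg_path_0 leg_path_1)

lemma leg_energy:
  fixes a :: "nat \<Rightarrow> 'a::real_inner"
  shows "((\<lambda>r. (norm (leg_vel n a r))\<^sup>2) has_integral (\<Sum>j\<le>n. (norm (a j))\<^sup>2 / (2 * real j + 1))) {0..1}"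
proof -
  have "((\<lambda>r. \<Sum>i\<le>n. \<Sum>j\<le>n. poly (legendre i * legendre j) r * (a i \<bullet> a j)) has_integral
      (\<Sum>i\<le>n. \<Sum>j\<le>n. pint (legendre i * legendre j) * (a i \<bullet> a j))) {0..1}"
    by (intro has_integral_sum has_integral_mult_left has_integral_pint finite_atMost)
  moreover have "(\<Sum>i\<le>n. \<Sum>j\<le>n. pint (legendre i * legendre j) * (a i \<bullet> a j)) = (\<Sum>j\<le>n. (norm (a j))\<^sup>2 / (2 * real j + 1))"
  proof (intro sum.cong refl)
    fix i assume i: "i \<in> {..n}"
    have "(\<Sum>j\<le>n. pint (legendre i * legendre j) * (a i \<bullet> a j)) = (\<Sum>j\<le>n. if i = j then (a i \<bullet> a i) / (2 * real i + 1) else 0)"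
      unfolding pint_legendre_mult by (intro sum.cong) auto
    then show "(\<Sum>j\<le>n. pint (legendre i * legendre j) * (a i \<bullet> a j)) = (norm (a i))\<^sup>2 / (2 * real i + 1)"
      using i by (simp add: power2_norm_eq_inner)
  qed
  moreover have "(norm (leg_vel n a r))\<^sup>2 = (\<Sum>i\<le>n. \<Sum>j\<le>n. poly (legendre i * legendre j) r * (a i \<bullet> a j))" for r
    unfolding power2_norm_eq_inner leg_vel_def inner_sum_left inner_sum_right
    by (intro sum.cong refl) (simp add: inner_commute mult_ac)
  ultimately show ?thesis by (simp only:)
qed

text \<open>The matrix of \<open>pint_legendre_int_mult\<close> is skew off the diagonal, and so is
  the form of T; their entrywise product is symmetric, so each neighbouring pair counts twice, and
  the diagonal contributes nothing.\<close>

lemma leg_area: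
  fixes T :: "real^'q^'q" and a :: "nat \<Rightarrow> real^'q"
  assumes skew: "transpose T = - T"
  shows "((\<lambda>r. (T *v leg_path n a r) \<bullet> leg_vel n a r) has_integral
     (\<Sum>j<n. ((T *v a j) \<bullet> a (Suc j)) / ((2 * real j + 1) * (2 * real j + 3)))) {0..1}"
proof -
  define \<beta> where "\<beta> i j = (T *v a i) \<bullet> a j" for i j
  have sk: "\<beta> j i = - \<beta> i j" for i j
    using skew_inner[OF skew, of "a j" "a i"] by (simp add: \<beta>_def inner_commute)
  have d: "\<beta> i i = 0" for i using sk[of i i] by simp
  define c where "c i = 1 / (2 * (2 * real i + 1) * (2 * real i + 3))" for i
  define A where "A i j = (if j = Suc i then c i * \<beta> i j else 0)" for i j
  have int: "((\<lambda>r. \<Sum>i\<le>n. \<Sum>j\<le>n. poly (legendre_int i * legendre j) r * \<beta> i j) has_integral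
      (\<Sum>i\<le>n. \<Sum>j\<le>n. pint (legendre_int i * legendre j) * \<beta> i j)) {0..1}"
    by (intro has_integral_sum has_integral_mult_left has_integral_pint finite_atMost)
  have key: "pint (legendre_int i * legendre j) * \<beta> i j = A i j + A j i" for i j
  proof -
    have c1: "1 / (2 * (2 * real i + 1) * (2 * real (Suc i) + 1)) = c i" for i
      by (simp add: c_def add.commute)
    consider "j = Suc i" | "i = Suc j" | "i = 0" "j = 0" | "j \<noteq> Suc i" "i \<noteq> Suc j" "\<not> (i = 0 \<and> j = 0)" by blast
    then show ?thesis
    proof cases
      case 1
      then show ?thesis unfolding pint_legendre_int_mult A_def using c1[of i] by simp
    next
      case 2
      have ne: "j \<noteq> Suc (Suc j)" by simp
      have e: "2 * (2 * real (Suc j) + 1) * (2 * real j + 1) = 2 * (2 * real j + 1) * (2 * real (Suc j) + 1)"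
        by (simp only: mult_ac)
      have "pint (legendre_int i * legendre j) = - 1 / (2 * (2 * real (Suc j) + 1) * (2 * real j + 1))"
        unfolding pint_legendre_int_mult 2 using ne by (simp only: if_False if_True simp_thms)
      also have "\<dots> = - c j" unfolding e c1[of j, symmetric] by (rule minus_divide_left[symmetric])
      finally have "pint (legendre_int i * legendre j) = - c j" .
      then show ?thesis unfolding A_def 2 using sk[of j "Suc j"] by simp
    qed (simp_all add: pint_legendre_int_mult A_def d)
  qed
  have sA: "(\<Sum>i\<le>n. \<Sum>j\<le>n. A i j) = (\<Sum>i<n. c i * \<beta> i (Suc i))"
  proof -
    have "(\<Sum>j\<le>n. A i j) = (if i < n then c i * \<beta> i (Suc i) else 0)" for i
      unfolding A_def by (simp add: Suc_le_eq)
    then have "(\<Sum>i\<le>n. \<Sum>j\<le>n. A i j) = (\<Sum>i\<le>n. if i < n then c i * \<beta> i (Suc i) else 0)" by simp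
    also have "\<dots> = (\<Sum>i\<in>{i\<in>{..n}. i < n}. c i * \<beta> i (Suc i))" by (rule sum.inter_filter[symmetric]) simp
    also have "{i\<in>{..n}. i < n} = {..<n}" by auto
    finally show ?thesis .
  qed
  have "(\<Sum>i\<le>n. \<Sum>j\<le>n. pint (legendre_int i * legendre j) * \<beta> i j) = (\<Sum>i\<le>n. \<Sum>j\<le>n. A i j) + (\<Sum>i\<le>n. \<Sum>j\<le>n. A j i)"
    unfolding key by (simp only: sum.distrib)
  also have "(\<Sum>i\<le>n. \<Sum>j\<le>n. A j i) = (\<Sum>i\<le>n. \<Sum>j\<le>n. A i j)" by (rule sum.swap)
  also have "(\<Sum>i\<le>n. \<Sum>j\<le>n. A i j) + (\<Sum>i\<le>n. \<Sum>j\<le>n. A i j) = (\<Sum>j<n. ((T *v a j) \<bullet> a (Suc j)) / ((2 * real j + 1) * (2 * real j + 3)))"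
    unfolding sA sum.distrib[symmetric]
  proof (intro sum.cong refl)
    fix i
    have "1 / (2 * A * B) + 1 / (2 * A * B) = 1 / (A * B)" for A B :: real
      unfolding mult_2[symmetric] by simp
    then have "c i + c i = 1 / ((2 * real i + 1) * (2 * real i + 3))" unfolding c_def .
    then show "c i * \<beta> i (Suc i) + c i * \<beta> i (Suc i) = (T *v a i) \<bullet> a (Suc i) / ((2 * real i + 1) * (2 * real i + 3))"
      unfolding distrib_right[symmetric] \<beta>_def by simp
  qed
  finally have "(\<Sum>i\<le>n. \<Sum>j\<le>n. pint (legendre_int i * legendre j) * \<beta> i j) = (\<Sum>j<n. ((T *v a j) \<bullet> a (Suc j)) / ((2 * real j + 1) * (2 * real j + 3)))" .
  moreover have "(T *v leg_path n a r) \<bullet> leg_vel n a r = (\<Sum>i\<le>n. \<Sum>j\<le>n. poly (legendre_int i * legendre j) r * \<beta> i j)" for r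
    unfolding leg_path_def leg_vel_def \<beta>_def
      linear_sum[OF matrix_vector_mul_linear] linear_scale[OF matrix_vector_mul_linear] inner_sum_left inner_sum_right
    by (subst sum.swap, intro sum.cong refl) (simp add: mult_ac)
  ultimately show ?thesis using int by (simp only:)
qed

lemma abs_cont_on_C1:
  fixes f :: "real \<Rightarrow> 'a::euclidean_space"
  assumes der: "\<And>r. r \<in> {a..b} \<Longrightarrow> (f has_vector_derivative f' r) (at r within {a..b})"
    and K: "\<And>r. r \<in> {a..b} \<Longrightarrow> norm (f' r) \<le> K" "0 \<le> K"
  shows "abs_cont_on f {a..b}"
  unfolding abs_cont_on_def
proof (intro allI impI)
  fix \<epsilon> :: real assume \<epsilon>: "\<epsilon> > 0"
  show "\<exists>\<delta>>0. \<forall>D. D division_of \<Union>D \<and> \<Union>D \<subseteq> {a..b} \<and> (\<Sum>K\<in>D. measure lborel K) < \<delta> \<longrightarrow>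
        (\<Sum>K\<in>D. norm (f (Sup K) - f (Inf K))) < \<epsilon>"
  proof (intro exI[of _ "\<epsilon> / (K + 1)"] conjI allI impI)
    show "0 < \<epsilon> / (K + 1)" using \<epsilon> K(2) by simp
    fix D assume D: "D division_of \<Union>D \<and> \<Union>D \<subseteq> {a..b} \<and> (\<Sum>K\<in>D. measure lborel K) < \<epsilon> / (K + 1)"
    have "(\<Sum>J\<in>D. norm (f (Sup J) - f (Inf J))) \<le> (\<Sum>J\<in>D. K * measure lborel J)"
    proof (rule sum_mono)
      fix J assume J: "J \<in> D"
      then obtain u v where uv: "J = {u..v}" "u \<le> v" "J \<subseteq> {a..b}"
        using division_ofD(3,4)[OF conjunct1[OF D] J] D by fastforce
      have "(f' has_integral (f v - f u)) {u..v}"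
      proof (rule fundamental_theorem_of_calculus[OF uv(2)])
        fix r assume r: "r \<in> {u..v}"
        then have "(f has_vector_derivative f' r) (at r within {a..b})" using uv by (intro der) auto
        then show "(f has_vector_derivative f' r) (at r within {u..v})"
          by (rule has_vector_derivative_within_subset) (use uv in auto)
      qed
      then have "norm (f v - f u) \<le> K * measure lborel {u..v}"
        by (rule has_integral_bound_real[OF K(2) finite.emptyI]) (use K uv in auto)
      then show "norm (f (Sup J) - f (Inf J)) \<le> K * measure lborel J" using uv by simp
    qed
    also have "\<dots> \<le> (K + 1) * (\<Sum>J\<in>D. measure lborel J)"
      unfolding sum_distrib_left by (intro sum_mono mult_right_mono) auto
    also have "\<dots> < \<epsilon>" using D K(2) by (simp add: less_divide_eq mult.commute)
    finally show "(\<Sum>J\<in>D. norm (f (Sup J) - f (Inf J))) < \<epsilon>" .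
  qed
qed

lemma has_integral_inner_right: "(f has_integral I) S \<Longrightarrow> ((\<lambda>s. c \<bullet> f s) has_integral (c \<bullet> I)) S"
  using has_integral_linear[OF _ bounded_linear_inner_right, unfolded o_def] .

lemma U_pair_has_integral:
  fixes U :: "'m::finite \<Rightarrow> real^'q^'q"
  assumes "\<And>\<tau>. ((\<lambda>r. (T_mat U \<tau> *v X r) \<bullet> u r) has_integral (w \<bullet> \<tau>)) S"
  shows "((\<lambda>r. U_pair U (X r) (u r)) has_integral w) S"
  unfolding has_integral_componentwise_iff[of "\<lambda>r. U_pair U (X r) (u r)"] U_pair_inner using assms by blast

lemma continuous_on_U_pair:
  fixes U :: "'m::finite \<Rightarrow> real^'q^'q"
  assumes "continuous_on S X" "continuous_on S u"
  shows "continuous_on S (\<lambda>r. U_pair U (X r) (u r))"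
  unfolding U_pair_def
  by (intro continuous_on_vec_lambda continuous_on_inner assms
      bounded_linear.continuous_on[OF matrix_vector_mul_bounded_linear])

text \<open>The horizontal velocity is prescribed as a Legendre sum, the central component is
  obtained by integration, and the constraint brings it to 0 at time 1. The minus sign in
  \<open>u\<close> reflects that the curve runs from (x, t) to the identity.\<close>

lemma exists_curve:
  fixes U :: "'m::finite \<Rightarrow> real^'q^'q"
  assumes U: "step_two_data U" and s0: "sqrt 2 *\<^sub>R \<sigma> 0 = x"
    and con: "t + (\<Sum>j<n. U_pair U (\<sigma> j) (\<sigma> (Suc j))) = 0"
    and E: "(\<Sum>j\<le>n. 2 * (2 * real j + 1) * (norm (\<sigma> j))\<^sup>2) \<le> e\<^sup>2" and e: "e > 0"
  shows "\<exists>\<gamma> u. horizontal_curve U \<gamma> u \<and> \<gamma> 0 = (x, t) \<and> \<gamma> 1 = 0 \<and> integral {0..1} (\<lambda>r. norm (u r)) \<le> e"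
proof -
  \<comment> \<open>The integral of the squared j-th polynomial is 1 / (2 j + 1); this scaling
    produces the weights 2 (2 j + 1) in the energy and cancels the denominators of
    \<open>leg_area\<close> up to a factor 2.\<close>
  define a where "a j = (sqrt 2 * (2 * real j + 1)) *\<^sub>R \<sigma> j" for j
  have a0: "a 0 = x" using s0 by (simp add: a_def)
  define u where "u r = - leg_vel n a r" for r
  define X where "X r = x - leg_path n a r" for r
  define w where "w r = (1/2) *\<^sub>R U_pair U (X r) (u r)" for r
  define \<gamma> where "\<gamma> r = (X r, t + integral {0..r} w)" for r
  have cX: "continuous_on {0..1} X" and cu: "continuous_on {0..1} u"
    unfolding X_def[abs_def] u_def[abs_def] by (intro continuous_intros continuous_leg_vel continuous_leg_path)+
  have cw: "continuous_on {0..1} w"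
    unfolding w_def[abs_def] by (intro continuous_intros continuous_on_U_pair cX cu)
  have der: "(\<gamma> has_vector_derivative (u r, w r)) (at r within {0..1})" if r: "r \<in> {0..1}" for r
  proof -
    have "(X has_vector_derivative (0 - leg_vel n a r)) (at r within {0..1})"
      unfolding X_def[abs_def] by (intro has_vector_derivative_diff has_vector_derivative_const leg_path_deriv)
    then have 1: "(X has_vector_derivative u r) (at r within {0..1})" by (simp add: u_def)
    have "((\<lambda>r. t + integral {0..r} w) has_vector_derivative (0 + w r)) (at r within {0..1})"
      by (intro has_vector_derivative_add has_vector_derivative_const integral_has_vector_derivative cw r)
    then show ?thesis unfolding \<gamma>_def[abs_def] using 1 by (intro has_vector_derivative_Pair) simp_all
  qed
  have "bounded ((\<lambda>r. (u r, w r)) ` {0..1})"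
    by (intro compact_imp_bounded compact_continuous_image continuous_on_Pair cu cw compact_Icc)
  then obtain K where K: "0 < K" "\<And>r. r \<in> {0..1} \<Longrightarrow> norm (u r, w r) \<le> K"
    unfolding bounded_pos by auto
  have "abs_cont_on \<gamma> {0..1}"
    by (rule abs_cont_on_C1[OF der K(2)]) (use K(1) in auto)
  moreover have "u absolutely_integrable_on {0..1}"
    using cu by (rule absolutely_integrable_continuous_real)
  moreover have "AE r in lebesgue_on {0..1}. (\<gamma> has_vector_derivative (\<Sum>l\<in>UNIV. (u r $ l) *\<^sub>R hfield U l (\<gamma> r))) (at r within {0..1})"
    by (rule AE_I2) (use der in \<open>simp add: hfield_sum \<gamma>_def w_def\<close>)
  ultimately have "horizontal_curve U \<gamma> u" by (simp add: horizontal_curve_def)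
  moreover have "\<gamma> 0 = (x, t)" by (simp add: \<gamma>_def X_def leg_path_0)
  moreover have "\<gamma> 1 = 0"
  proof -
    have "((\<lambda>r. U_pair U (X r) (u r)) has_integral (- 2 *\<^sub>R t)) {0..1}"
    proof (rule U_pair_has_integral)
      fix \<tau>
      let ?T = "T_mat U \<tau>"
      note skew = transpose_T_mat[OF U, of \<tau>]
      have xx: "(?T *v x) \<bullet> x = 0" using skew_inner[OF skew, of x x] by (simp add: inner_commute)
      have "((\<lambda>r. (?T *v leg_path n a r) \<bullet> leg_vel n a r - (?T *v x) \<bullet> leg_vel n a r) has_integral
        ((\<Sum>j<n. ((?T *v a j) \<bullet> a (Suc j)) / ((2 * real j + 1) * (2 * real j + 3))) - (?T *v x) \<bullet> a 0)) {0..1}"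
        by (intro has_integral_diff leg_area[OF skew] has_integral_inner_right leg_vel_has_integral)
      moreover have "(?T *v leg_path n a r) \<bullet> leg_vel n a r - (?T *v x) \<bullet> leg_vel n a r = (?T *v X r) \<bullet> u r" for r
        by (simp add: X_def u_def matrix_vector_mult_diff_distrib inner_diff_left)
      moreover have "(\<Sum>j<n. ((?T *v a j) \<bullet> a (Suc j)) / ((2 * real j + 1) * (2 * real j + 3))) = 2 * ((\<Sum>j<n. U_pair U (\<sigma> j) (\<sigma> (Suc j))) \<bullet> \<tau>)"
      proof -
        have "((?T *v a j) \<bullet> a (Suc j)) / ((2 * real j + 1) * (2 * real j + 3)) = 2 * (U_pair U (\<sigma> j) (\<sigma> (Suc j)) \<bullet> \<tau>)" for j
        proof -
          define A B where "A = 2 * real j + 1" and "B = 2 * real j + 3"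
          have AB: "A > 0" "B > 0" by (simp_all add: A_def B_def add_nonneg_pos)
          have "(?T *v a j) \<bullet> a (Suc j) = (sqrt 2 * A) * (sqrt 2 * B) * ((?T *v \<sigma> j) \<bullet> \<sigma> (Suc j))"
            by (simp add: a_def A_def B_def matrix_vector_mult_scaleR add.commute)
          also have "\<dots> = 2 * (A * B) * ((?T *v \<sigma> j) \<bullet> \<sigma> (Suc j))" by simp
          finally show ?thesis unfolding U_pair_inner A_def[symmetric] B_def[symmetric] using AB by simp
        qed
        then show "(\<Sum>j<n. ((?T *v a j) \<bullet> a (Suc j)) / ((2 * real j + 1) * (2 * real j + 3))) = 2 * ((\<Sum>j<n. U_pair U (\<sigma> j) (\<sigma> (Suc j))) \<bullet> \<tau>)"
          by (simp add: inner_sum_left sum_distrib_left)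
      qed
      moreover have "(\<Sum>j<n. U_pair U (\<sigma> j) (\<sigma> (Suc j))) = - t"
        using con by (simp add: eq_neg_iff_add_eq_0 add.commute)
      ultimately show "((\<lambda>r. (?T *v X r) \<bullet> u r) has_integral ((- 2 *\<^sub>R t) \<bullet> \<tau>)) {0..1}"
        using xx a0 by simp
    qed
    then have "(w has_integral (1/2) *\<^sub>R (- 2 *\<^sub>R t)) {0..1}"
      unfolding w_def[abs_def] by (rule has_integral_cmul)
    then have "integral {0..1} w = - t" by (simp add: integral_unique)
    then show ?thesis by (simp add: \<gamma>_def X_def leg_path_1 a0 zero_prod_def)
  qed
  moreover have "integral {0..1} (\<lambda>r. norm (u r)) \<le> e"
  proof -
    let ?E = "\<Sum>j\<le>n. (norm (a j))\<^sup>2 / (2 * real j + 1)"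
    have "(norm (a j))\<^sup>2 / (2 * real j + 1) = 2 * (2 * real j + 1) * (norm (\<sigma> j))\<^sup>2" for j
    proof -
      have "(norm (a j))\<^sup>2 = 2 * ((2 * real j + 1) * (2 * real j + 1)) * (norm (\<sigma> j))\<^sup>2"
        by (simp add: a_def power_mult_distrib power2_eq_square[of "2 * real j + 1"])
      then show ?thesis by (simp add: add_nonneg_eq_0_iff)
    qed
    then have Ee: "?E \<le> e\<^sup>2" using E by simp
    \<comment> \<open>The pointwise bound |u| \<le> (|u|^2 / e + e) / 2 takes the place of the
      Cauchy-Schwarz inequality for integrals; with energy at most e^2 it gives length at most
      e.\<close>
    have "((\<lambda>r. ((norm (leg_vel n a r))\<^sup>2 * (1/e) + e) * (1/2)) has_integral ((?E * (1/e) + e) * (1/2))) {0..1}"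
    proof -
      have "((\<lambda>_. e) has_integral e) {0..1::real}" using has_integral_const_real[of e 0 1] by simp
      then show ?thesis by (intro has_integral_mult_left has_integral_add leg_energy)
    qed
    moreover have "((\<lambda>r. norm (u r)) has_integral integral {0..1} (\<lambda>r. norm (u r))) {0..1}"
      by (intro integrable_integral integrable_continuous_real continuous_intros cu)
    moreover have "norm (u r) \<le> ((norm (leg_vel n a r))\<^sup>2 * (1/e) + e) * (1/2)" for r
    proof -
      have "2 * norm (u r) * e \<le> (norm (u r))\<^sup>2 + e\<^sup>2" using sum_squares_bound[of "norm (u r)" e] by simp
      then have "2 * norm (u r) * e / e \<le> ((norm (u r))\<^sup>2 + e\<^sup>2) / e" using e by (intro divide_right_mono) auto
      then show ?thesis using e by (simp add: u_def add_divide_distrib power2_eq_square)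
    qed
    ultimately have "integral {0..1} (\<lambda>r. norm (u r)) \<le> (?E * (1/e) + e) * (1/2)"
      by (meson has_integral_le)
    also have "\<dots> \<le> (e\<^sup>2 * (1/e) + e) * (1/2)" using Ee e by (intro mult_right_mono add_right_mono) auto
    also have "\<dots> = e" using e by (simp add: power2_eq_square)
    finally show ?thesis .
  qed
  ultimately show ?thesis by blast
qed

section \<open>Approximation of horizontal curves by polynomial ones\<close>

lemma area_riemann_piece:
  fixes T :: "real^'q^'q"
  assumes ui: "(u has_integral X d - X c) {c..d}"
    and ni: "(\<lambda>s. norm (u s)) integrable_on {c..d}" "integral {c..d} (\<lambda>s. norm (u s)) \<le> h"
    and osc: "\<And>s. s \<in> {c..d} \<Longrightarrow> norm (X s - X c) \<le> h"
    and A: "((\<lambda>s. (T *v X s) \<bullet> u s) has_integral A) {c..d}"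
    and K: "\<And>x. norm (T *v x) \<le> K * norm x" "K \<ge> 0" and h: "h \<ge> 0"
  shows "\<bar>A - (T *v X c) \<bullet> (X d - X c)\<bar> \<le> K * h\<^sup>2"
proof -
  \<comment> \<open>The position is frozen at the left end point. Its oscillation and the length of
    the piece are both at most h, so the error is quadratic; over M pieces with h = l / M it sums to
    K l^2 / M.\<close>
  have "((\<lambda>s. (T *v X s) \<bullet> u s - (T *v X c) \<bullet> u s) has_integral (A - (T *v X c) \<bullet> (X d - X c))) {c..d}"
    by (intro has_integral_diff A has_integral_inner_right ui)
  then have i: "((\<lambda>s. (T *v (X s - X c)) \<bullet> u s) has_integral (A - (T *v X c) \<bullet> (X d - X c))) {c..d}"
    by (simp add: matrix_vector_mult_diff_distrib inner_diff_left)
  have "norm (integral {c..d} (\<lambda>s. (T *v (X s - X c)) \<bullet> u s)) \<le> integral {c..d} (\<lambda>s. (K * h) * norm (u s))"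
  proof (rule integral_norm_bound_integral)
    show "(\<lambda>s. (T *v (X s - X c)) \<bullet> u s) integrable_on {c..d}" using i by (rule has_integral_integrable)
    show "(\<lambda>s. (K * h) * norm (u s)) integrable_on {c..d}" using integrable_on_cmult_left[OF ni(1), of "K * h"] by simp
    fix s assume s: "s \<in> {c..d}"
    have "norm ((T *v (X s - X c)) \<bullet> u s) \<le> norm (T *v (X s - X c)) * norm (u s)"
      using Cauchy_Schwarz_ineq2 by simp
    also have "\<dots> \<le> (K * h) * norm (u s)"
    proof (rule mult_right_mono)
      have "norm (T *v (X s - X c)) \<le> K * norm (X s - X c)" by (rule K)
      also have "\<dots> \<le> K * h" using osc[OF s] K(2) by (rule mult_left_mono)
      finally show "norm (T *v (X s - X c)) \<le> K * h" .
    qed simp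
    finally show "norm ((T *v (X s - X c)) \<bullet> u s) \<le> (K * h) * norm (u s)" .
  qed
  also have "\<dots> = K * h * integral {c..d} (\<lambda>s. norm (u s))" by simp
  also have "\<dots> \<le> K * h * h" using ni(2) K(2) h by (intro mult_left_mono) auto
  finally show ?thesis using integral_unique[OF i] by (simp add: power2_eq_square)
qed

lemma bernstein_deriv:
  "((\<lambda>s. Bernstein (Suc n) k s) has_real_derivative
     real (Suc n) * ((if k = 0 then 0 else Bernstein n (k - 1) s) - (if k \<le> n then Bernstein n k s else 0))) (at s)"
  if k: "k \<le> Suc n"
proof (cases k)
  case 0
  have "((\<lambda>s. (1 - s) ^ Suc n) has_real_derivative real (Suc n) * ((0 - 1) * (1 - s) ^ (Suc n - Suc 0))) (at s)"
    by (intro DERIV_power derivative_intros)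
  then show ?thesis by (simp add: Bernstein_def 0)
next
  case (Suc j)
  have j: "j \<le> n" using k Suc by simp
  have "((\<lambda>s. real (Suc n choose Suc j) * (s ^ Suc j * (1 - s) ^ (n - j))) has_real_derivative
      real (Suc n choose Suc j) * ((real (Suc j) * (1 * s ^ (Suc j - Suc 0))) * (1 - s) ^ (n - j)
        + (real (n - j) * ((0 - 1) * (1 - s) ^ (n - j - Suc 0))) * s ^ Suc j)) (at s)"
    by (intro DERIV_cmult DERIV_mult DERIV_power derivative_intros)
  moreover have "real (Suc n choose Suc j) * ((real (Suc j) * (1 * s ^ (Suc j - Suc 0))) * (1 - s) ^ (n - j)
        + (real (n - j) * ((0 - 1) * (1 - s) ^ (n - j - Suc 0))) * s ^ Suc j)
      = real (Suc n) * (Bernstein n j s - (if Suc j \<le> n then Bernstein n (Suc j) s else 0))"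
  proof -
    have c1: "real (Suc n choose Suc j) * real (Suc j) = real (Suc n) * real (n choose j)"
      using Suc_times_binomial_eq[of n j] by (metis of_nat_mult mult.commute)
    have c2: "real (Suc n choose Suc j) * real (n - j) = real (Suc n) * real (n choose Suc j)"
    proof -
      have "(Suc n - Suc j) * (Suc n choose Suc j) = Suc n * ((Suc n - 1) choose Suc j)"
        by (rule binomial_absorb_comp)
      then show ?thesis by (metis diff_Suc_Suc diff_Suc_1 of_nat_mult mult.commute)
    qed
    have "real (Suc n choose Suc j) * ((real (Suc j) * (1 * s ^ (Suc j - Suc 0))) * (1 - s) ^ (n - j)
        + (real (n - j) * ((0 - 1) * (1 - s) ^ (n - j - Suc 0))) * s ^ Suc j)
      = (real (Suc n choose Suc j) * real (Suc j)) * (s ^ j * (1 - s) ^ (n - j))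
        - (real (Suc n choose Suc j) * real (n - j)) * (s ^ Suc j * (1 - s) ^ (n - Suc j))"
      by (simp add: algebra_simps del: of_nat_Suc binomial_Suc_Suc power_Suc)
    also have "\<dots> = real (Suc n) * (Bernstein n j s - (if Suc j \<le> n then Bernstein n (Suc j) s else 0))"
      unfolding c1 c2 by (simp add: Bernstein_def algebra_simps binomial_eq_0 del: of_nat_Suc power_Suc)
    finally show ?thesis .
  qed
  moreover have "Bernstein (Suc n) k = (\<lambda>s. real (Suc n choose Suc j) * (s ^ Suc j * (1 - s) ^ (n - j)))"
    by (rule ext) (simp add: Bernstein_def Suc mult.assoc del: binomial_Suc_Suc power_Suc)
  ultimately have "(Bernstein (Suc n) k has_real_derivative real (Suc n) * (Bernstein n j s - (if Suc j \<le> n then Bernstein n (Suc j) s else 0))) (at s)"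
    by (simp only:)
  then show ?thesis unfolding Suc by (simp only: nat.simps(3) if_False diff_Suc_1)
qed

lemma Bernstein_legendre: "k \<le> n \<Longrightarrow> \<exists>c. \<forall>r. Bernstein n k r = (\<Sum>j\<le>n. c j * L j r)"
proof -
  assume k: "k \<le> n"
  define p where "p = smult (real (n choose k)) (monom 1 k * [:1, -1:] ^ (n - k))"
  have "degree (monom (1::real) k * [:1, -1:] ^ (n - k)) \<le> degree (monom (1::real) k) + degree ([:1, -1::real:] ^ (n - k))"
    by (rule degree_mult_le)
  also have "\<dots> \<le> k + (n - k)"
    using degree_power_le[of "[:1, -1::real:]" "n - k"] by (intro add_mono) (auto simp: degree_monom_le)
  finally have "degree p \<le> n" unfolding p_def using k degree_smult_le order_trans by fastforce
  moreover have "poly p r = Bernstein n k r" for r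
    by (simp add: p_def Bernstein_def poly_monom)
  ultimately show ?thesis using legendre_span[of p n] by simp
qed

text \<open>The derivative of a Bernstein polynomial is a convex combination of difference quotients
  of X, so the Lipschitz constant still bounds the velocity; truncated Legendre expansions do not
  keep such a pointwise bound. The end points are interpolated exactly, which fixes
  \<open>c 0\<close>.\<close>

lemma bernstein_path:
  fixes X :: "real \<Rightarrow> real^'q"
  assumes lip: "\<And>s s'. s \<in> {0..1} \<Longrightarrow> s' \<in> {0..1} \<Longrightarrow> norm (X s - X s') \<le> l * \<bar>s - s'\<bar>"
  shows "\<exists>c. c 0 = X 1 - X 0 \<and> (\<forall>s\<in>{0..1}. norm (leg_vel n c s) \<le> l) \<and>
     (\<forall>s. X 0 + leg_path n c s = (\<Sum>k\<le>Suc n. Bernstein (Suc n) k s *\<^sub>R X (real k / real (Suc n))))"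
proof -
  define x where "x k = X (real k / real (Suc n))" for k
  define \<Delta> where "\<Delta> k = real (Suc n) *\<^sub>R (x (Suc k) - x k)" for k
  have "\<exists>d. \<forall>k\<in>{..n}. \<forall>r. Bernstein n k r = (\<Sum>j\<le>n. d k j * L j r)"
    by (rule bchoice) (use Bernstein_legendre in auto)
  then obtain d where d: "\<And>k r. k \<le> n \<Longrightarrow> Bernstein n k r = (\<Sum>j\<le>n. d k j * L j r)" by auto
  define c where "c j = (\<Sum>k\<le>n. d k j *\<^sub>R \<Delta> k)" for j
  have v: "leg_vel n c s = (\<Sum>k\<le>n. Bernstein n k s *\<^sub>R \<Delta> k)" for s
  proof -
    have "leg_vel n c s = (\<Sum>j\<le>n. \<Sum>k\<le>n. (d k j * L j s) *\<^sub>R \<Delta> k)"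
      unfolding leg_vel_def c_def scaleR_sum_right by (intro sum.cong refl) (simp add: mult.commute)
    also have "\<dots> = (\<Sum>k\<le>n. \<Sum>j\<le>n. (d k j * L j s) *\<^sub>R \<Delta> k)" by (rule sum.swap)
    also have "\<dots> = (\<Sum>k\<le>n. Bernstein n k s *\<^sub>R \<Delta> k)"
      by (intro sum.cong refl) (simp add: d scaleR_sum_left)
    finally show ?thesis .
  qed
  define Z where "Z s = (\<Sum>k\<le>Suc n. Bernstein (Suc n) k s *\<^sub>R x k)" for s
  have Z': "(Z has_vector_derivative leg_vel n c s) (at s)" for s
  proof -
    define b where "b k = (if k \<le> n then Bernstein n k s else 0)" for k
    have "(Z has_vector_derivative (\<Sum>k\<le>Suc n. (real (Suc n) * ((if k = 0 then 0 else Bernstein n (k - 1) s) - b k)) *\<^sub>R x k)) (at s)"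
      unfolding Z_def[abs_def]
    proof (intro has_vector_derivative_sum)
      fix k assume "k \<in> {..Suc n}"
      then have "((\<lambda>s. Bernstein (Suc n) k s) has_real_derivative
         real (Suc n) * ((if k = 0 then 0 else Bernstein n (k - 1) s) - b k)) (at s)"
        unfolding b_def by (intro bernstein_deriv) auto
      then show "((\<lambda>s. Bernstein (Suc n) k s *\<^sub>R x k) has_vector_derivative (real (Suc n) * ((if k = 0 then 0 else Bernstein n (k - 1) s) - b k)) *\<^sub>R x k) (at s)"
        unfolding has_real_derivative_iff_has_vector_derivative
        by (rule bounded_linear.has_vector_derivative[OF bounded_linear_scaleR_left])
    qed
    also have "(\<Sum>k\<le>Suc n. (real (Suc n) * ((if k = 0 then 0 else Bernstein n (k - 1) s) - b k)) *\<^sub>R x k)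
       = real (Suc n) *\<^sub>R ((\<Sum>k\<le>Suc n. (if k = 0 then 0 else Bernstein n (k - 1) s) *\<^sub>R x k) - (\<Sum>k\<le>Suc n. b k *\<^sub>R x k))"
      by (simp only: scaleR_sum_right scaleR_diff_left scaleR_scaleR[symmetric] sum_subtractf[symmetric] scaleR_diff_right)
    also have "(\<Sum>k\<le>Suc n. (if k = 0 then 0 else Bernstein n (k - 1) s) *\<^sub>R x k) = (\<Sum>k\<le>n. Bernstein n k s *\<^sub>R x (Suc k))"
      unfolding sum.atMost_Suc_shift by simp
    also have "(\<Sum>k\<le>Suc n. b k *\<^sub>R x k) = (\<Sum>k\<le>n. Bernstein n k s *\<^sub>R x k)" by (simp add: b_def)
    also have "real (Suc n) *\<^sub>R ((\<Sum>k\<le>n. Bernstein n k s *\<^sub>R x (Suc k)) - (\<Sum>k\<le>n. Bernstein n k s *\<^sub>R x k)) = leg_vel n c s"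
      unfolding v \<Delta>_def sum_subtractf[symmetric] scaleR_sum_right
      by (intro sum.cong refl) (simp only: scaleR_diff_right scaleR_scaleR mult.commute)
    finally show ?thesis .
  qed
  have Z0: "Z 0 = X 0"
  proof -
    have "Z 0 = (\<Sum>k\<le>Suc n. if k = 0 then x 0 else 0)"
      unfolding Z_def by (intro sum.cong) (auto simp: Bernstein_def)
    then show ?thesis by (simp add: x_def del: sum.atMost_Suc)
  qed
  have Z1: "Z 1 = X 1"
  proof -
    have "Z 1 = (\<Sum>k\<le>Suc n. if k = Suc n then x (Suc n) else 0)"
      unfolding Z_def by (intro sum.cong) (auto simp: Bernstein_def)
    then show ?thesis by (simp add: x_def del: sum.atMost_Suc of_nat_Suc)
  qed
  have eq: "X 0 + leg_path n c s = Z s" for s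
  proof -
    have "((\<lambda>s. Z s - leg_path n c s) has_vector_derivative leg_vel n c s - leg_vel n c s) (at s within UNIV)" for s
      by (intro has_vector_derivative_diff Z' leg_path_deriv)
    then have "((\<lambda>s. Z s - leg_path n c s) has_derivative (\<lambda>h. 0)) (at s within UNIV)" for s
      by (simp add: has_vector_derivative_def)
    then obtain C where C: "\<And>s. s \<in> UNIV \<Longrightarrow> Z s - leg_path n c s = C"
      using has_derivative_zero_constant[OF convex_UNIV, of "\<lambda>s. Z s - leg_path n c s"] by blast
    show ?thesis using C[of 0] C[of s] by (simp add: leg_path_0 Z0 algebra_simps)
  qed
  have "c 0 = X 1 - X 0" using eq[of 1] Z1 by (simp add: leg_path_1 algebra_simps)
  moreover have "norm (leg_vel n c s) \<le> l" if s: "s \<in> {0..1}" for s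
  proof -
    have \<Delta>: "norm (\<Delta> k) \<le> l" if "k \<le> n" for k
    proof -
      have "norm (x (Suc k) - x k) \<le> l * \<bar>real (Suc k) / real (Suc n) - real k / real (Suc n)\<bar>"
        unfolding x_def using that by (intro lip) (auto simp: divide_simps)
      also have "real (Suc k) / real (Suc n) - real k / real (Suc n) = 1 / real (Suc n)"
        by (simp add: diff_divide_distrib[symmetric])
      finally have "real (Suc n) * norm (x (Suc k) - x k) \<le> real (Suc n) * (l * \<bar>1 / real (Suc n)\<bar>)"
        by (intro mult_left_mono) auto
      then show ?thesis unfolding \<Delta>_def by simp
    qed
    have "norm (leg_vel n c s) \<le> (\<Sum>k\<le>n. norm (Bernstein n k s *\<^sub>R \<Delta> k))" unfolding v by (rule norm_sum)
    also have "\<dots> \<le> (\<Sum>k\<le>n. Bernstein n k s * l)"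
      using s \<Delta> Bernstein_nonneg[of s n] by (intro sum_mono) (auto intro!: mult_left_mono)
    also have "\<dots> = l" unfolding sum_distrib_right[symmetric] by simp
    finally show ?thesis .
  qed
  ultimately show ?thesis using eq unfolding Z_def x_def by blast
qed

lemma bernstein_tendsto:
  fixes X :: "real \<Rightarrow> real^'q"
  assumes c: "continuous_on {0..1} X" and s: "s \<in> {0..1}"
  shows "(\<lambda>n. \<Sum>k\<le>n. Bernstein n k s *\<^sub>R X (real k / real n)) \<longlonglongrightarrow> X s"
proof (rule vec_tendstoI)
  fix i
  have ci: "continuous_on {0..1} (\<lambda>s. X s $ i)" by (intro continuous_on_component c)
  show "(\<lambda>n. (\<Sum>k\<le>n. Bernstein n k s *\<^sub>R X (real k / real n)) $ i) \<longlonglongrightarrow> X s $ i"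
    unfolding LIMSEQ_iff
  proof (intro allI impI)
    fix r :: real assume "0 < r"
    from Bernstein_Weierstrass[OF ci this] obtain N where
      N: "\<And>n x. N \<le> n \<Longrightarrow> x \<in> {0..1} \<Longrightarrow> \<bar>X x $ i - (\<Sum>k\<le>n. X (real k / real n) $ i * Bernstein n k x)\<bar> < r" by blast
    show "\<exists>no. \<forall>n\<ge>no. norm ((\<Sum>k\<le>n. Bernstein n k s *\<^sub>R X (real k / real n)) $ i - X s $ i) < r"
    proof (intro exI[of _ N] allI impI)
      fix n assume "N \<le> n"
      from N[OF this s] show "norm ((\<Sum>k\<le>n. Bernstein n k s *\<^sub>R X (real k / real n)) $ i - X s $ i) < r"
        by (simp add: sum_component abs_minus_commute mult.commute)
    qed
  qed
qed

lemma horizontal_integral: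
  fixes U :: "'m::finite \<Rightarrow> real^'q^'q"
  assumes hc: "horizontal_curve U \<gamma> u" and ab: "0 \<le> a" "a \<le> b" "b \<le> 1"
  shows "(u has_integral fst (\<gamma> b) - fst (\<gamma> a)) {a..b}"
    "((\<lambda>r. (T_mat U \<tau> *v fst (\<gamma> r)) \<bullet> u r) has_integral 2 * ((snd (\<gamma> b) - snd (\<gamma> a)) \<bullet> \<tau>)) {a..b}"
proof -
  define w where "w r = (u r, (1/2) *\<^sub>R U_pair U (fst (\<gamma> r)) (u r))" for r
  have "AE r in lebesgue_on {0..1}. (\<gamma> has_vector_derivative w r) (at r within {0..1})"
    using hc unfolding horizontal_curve_def hfield_sum w_def by blast
  then have "AE r in lebesgue. r \<in> {0..1} \<longrightarrow> (\<gamma> has_vector_derivative w r) (at r within {0..1})"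
    by (simp add: AE_restrict_space_iff)
  then obtain N where N: "N \<in> null_sets lebesgue"
    "\<And>r. r \<in> {0..1} \<Longrightarrow> r \<notin> N \<Longrightarrow> (\<gamma> has_vector_derivative w r) (at r within {0..1})"
    unfolding eventually_ae_filter by auto
  have "(w has_integral (\<gamma> b - \<gamma> a)) {a..b}"
  proof (rule abs_cont_on_has_integral)
    show "abs_cont_on \<gamma> {a..b}"
      using hc ab unfolding horizontal_curve_def by (auto intro: abs_cont_on_subset)
    show "a \<le> b" by fact
    show "negligible N" using N(1) by (simp add: negligible_iff_null_sets)
    fix r assume "r \<in> {a..b} - N"
    then have "(\<gamma> has_vector_derivative w r) (at r within {0..1})" using ab by (intro N(2)) auto
    then show "(\<gamma> has_vector_derivative w r) (at r within {a..b})"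
      by (rule has_vector_derivative_within_subset) (use ab in auto)
  qed
  note w = this
  show "(u has_integral fst (\<gamma> b) - fst (\<gamma> a)) {a..b}"
    using has_integral_linear[OF w bounded_linear_fst] by (simp add: o_def w_def fst_diff)
  have "((\<lambda>r. (1/2) *\<^sub>R U_pair U (fst (\<gamma> r)) (u r)) has_integral snd (\<gamma> b) - snd (\<gamma> a)) {a..b}"
    using has_integral_linear[OF w bounded_linear_snd] by (simp add: o_def w_def snd_diff)
  from has_integral_inner_right[OF this, of "2 *\<^sub>R \<tau>"]
  show "((\<lambda>r. (T_mat U \<tau> *v fst (\<gamma> r)) \<bullet> u r) has_integral 2 * ((snd (\<gamma> b) - snd (\<gamma> a)) \<bullet> \<tau>)) {a..b}"
    by (simp add: inner_commute[of \<tau>] U_pair_inner)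
qed

lemma sum_increments_bound:
  fixes G f :: "nat \<Rightarrow> real"
  assumes "\<And>i. i < M \<Longrightarrow> \<bar>(G (Suc i) - G i) - f i\<bar> \<le> b"
  shows "\<bar>(G M - G 0) - (\<Sum>i<M. f i)\<bar> \<le> real M * b"
proof -
  have "(G M - G 0) - (\<Sum>i<M. f i) = (\<Sum>i<M. (G (Suc i) - G i) - f i)"
    unfolding sum_lessThan_telescope[symmetric] sum_subtractf[symmetric] ..
  also have "\<bar>\<dots>\<bar> \<le> (\<Sum>i<M. \<bar>(G (Suc i) - G i) - f i\<bar>)" by (rule sum_abs)
  also have "\<dots> \<le> (\<Sum>i<M. b)" using assms by (intro sum_mono) auto
  finally show ?thesis by simp
qed

text \<open>A left Riemann sum sees the path at finitely many points only, so pointwise convergence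
  of paths suffices and their velocities need not converge.\<close>

definition area_sum :: "real^'q^'q \<Rightarrow> nat \<Rightarrow> (real \<Rightarrow> real^'q) \<Rightarrow> real" where
  "area_sum T M Y = (\<Sum>i<M. (T *v Y (real i / real M)) \<bullet> (Y (real (Suc i) / real M) - Y (real i / real M)))"

lemma area_sum_C1:
  fixes T :: "real^'q^'q"
  assumes der: "\<And>s. (Z has_vector_derivative v s) (at s)" and cv: "continuous_on UNIV v"
    and vl: "\<And>s. s \<in> {0..1} \<Longrightarrow> norm (v s) \<le> l" and l: "l \<ge> 0"
    and I: "((\<lambda>s. (T *v Z s) \<bullet> v s) has_integral I) {0..1}"
    and K: "\<And>x. norm (T *v x) \<le> K * norm x" "K \<ge> 0" and M: "M > 0"
  shows "\<bar>I - area_sum T M Z\<bar> \<le> real M * (K * (l / real M)\<^sup>2)"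
proof -
  define f where "f s = (T *v Z s) \<bullet> v s" for s
  define G where "G i = integral {0..real i / real M} f" for i
  have fint: "f integrable_on {0..1}" using I unfolding f_def by (rule has_integral_integrable)
  have Zint: "(v has_integral Z d - Z c) {c..d}" if "c \<le> d" for c d
    by (rule fundamental_theorem_of_calculus[OF that]) (rule has_vector_derivative_at_within[OF der])
  have "\<bar>(G M - G 0) - (\<Sum>i<M. (T *v Z (real i / real M)) \<bullet> (Z (real (Suc i) / real M) - Z (real i / real M)))\<bar>
      \<le> real M * (K * (l / real M)\<^sup>2)"
  proof (rule sum_increments_bound)
    fix i assume i: "i < M"
    define c d where "c = real i / real M" and "d = real (Suc i) / real M"
    have cd: "0 \<le> c" "c \<le> d" "d \<le> 1" "d - c = 1 / real M"
      using i M by (auto simp: c_def d_def divide_simps)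
    have fi: "f integrable_on {0..d}" by (rule integrable_on_subinterval[OF fint]) (use cd in auto)
    have "G (Suc i) - G i = integral {c..d} f"
      using Henstock_Kurzweil_Integration.integral_combine[OF cd(1,2) fi] by (simp add: G_def c_def d_def)
    moreover have "\<bar>integral {c..d} f - (T *v Z c) \<bullet> (Z d - Z c)\<bar> \<le> K * (l / real M)\<^sup>2"
    proof (rule area_riemann_piece[where u=v])
      show "(v has_integral Z d - Z c) {c..d}" by (rule Zint[OF cd(2)])
      have cn: "continuous_on {c..d} (\<lambda>s. norm (v s))"
        by (intro continuous_on_norm continuous_on_subset[OF cv]) auto
      then show ni: "(\<lambda>s. norm (v s)) integrable_on {c..d}" by (rule integrable_continuous_real)
      have "integral {c..d} (\<lambda>s. norm (v s)) \<le> integral {c..d} (\<lambda>_. l)"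
        by (rule integral_le[OF ni integrable_const_ivl]) (use cd vl in auto)
      also have "\<dots> = l / real M" using cd(2,4) by simp
      finally show "integral {c..d} (\<lambda>s. norm (v s)) \<le> l / real M" .
      fix s assume s: "s \<in> {c..d}"
      have "norm (Z s - Z c) \<le> l * measure lborel {c..s}"
        by (rule has_integral_bound_real[OF l finite.emptyI Zint]) (use s cd vl in auto)
      also have "\<dots> \<le> l * (1 / real M)"
        using s cd by (intro mult_left_mono l) auto
      finally show "norm (Z s - Z c) \<le> l / real M" by simp
    next
      have "f integrable_on {c..d}" by (rule integrable_on_subinterval[OF fint]) (use cd in auto)
      then show "((\<lambda>s. (T *v Z s) \<bullet> v s) has_integral integral {c..d} f) {c..d}"
        unfolding f_def[abs_def] by (rule integrable_integral)
    qed (use K l in auto)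
    ultimately show "\<bar>(G (Suc i) - G i) - (T *v Z (real i / real M)) \<bullet> (Z (real (Suc i) / real M) - Z (real i / real M))\<bar> \<le> K * (l / real M)\<^sup>2"
      by (simp add: c_def d_def)
  qed
  moreover have "G M = I" "G 0 = 0" using M integral_unique[OF I] by (simp_all add: G_def f_def[abs_def])
  ultimately show ?thesis by (simp add: area_sum_def)
qed

text \<open>Arc length parametrisation, with a small multiple of the time added to make the length
  function strictly increasing.\<close>
lemma arc_length_param:
  fixes U :: "'m::finite \<Rightarrow> real^'q^'q"
  assumes hc: "horizontal_curve U \<gamma> u" and len: "integral {0..1} (\<lambda>r. norm (u r)) < l"
  shows "\<exists>\<rho>. \<rho> 0 = 0 \<and> \<rho> 1 = 1 \<and> (\<forall>s s'. 0 \<le> s \<longrightarrow> s \<le> s' \<longrightarrow> s' \<le> 1 \<longrightarrow>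
     0 \<le> \<rho> s \<and> \<rho> s \<le> \<rho> s' \<and> \<rho> s' \<le> 1 \<and> integral {\<rho> s..\<rho> s'} (\<lambda>r. norm (u r)) \<le> l * (s' - s))"
proof -
  define len where "len = integral {0..1} (\<lambda>r. norm (u r))"
  have nint: "(\<lambda>r. norm (u r)) integrable_on {0..1}"
    using hc unfolding horizontal_curve_def absolutely_integrable_on_def by blast
  have sub: "(\<lambda>r. norm (u r)) integrable_on {a..b}" if "0 \<le> a" "b \<le> 1" for a b
    by (rule integrable_on_subinterval[OF nint]) (use that in auto)
  define S where "S r = integral {0..r} (\<lambda>r. norm (u r)) + (l - len) * r" for r
  have Sd: "S b - S a = integral {a..b} (\<lambda>r. norm (u r)) + (l - len) * (b - a)" if "0 \<le> a" "a \<le> b" "b \<le> 1" for a b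
    using Henstock_Kurzweil_Integration.integral_combine[OF that(1,2) sub[OF order_refl that(3)]] by (simp add: S_def algebra_simps)
  have ge: "integral {a..b} (\<lambda>r. norm (u r)) \<le> S b - S a" if "0 \<le> a" "a \<le> b" "b \<le> 1" for a b
    using Sd[OF that] len that mult_nonneg_nonneg[of "l - len" "b - a"] by (simp add: len_def)
  have mono: "S a < S b" if "0 \<le> a" "a < b" "b \<le> 1" for a b
  proof -
    have "0 \<le> integral {a..b} (\<lambda>r. norm (u r))" by (rule integral_nonneg[OF sub]) (use that in auto)
    moreover have "0 < (l - len) * (b - a)" using len that by (simp add: len_def)
    ultimately show ?thesis using Sd[of a b] that by linarith
  qed
  have S01: "S 0 = 0" "S 1 = l" by (simp_all add: S_def len_def)
  have l: "l > 0" using mono[of 0 1] S01 by simp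
  have "continuous_on {0..1} S"
    unfolding S_def[abs_def] by (intro continuous_intros indefinite_integral_continuous_1 nint)
  then have "\<exists>r. r \<in> {0..1} \<and> S r = l * s" if "s \<in> {0..1}" for s
    using IVT'[of S 0 "l * s" 1] that l by (auto simp: S01)
  then obtain \<rho> where \<rho>: "\<And>s. s \<in> {0..1} \<Longrightarrow> \<rho> s \<in> {0..1} \<and> S (\<rho> s) = l * s"
    using bchoice[of "{0..1}" "\<lambda>s r. r \<in> {0..1} \<and> S r = l * s"] by blast
  have "\<rho> 0 = 0"
    using \<rho>[of 0] mono[of 0 "\<rho> 0"] S01 by (cases "\<rho> 0 = 0") auto
  moreover have "\<rho> 1 = 1"
    using \<rho>[of 1] mono[of "\<rho> 1" 1] S01 by (cases "\<rho> 1 = 1") auto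
  moreover have "0 \<le> \<rho> s \<and> \<rho> s \<le> \<rho> s' \<and> \<rho> s' \<le> 1 \<and> integral {\<rho> s..\<rho> s'} (\<lambda>r. norm (u r)) \<le> l * (s' - s)"
    if "0 \<le> s" "s \<le> s'" "s' \<le> 1" for s s'
  proof -
    have r: "\<rho> s \<in> {0..1}" "S (\<rho> s) = l * s" "\<rho> s' \<in> {0..1}" "S (\<rho> s') = l * s'" using \<rho> that by auto
    have "l * s \<le> l * s'" using that l by simp
    then have le: "\<rho> s \<le> \<rho> s'"
      using mono[of "\<rho> s'" "\<rho> s"] r by (cases "\<rho> s \<le> \<rho> s'") auto
    then show ?thesis using ge[of "\<rho> s" "\<rho> s'"] r by (auto simp: algebra_simps)
  qed
  ultimately show ?thesis by blast
qed

text \<open>Only the horizontal component is reparametrised and smoothed; the central component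
  enters through its increments, which \<open>horizontal_integral\<close> identifies as areas. The
  strict bound on the length leaves room for the extra time term in the arc length function.\<close>

lemma curve_approx:
  fixes U :: "'m::finite \<Rightarrow> real^'q^'q"
  assumes U: "step_two_data U" and hc: "horizontal_curve U \<gamma> u" and \<gamma>: "\<gamma> 0 = (x, t)" "\<gamma> 1 = 0"
    and len: "integral {0..1} (\<lambda>r. norm (u r)) < l" and \<epsilon>: "\<epsilon> > 0"
  shows "\<exists>n \<sigma>. sqrt 2 *\<^sub>R \<sigma> 0 = x \<and> (\<Sum>j\<le>n. 2 * (2 * real j + 1) * (norm (\<sigma> j))\<^sup>2) \<le> l\<^sup>2 \<and>
     norm (t + (\<Sum>j<n. U_pair U (\<sigma> j) (\<sigma> (Suc j)))) < \<epsilon>"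
proof -
  have nint: "(\<lambda>r. norm (u r)) integrable_on {0..1}"
    using hc unfolding horizontal_curve_def absolutely_integrable_on_def by blast
  have sub: "(\<lambda>r. norm (u r)) integrable_on {a..b}" if "0 \<le> a" "b \<le> 1" for a b
    by (rule integrable_on_subinterval[OF nint]) (use that in auto)
  have "0 \<le> integral {0..1} (\<lambda>r. norm (u r))" by (rule integral_nonneg[OF nint]) simp
  then have l: "l > 0" using len by simp
  obtain \<rho> where \<rho>01: "\<rho> 0 = 0" "\<rho> 1 = 1"
    and \<rho>: "\<And>s s'. 0 \<le> s \<Longrightarrow> s \<le> s' \<Longrightarrow> s' \<le> 1 \<Longrightarrow>
     0 \<le> \<rho> s \<and> \<rho> s \<le> \<rho> s' \<and> \<rho> s' \<le> 1 \<and> integral {\<rho> s..\<rho> s'} (\<lambda>r. norm (u r)) \<le> l * (s' - s)"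
    using arc_length_param[OF hc len] by blast
  define Y where "Y r = fst (\<gamma> r)" for r
  define X where "X s = Y (\<rho> s)" for s
  have Yd: "norm (Y b - Y a) \<le> integral {a..b} (\<lambda>r. norm (u r))" if "0 \<le> a" "a \<le> b" "b \<le> 1" for a b
  proof -
    have i: "(u has_integral Y b - Y a) {a..b}" unfolding Y_def by (rule horizontal_integral(1)[OF hc that])
    have "norm (integral {a..b} u) \<le> integral {a..b} (\<lambda>r. norm (u r))"
      by (rule integral_norm_bound_integral[OF has_integral_integrable[OF i] sub]) (use that in auto)
    then show ?thesis using integral_unique[OF i] by simp
  qed
  have X01: "X 0 = x" "X 1 = 0" by (simp_all add: X_def Y_def \<rho>01 \<gamma>)
  have lip1: "norm (X s' - X s) \<le> l * (s' - s)" if "0 \<le> s" "s \<le> s'" "s' \<le> 1" for s s'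
    using \<rho>[OF that] Yd[of "\<rho> s" "\<rho> s'"] unfolding X_def by linarith
  have lip: "norm (X s - X s') \<le> l * \<bar>s - s'\<bar>" if "s \<in> {0..1}" "s' \<in> {0..1}" for s s'
  proof (cases "s \<le> s'")
    case True
    then show ?thesis using lip1[of s s'] that by (simp add: norm_minus_commute abs_if)
  next
    case False
    then show ?thesis using lip1[of s' s] that by simp
  qed
  have contX: "continuous_on {0..1} X"
  proof (rule lipschitz_on_continuous_on[of l])
    show "l-lipschitz_on {0..1} X"
      using lip l by (auto simp: lipschitz_on_def dist_norm)
  qed
  have "\<forall>n. \<exists>c. c 0 = X 1 - X 0 \<and> (\<forall>s\<in>{0..1}. norm (leg_vel n c s) \<le> l) \<and>
     (\<forall>s. X 0 + leg_path n c s = (\<Sum>k\<le>Suc n. Bernstein (Suc n) k s *\<^sub>R X (real k / real (Suc n))))"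
    using bernstein_path[OF lip] by blast
  then obtain c where c0: "\<And>n. c n 0 = X 1 - X 0" and cl: "\<And>n s. s \<in> {0..1} \<Longrightarrow> norm (leg_vel n (c n) s) \<le> l"
    and cB: "\<And>n s. X 0 + leg_path n (c n) s = (\<Sum>k\<le>Suc n. Bernstein (Suc n) k s *\<^sub>R X (real k / real (Suc n)))"
    unfolding choice_iff by blast
  define Z where "Z n s = x + leg_path n (c n) s" for n s
  have Z: "(\<lambda>n. Z n s) \<longlonglongrightarrow> X s" if "s \<in> {0..1}" for s
    using LIMSEQ_Suc[OF bernstein_tendsto[OF contX that]] unfolding Z_def cB[unfolded X01] .
  have Z': "(Z n has_vector_derivative leg_vel n (c n) s) (at s)" for n s
    unfolding Z_def[abs_def] using has_vector_derivative_add[OF has_vector_derivative_const leg_path_deriv[of n "c n" s UNIV]] by simp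
  \<comment> \<open>Inverse of the scaling in \<open>exists_curve\<close>, with its sign: c holds
    the velocity coefficients of the path from x to 0.\<close>
  define \<sigma> where "\<sigma> n j = (- 1 / (sqrt 2 * (2 * real j + 1))) *\<^sub>R c n j" for n j
  have \<sigma>0: "sqrt 2 *\<^sub>R \<sigma> n 0 = x" for n by (simp add: \<sigma>_def c0 X01)
  have E: "(\<Sum>j\<le>n. 2 * (2 * real j + 1) * (norm (\<sigma> n j))\<^sup>2) \<le> l\<^sup>2" for n
  proof -
    have "2 * (2 * real j + 1) * (norm (\<sigma> n j))\<^sup>2 = (norm (c n j))\<^sup>2 / (2 * real j + 1)" for j
    proof -
      have gen: "2 * A * (N / (sqrt 2 * A))\<^sup>2 = N\<^sup>2 / A" if "A > 0" for A N :: real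
        using that by (simp add: power_divide power_mult_distrib power2_eq_square[of A])
      have "norm (\<sigma> n j) = norm (c n j) / (sqrt 2 * (2 * real j + 1))" by (simp add: \<sigma>_def add_nonneg_nonneg abs_mult)
      then show ?thesis using gen[of "2 * real j + 1" "norm (c n j)"] by (simp only:)
    qed
    moreover have "(\<Sum>j\<le>n. (norm (c n j))\<^sup>2 / (2 * real j + 1)) \<le> l\<^sup>2"
    proof (rule has_integral_le[OF leg_energy])
      show "((\<lambda>_. l\<^sup>2) has_integral l\<^sup>2) {0..1::real}" using has_integral_const_real[of "l\<^sup>2" 0 1] by simp
      fix s :: real assume "s \<in> {0..1}"
      then show "(norm (leg_vel n (c n) s))\<^sup>2 \<le> l\<^sup>2" by (intro power_mono cl) auto
    qed
    ultimately show ?thesis by simp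
  qed
  define d where "d n = t + (\<Sum>j<n. U_pair U (\<sigma> n j) (\<sigma> n (Suc j)))" for n
  \<comment> \<open>Three comparisons through Riemann sums over M pieces: the errors for X and for
    \<open>Z n\<close> are at most K l^2 / M, uniformly in n, and for fixed M the sums of
    \<open>Z n\<close> tend to that of X. So M is chosen before n.\<close>
  have lim: "(\<lambda>n. d n \<bullet> \<tau>) \<longlonglongrightarrow> 0" for \<tau>
  proof -
    define T where "T = T_mat U \<tau>"
    have skew: "transpose T = - T" unfolding T_def by (rule transpose_T_mat[OF U])
    define K where "K = freq U \<tau>"
    have K: "norm (T *v y) \<le> K * norm y" "K \<ge> 0" for y unfolding T_def K_def by (rule norm_T_mat_le, rule freq_nonneg)
    define I where "I n = (\<Sum>j<n. ((T *v c n j) \<bullet> c n (Suc j)) / ((2 * real j + 1) * (2 * real j + 3)))" for n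
    have I: "((\<lambda>s. (T *v Z n s) \<bullet> leg_vel n (c n) s) has_integral I n) {0..1}" for n
    proof -
      have "((\<lambda>s. (T *v x) \<bullet> leg_vel n (c n) s + (T *v leg_path n (c n) s) \<bullet> leg_vel n (c n) s) has_integral ((T *v x) \<bullet> c n 0 + I n)) {0..1}"
        unfolding I_def by (intro has_integral_add has_integral_inner_right leg_vel_has_integral leg_area[OF skew])
      moreover have "(T *v x) \<bullet> c n 0 = 0" using skew_inner[OF skew, of x x] by (simp add: c0 X01 inner_commute)
      ultimately show ?thesis by (simp add: Z_def matrix_vector_right_distrib inner_add_left)
    qed
    have dn: "2 * (d n \<bullet> \<tau>) = 2 * (t \<bullet> \<tau>) + I n" for n
    proof -
      have "2 * (U_pair U (\<sigma> n j) (\<sigma> n (Suc j)) \<bullet> \<tau>) = ((T *v c n j) \<bullet> c n (Suc j)) / ((2 * real j + 1) * (2 * real j + 3))" for j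
      proof -
        have gen: "2 * ((- 1 / (sqrt 2 * A)) * ((- 1 / (sqrt 2 * B)) * p)) = p / (A * B)" for A B p :: real
        proof -
          have e: "(sqrt 2 * A) * (sqrt 2 * B) = 2 * (A * B)" by simp
          have "2 * ((- 1 / (sqrt 2 * A)) * ((- 1 / (sqrt 2 * B)) * p)) = 2 * (p / ((sqrt 2 * A) * (sqrt 2 * B)))"
            by simp
          then show ?thesis unfolding e by simp
        qed
        have "U_pair U (\<sigma> n j) (\<sigma> n (Suc j)) \<bullet> \<tau> = (- 1 / (sqrt 2 * (2 * real j + 1))) * ((- 1 / (sqrt 2 * (2 * real j + 3))) * ((T *v c n j) \<bullet> c n (Suc j)))"
          unfolding U_pair_inner T_def[symmetric] \<sigma>_def matrix_vector_mult_scaleR inner_scaleR_left inner_scaleR_right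
          by (simp add: add.commute)
        then show ?thesis by (simp only: gen)
      qed
      then show ?thesis unfolding d_def I_def by (simp add: inner_add_left inner_sum_left distrib_left sum_distrib_left)
    qed
    have A: "\<bar>- 2 * (t \<bullet> \<tau>) - area_sum T M X\<bar> \<le> real M * (K * (l / real M)\<^sup>2)" if M: "M > 0" for M
    proof -
      define G where "G i = 2 * (snd (\<gamma> (\<rho> (real i / real M))) \<bullet> \<tau>)" for i
      have "\<bar>(G M - G 0) - area_sum T M X\<bar> \<le> real M * (K * (l / real M)\<^sup>2)"
        unfolding area_sum_def
      proof (rule sum_increments_bound)
        fix i assume i: "i < M"
        define a b where "a = \<rho> (real i / real M)" and "b = \<rho> (real (Suc i) / real M)"
        have s: "0 \<le> real i / real M" "real i / real M \<le> real (Suc i) / real M" "real (Suc i) / real M \<le> 1"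
          "real (Suc i) / real M - real i / real M = 1 / real M"
          using i M by (auto simp: divide_simps)
        have ab: "0 \<le> a" "a \<le> b" "b \<le> 1" "integral {a..b} (\<lambda>r. norm (u r)) \<le> l / real M"
          using \<rho>[OF s(1-3)] unfolding a_def b_def s(4) by auto
        have "\<bar>2 * ((snd (\<gamma> b) - snd (\<gamma> a)) \<bullet> \<tau>) - (T *v Y a) \<bullet> (Y b - Y a)\<bar> \<le> K * (l / real M)\<^sup>2"
        proof (rule area_riemann_piece[where X=Y and u=u and c=a and d=b])
          show "(u has_integral Y b - Y a) {a..b}" unfolding Y_def by (rule horizontal_integral(1)[OF hc ab(1-3)])
          show "(\<lambda>r. norm (u r)) integrable_on {a..b}" by (rule sub[OF ab(1,3)])
          show "integral {a..b} (\<lambda>r. norm (u r)) \<le> l / real M" by (rule ab(4))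
          show "((\<lambda>r. (T *v Y r) \<bullet> u r) has_integral 2 * ((snd (\<gamma> b) - snd (\<gamma> a)) \<bullet> \<tau>)) {a..b}"
            unfolding T_def Y_def by (rule horizontal_integral(2)[OF hc ab(1-3)])
          show "0 \<le> l / real M" using l by simp
          fix r assume r: "r \<in> {a..b}"
          have "norm (Y r - Y a) \<le> integral {a..r} (\<lambda>r. norm (u r))" using ab r by (intro Yd) auto
          also have "\<dots> \<le> integral {a..b} (\<lambda>r. norm (u r))"
            using ab r by (intro integral_subset_le sub) auto
          finally show "norm (Y r - Y a) \<le> l / real M" using ab(4) by linarith
        qed (rule K)+
        then show "\<bar>(G (Suc i) - G i) - (T *v X (real i / real M)) \<bullet> (X (real (Suc i) / real M) - X (real i / real M))\<bar> \<le> K * (l / real M)\<^sup>2"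
          unfolding G_def X_def a_def b_def by (simp only: inner_diff_left right_diff_distrib)
      qed
      moreover have "G M - G 0 = - 2 * (t \<bullet> \<tau>)" using M by (simp add: G_def \<rho>01 \<gamma>)
      ultimately show ?thesis by simp
    qed
    have B: "\<bar>I n - area_sum T M (Z n)\<bar> \<le> real M * (K * (l / real M)\<^sup>2)" if "M > 0" for M n
      by (rule area_sum_C1[OF Z' continuous_leg_vel cl less_imp_le[OF l] I K that])
    have C: "(\<lambda>n. area_sum T M (Z n)) \<longlonglongrightarrow> area_sum T M X" if "M > 0" for M
      unfolding area_sum_def
    proof (intro tendsto_sum tendsto_inner tendsto_diff bounded_linear.tendsto[OF matrix_vector_mul_bounded_linear])
      fix i assume "i \<in> {..<M}"
      then have "real i / real M \<in> {0..1}" "real (Suc i) / real M \<in> {0..1}" using that by (auto simp: divide_simps)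
      then show "(\<lambda>n. Z n (real i / real M)) \<longlonglongrightarrow> X (real i / real M)"
        "(\<lambda>n. Z n (real (Suc i) / real M)) \<longlonglongrightarrow> X (real (Suc i) / real M)"
        "(\<lambda>n. Z n (real i / real M)) \<longlonglongrightarrow> X (real i / real M)" by (auto intro: Z)
    qed
    show ?thesis
      unfolding LIMSEQ_iff
    proof (intro allI impI)
      fix r :: real assume r: "0 < r"
      obtain M' :: nat where M': "2 * (K * l\<^sup>2) / r < real M'" using reals_Archimedean2 by blast
      define M where "M = Suc M'"
      have M: "M > 0" "2 * (K * l\<^sup>2) / r < real M" using M' by (auto simp: M_def)
      have e: "real M * (K * (l / real M)\<^sup>2) = K * l\<^sup>2 / real M" using M(1) by (simp add: power2_eq_square)
      have "2 * (K * l\<^sup>2) < real M * r" using M(2) r by (simp add: divide_less_eq)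
      then have small: "2 * (real M * (K * (l / real M)\<^sup>2)) < r" unfolding e using M(1) by (simp add: divide_less_eq mult.commute)
      obtain no where no: "\<And>n. n \<ge> no \<Longrightarrow> norm (area_sum T M (Z n) - area_sum T M X) < r"
        using C[OF M(1)] r unfolding LIMSEQ_iff by blast
      show "\<exists>no. \<forall>n\<ge>no. norm (d n \<bullet> \<tau> - 0) < r"
      proof (intro exI[of _ no] allI impI)
        fix n assume "n \<ge> no"
        then have "\<bar>area_sum T M (Z n) - area_sum T M X\<bar> < r" using no by simp
        then have "\<bar>2 * (d n \<bullet> \<tau>)\<bar> < 2 * r" using A[OF M(1)] B[OF M(1), of n] small unfolding dn by linarith
        then show "norm (d n \<bullet> \<tau> - 0) < r" by simp
      qed
    qed
  qed
  have "d \<longlonglongrightarrow> 0"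
  proof (rule vec_tendstoI)
    fix i show "(\<lambda>n. d n $ i) \<longlonglongrightarrow> 0 $ i" using lim[of "axis i 1"] by (simp add: inner_axis)
  qed
  then obtain n where "norm (d n) < \<epsilon>" using \<epsilon> unfolding LIMSEQ_iff by fastforce
  then show ?thesis using \<sigma>0 E unfolding d_def by blast
qed

section \<open>The functionals in Legendre coordinates\<close>

text \<open>Here \<open>(2j + 1) sqrt 2 \<sigma>\<^sub>j\<close> is the coefficient of the \<open>j\<close>-th Legendre polynomial in the velocity of the
  horizontal part of a curve, \<open>energy\<close> is the integral of the squared speed, and \<open>defect\<close>
  is the error in the central component of the end point.\<close>
definition energy :: "nat \<Rightarrow> (nat \<Rightarrow> 'a::real_normed_vector) \<Rightarrow> real" where
  "energy n \<sigma> = (\<Sum>j\<le>n. 2 * (2 * real j + 1) * (norm (\<sigma> j))\<^sup>2)"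

definition defect :: "('m::finite \<Rightarrow> real^'q^'q) \<Rightarrow> nat \<Rightarrow> real^'m \<Rightarrow> (nat \<Rightarrow> real^'q) \<Rightarrow> real^'m" where
  "defect U n t \<sigma> = t + (\<Sum>j<n. U_pair U (\<sigma> j) (\<sigma> (Suc j)))"

definition psi :: "('m::finite \<Rightarrow> real^'q^'q) \<Rightarrow> nat \<Rightarrow> real^'m \<Rightarrow> (nat \<Rightarrow> real^'q) \<Rightarrow> real^'m \<Rightarrow> real" where
  "psi U n t \<sigma> \<tau> = energy n \<sigma> + 2 * rho U n \<tau> (\<sigma> n) + 4 * (defect U n t \<sigma> \<bullet> \<tau>)"

text \<open>With this head, |x|^2 becomes 2 |sigma_0|^2 and the factor 1 / sqrt 2 of the first
  bracket is absorbed, so index 0 follows the common pattern and one functional \<open>psi\<close>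
  covers k = 0 as well.\<close>

definition with_head :: "real^'q \<Rightarrow> (nat \<Rightarrow> real^'q) \<Rightarrow> nat \<Rightarrow> real^'q" where
  "with_head x s j = (if j = 0 then (1 / sqrt 2) *\<^sub>R x else s j)"

lemma energy_Suc: "energy (Suc n) \<sigma> = energy n \<sigma> + 2 * (2 * real n + 3) * (norm (\<sigma> (Suc n)))\<^sup>2"
  by (simp add: energy_def add.commute)

lemma defect_Suc: "defect U (Suc n) t \<sigma> = defect U n t \<sigma> + U_pair U (\<sigma> n) (\<sigma> (Suc n))"
  by (simp add: defect_def)

lemma energy_cong: "(\<And>j. j \<le> n \<Longrightarrow> \<sigma> j = \<sigma>' j) \<Longrightarrow> energy n \<sigma> = energy n \<sigma>'"
  by (simp add: energy_def)

lemma defect_cong: "(\<And>j. j \<le> n \<Longrightarrow> \<sigma> j = \<sigma>' j) \<Longrightarrow> defect U n t \<sigma> = defect U n t \<sigma>'"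
  by (simp add: defect_def)

lemma psi_cong: "(\<And>j. j \<le> n \<Longrightarrow> \<sigma> j = \<sigma>' j) \<Longrightarrow> psi U n t \<sigma> \<tau> = psi U n t \<sigma>' \<tau>"
  using energy_cong[of n \<sigma> \<sigma>'] defect_cong[of n \<sigma> \<sigma>' U t] by (simp add: psi_def)

lemma energy_nonneg: "0 \<le> energy n \<sigma>"
  unfolding energy_def by (intro sum_nonneg) simp

lemma energy_term_le: "j \<le> n \<Longrightarrow> (norm (\<sigma> j))\<^sup>2 \<le> energy n \<sigma>"
proof -
  assume j: "j \<le> n"
  have "1 * (norm (\<sigma> j))\<^sup>2 \<le> 2 * (2 * real j + 1) * (norm (\<sigma> j))\<^sup>2" by (intro mult_right_mono) auto
  also have "\<dots> \<le> energy n \<sigma>"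
    unfolding energy_def by (rule member_le_sum[of j "{..n}"]) (use j in auto)
  finally show ?thesis by simp
qed

lemma U_pair_scaleR_left: "U_pair U (c *\<^sub>R x) y = c *\<^sub>R U_pair U x y"
  by (simp add: U_pair_def vec_eq_iff matrix_vector_mult_scaleR)

lemma U_pair_scaleR_right: "U_pair U x (c *\<^sub>R y) = c *\<^sub>R U_pair U x y"
  by (simp add: U_pair_def vec_eq_iff)

lemma U_pair_zero [simp]: "U_pair U 0 y = 0" "U_pair U x 0 = 0"
  by (simp_all add: U_pair_def vec_eq_iff)

context
  fixes U :: "'m::finite \<Rightarrow> real^'q^'q"
  assumes U: "step_two_data U"
begin

lemma phi_eq_psi:
  assumes \<tau>: "\<tau> \<in> Omega U k"
  shows "phi U k (x, t) s \<tau> = psi U k t (with_head x s) \<tau>"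
proof (cases k)
  case 0
  have "rho U 0 \<tau> ((1 / sqrt 2) *\<^sub>R x) = (1/2) * rho U 0 \<tau> x"
    unfolding rho_scaleR[OF U] by (simp add: power_divide)
  then show ?thesis
    using z_cot_form[OF U, of \<tau> x] \<tau> unfolding 0
    by (simp add: phi_def psi_def energy_def defect_def with_head_def power_divide)
next
  case (Suc n)
  have 1: "energy k (with_head x s) = (norm x)\<^sup>2 + (\<Sum>j=1..k. 2 * (2 * real j + 1) * (norm (s j))\<^sup>2)"
  proof -
    have "energy k (with_head x s) = 2 * (2 * real 0 + 1) * (norm (with_head x s 0))\<^sup>2 + (\<Sum>j=1..k. 2 * (2 * real j + 1) * (norm (with_head x s j))\<^sup>2)"
      unfolding energy_def atMost_atLeast0 by (subst sum.atLeast_Suc_atMost) auto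
    then show ?thesis by (simp add: with_head_def power_divide)
  qed
  have 2: "(\<Sum>j<k. U_pair U (with_head x s j) (with_head x s (Suc j)))
     = (1 / sqrt 2) *\<^sub>R U_pair U x (s 1) + (\<Sum>j=2..k. U_pair U (s (j - 1)) (s j))"
  proof -
    have "(\<Sum>j<k. U_pair U (with_head x s j) (with_head x s (Suc j)))
       = U_pair U (with_head x s 0) (with_head x s 1) + (\<Sum>j<n. U_pair U (with_head x s (Suc j)) (with_head x s (Suc (Suc j))))"
      unfolding Suc by (subst sum.lessThan_Suc_shift) simp
    also have "(\<Sum>j<n. U_pair U (with_head x s (Suc j)) (with_head x s (Suc (Suc j)))) = (\<Sum>j=2..k. U_pair U (s (j - 1)) (s j))"
      unfolding Suc by (rule sum.reindex_bij_witness[of _ "\<lambda>j. j - 2" "\<lambda>j. Suc (Suc j)"]) (auto simp: with_head_def)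
    finally show ?thesis by (simp add: with_head_def U_pair_scaleR_left)
  qed
  have 3: "with_head x s k = s k" by (simp add: with_head_def Suc)
  have "phi U k (x, t) s \<tau> = (norm x)\<^sup>2 + (\<Sum>j=1..k. 2 * (2 * real j + 1) * (norm (s j))\<^sup>2)
     + 2 * rho U k \<tau> (s k) + 4 * ((t + (1 / sqrt 2) *\<^sub>R U_pair U x (s 1) + (\<Sum>j=2..k. U_pair U (s (j - 1)) (s j))) \<bullet> \<tau>)"
    by (simp add: phi_def rho_def Suc del: sum.cl_ivl_Suc)
  then show ?thesis unfolding psi_def 1 defect_def 2 3 by (simp only: add.assoc)
qed

lemma psi_zero: "psi U k t \<sigma> 0 = energy k \<sigma>"
  by (simp add: psi_def rho_zero[OF U])

lemma psi_le:
  assumes "\<tau> \<in> Omega U k" "k \<le> n"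
  shows "psi U n t \<sigma> \<tau> \<le> energy n \<sigma> + 4 * (defect U n t \<sigma> \<bullet> \<tau>)"
  using rho_nonpos[OF U assms, of "\<sigma> n"] by (simp add: psi_def)

lemma psi_minimum:
  assumes \<tau>: "\<tau> \<in> Omega U n"
  shows "\<exists>s0 c. c > 0 \<and>
    (\<forall>s'. psi U n t \<sigma> \<tau> + c * (norm (s' - s0))\<^sup>2 \<le> psi U (Suc n) t (\<sigma>(Suc n := s')) \<tau>) \<and>
    psi U (Suc n) t (\<sigma>(Suc n := s0)) \<tau> = psi U n t \<sigma> \<tau>"
proof -
  define F where "F s' = (2 * real n + 3) * (norm s')\<^sup>2 + 2 * ((T_mat U \<tau> *v \<sigma> n) \<bullet> s') + rho U (Suc n) \<tau> s'" for s'
  obtain s0 c where c: "c > 0" "\<And>s'. rho U n \<tau> (\<sigma> n) + c * (norm (s' - s0))\<^sup>2 \<le> F s'" "F s0 = rho U n \<tau> (\<sigma> n)"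
    using rho_minimum[OF U \<tau>, of "\<sigma> n"] unfolding F_def by blast
  have e: "psi U (Suc n) t (\<sigma>(Suc n := s')) \<tau> = psi U n t \<sigma> \<tau> + 2 * (F s' - rho U n \<tau> (\<sigma> n))" for s'
  proof -
    have "energy n (\<sigma>(Suc n := s')) = energy n \<sigma>" by (rule energy_cong) simp
    moreover have "defect U n t (\<sigma>(Suc n := s')) = defect U n t \<sigma>" by (rule defect_cong) simp
    ultimately show ?thesis
      unfolding psi_def energy_Suc defect_Suc F_def inner_add_left U_pair_inner by (simp add: algebra_simps)
  qed
  show ?thesis
  proof (intro exI conjI allI)
    show "2 * c > 0" using c(1) by simp
    show "psi U n t \<sigma> \<tau> + 2 * c * (norm (s' - s0))\<^sup>2 \<le> psi U (Suc n) t (\<sigma>(Suc n := s')) \<tau>" for s'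
      unfolding e using c(2)[of s'] by (simp add: algebra_simps)
    show "psi U (Suc n) t (\<sigma>(Suc n := s0)) \<tau> = psi U n t \<sigma> \<tau>" unfolding e c(3) by simp
  qed
qed

lemma psi_le_Suc:
  assumes "\<tau> \<in> Omega U n"
  shows "psi U n t \<sigma> \<tau> \<le> psi U (Suc n) t \<sigma> \<tau>"
proof -
  obtain s0 c where c: "c > 0" "\<And>s'. psi U n t \<sigma> \<tau> + c * (norm (s' - s0))\<^sup>2 \<le> psi U (Suc n) t (\<sigma>(Suc n := s')) \<tau>"
    using psi_minimum[OF assms] by blast
  have "0 \<le> c * (norm (\<sigma> (Suc n) - s0))\<^sup>2" using c(1) by simp
  then show ?thesis using c(2)[of "\<sigma> (Suc n)"] by simp
qed

lemma psi_mono: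
  assumes "\<tau> \<in> Omega U k" "k \<le> n"
  shows "psi U k t \<sigma> \<tau> \<le> psi U n t \<sigma> \<tau>"
  using assms(2)
proof (induction n rule: dec_induct)
  case (step n)
  have "\<tau> \<in> Omega U n" using Omega_mono[OF step(1)] assms(1) by blast
  then show ?case using psi_le_Suc[of \<tau> n t \<sigma>] step by linarith
qed simp

lemma psi_concave:
  assumes "\<tau>1 \<in> Omega U n" "\<tau>2 \<in> Omega U n" "0 \<le> u" "0 \<le> v" "u + v = 1"
  shows "u * psi U n t \<sigma> \<tau>1 + v * psi U n t \<sigma> \<tau>2 \<le> psi U n t \<sigma> (u *\<^sub>R \<tau>1 + v *\<^sub>R \<tau>2)"
proof -
  have v: "v = 1 - u" using assms by simp
  show ?thesis
    using rho_concave[OF U assms, of "\<sigma> n"] unfolding psi_def inner_add_right inner_scaleR_right v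
    by (simp add: algebra_simps)
qed

text \<open>A finite concave function on an open convex set is continuous. This avoids any
  discussion of how eigenvalues and eigenbases vary with the multiplier.\<close>

lemma continuous_on_psi: "continuous_on (Omega U n) (psi U n t \<sigma>)"
proof -
  have "convex_on (Omega U n) (\<lambda>\<tau>. - psi U n t \<sigma> \<tau>)"
    unfolding convex_on_def
  proof (intro conjI convex_Omega ballI allI impI)
    fix \<tau>1 \<tau>2 and u v :: real
    assume "\<tau>1 \<in> Omega U n" "\<tau>2 \<in> Omega U n" "0 \<le> u" "0 \<le> v" "u + v = 1"
    from psi_concave[OF this, of t \<sigma>]
    show "- psi U n t \<sigma> (u *\<^sub>R \<tau>1 + v *\<^sub>R \<tau>2) \<le> u * - psi U n t \<sigma> \<tau>1 + v * - psi U n t \<sigma> \<tau>2" by simp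
  qed
  from convex_on_continuous[OF open_Omega this] have "continuous_on (Omega U n) (\<lambda>\<tau>. - (- psi U n t \<sigma> \<tau>))"
    by (rule continuous_on_minus)
  then show ?thesis by simp
qed

section \<open>Consequences of linear independence; correction of defects\<close>

lemma T_mat_eq_0:
  assumes "\<And>x. T_mat U \<tau> *v x = 0"
  shows "\<tau> = 0"
proof -
  have "T_mat U \<tau> = 0" using assms matrix_eq[of "T_mat U \<tau>" 0] by simp
  moreover have "T_mat U \<tau> = (\<Sum>j\<in>UNIV. \<tau> $ j *\<^sub>R U j)"
    by (simp add: T_mat_def vec_eq_iff sum_component)
  ultimately have 0: "(\<Sum>j\<in>UNIV. \<tau> $ j *\<^sub>R U j) = 0" by simp
  have inj: "inj U" and ind: "independent (range U)" using U by (auto simp: step_two_data_def)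
  have "(\<Sum>v\<in>range U. (\<tau> $ inv U v) *\<^sub>R v) = 0"
    using 0 inj by (simp add: sum.reindex)
  then have "\<tau> $ inv U (U j) = 0" for j
    by (intro independentD[OF ind, of "range U" "\<lambda>v. \<tau> $ inv U v"]) auto
  then show ?thesis using inj by (simp add: vec_eq_iff)
qed

text \<open>By linear independence \<open>freq U\<close> vanishes only at 0; by homogeneity it then
  dominates the norm times its minimum over the unit sphere.\<close>

lemma Omega_bounded: "\<exists>R>0. \<forall>\<tau>\<in>Omega U k. norm \<tau> \<le> R"
proof -
  have "continuous_on (sphere 0 1) (freq U)" by (rule continuous_on_subset[OF continuous_on_freq]) auto
  then obtain \<theta> where \<theta>: "\<theta> \<in> sphere 0 1" "\<And>\<tau>. \<tau> \<in> sphere 0 1 \<Longrightarrow> freq U \<theta> \<le> freq U \<tau>"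
    using continuous_attains_inf[of "sphere (0::real^'m) 1" "freq U"] by auto
  have pos: "freq U \<theta> > 0"
  proof (rule ccontr)
    assume "\<not> freq U \<theta> > 0"
    then have "freq U \<theta> = 0" using freq_nonneg[of U \<theta>] by simp
    then have "T_mat U \<theta> *v x = 0" for x using norm_T_mat_le[of U \<theta> x] by simp
    then have "\<theta> = 0" by (rule T_mat_eq_0)
    then show False using \<theta>(1) by simp
  qed
  have "norm \<tau> \<le> bessel_zero k 1 / freq U \<theta>" if "\<tau> \<in> Omega U k" for \<tau>
  proof (cases "\<tau> = 0")
    case True
    then show ?thesis using pos bessel_zero_1_pos[of k] by simp
  next
    case False
    have "freq U \<theta> \<le> freq U ((1 / norm \<tau>) *\<^sub>R \<tau>)" using False by (intro \<theta>(2)) simp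
    then have "freq U \<theta> * norm \<tau> \<le> freq U \<tau>" using False by (simp add: freq_scaleR field_simps)
    then show ?thesis using that pos by (simp add: Omega_eq le_divide_eq mult.commute)
  qed
  moreover have "bessel_zero k 1 / freq U \<theta> > 0" using pos bessel_zero_1_pos[of k] by simp
  ultimately show ?thesis by blast
qed

text \<open>The bracket-generating property: a vector orthogonal to all brackets has vanishing
  matrix, hence is 0. Through it every defect can be corrected.\<close>

lemma span_U_pair: "span {U_pair U a b | a b. True} = UNIV"
proof (rule ccontr)
  assume "span {U_pair U a b | a b. True} \<noteq> UNIV"
  then obtain \<tau> where \<tau>: "\<tau> \<noteq> 0" "\<And>y. y \<in> span {U_pair U a b | a b. True} \<Longrightarrow> orthogonal \<tau> y"
    using span_not_UNIV_orthogonal unfolding orthogonal_def by blast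
  have "(T_mat U \<tau> *v x) \<bullet> y = 0" for x y
  proof -
    have "U_pair U x y \<in> {U_pair U a b | a b. True}" by blast
    then have "\<tau> \<bullet> U_pair U x y = 0" by (intro \<tau>(2)[unfolded orthogonal_def] span_base)
    then show ?thesis unfolding U_pair_inner[symmetric] by (simp only: inner_commute)
  qed
  then have "T_mat U \<tau> *v x = 0" for x by (metis inner_eq_zero_iff)
  then show False using T_mat_eq_0 \<tau>(1) by blast
qed

text \<open>The components are appended after a gap, so that they do not interact with \<open>\<sigma> n\<close>.\<close>
lemma append_pair:
  "\<exists>\<sigma>'. (\<forall>j\<le>n. \<sigma>' j = \<sigma> j) \<and> defect U (n + 3) t \<sigma>' = defect U n t \<sigma> + c *\<^sub>R U_pair U a b \<and>
    energy (n + 3) \<sigma>' \<le> energy n \<sigma> + (14 * ((norm a)\<^sup>2 + (norm b)\<^sup>2)) * (real n + 1) * \<bar>c\<bar>"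
proof -
  \<comment> \<open>The defect is bilinear in two neighbouring terms, so each takes a factor sqrt
    |c| and the energy grows only linearly in |c|; the sign of c sits on the second.\<close>
  define \<sigma>' where "\<sigma>' j = (if j \<le> n then \<sigma> j else if j = n + 2 then sqrt \<bar>c\<bar> *\<^sub>R a
     else if j = n + 3 then (sgn c * sqrt \<bar>c\<bar>) *\<^sub>R b else 0)" for j
  have v: "\<sigma>' n = \<sigma> n" "\<sigma>' (Suc n) = 0" "\<sigma>' (Suc (Suc n)) = sqrt \<bar>c\<bar> *\<^sub>R a" "\<sigma>' (Suc (Suc (Suc n))) = (sgn c * sqrt \<bar>c\<bar>) *\<^sub>R b"
    by (auto simp: \<sigma>'_def)
  have n3: "n + 3 = Suc (Suc (Suc n))" by simp
  have d1: "defect U n t \<sigma>' = defect U n t \<sigma>" by (rule defect_cong) (simp add: \<sigma>'_def)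
  have d2: "energy n \<sigma>' = energy n \<sigma>" by (rule energy_cong) (simp add: \<sigma>'_def)
  note d = d1 d2
  have "sgn c * sqrt \<bar>c\<bar> * sqrt \<bar>c\<bar> = sgn c * (sqrt \<bar>c\<bar> * sqrt \<bar>c\<bar>)" by (rule mult.assoc)
  also have "\<dots> = c" by (simp add: sgn_if abs_if)
  finally have e: "sgn c * sqrt \<bar>c\<bar> * sqrt \<bar>c\<bar> = c" .
  have "U_pair U (sqrt \<bar>c\<bar> *\<^sub>R a) ((sgn c * sqrt \<bar>c\<bar>) *\<^sub>R b) = c *\<^sub>R U_pair U a b"
    unfolding U_pair_scaleR_left U_pair_scaleR_right scaleR_scaleR e ..
  then have "defect U (n + 3) t \<sigma>' = defect U n t \<sigma> + c *\<^sub>R U_pair U a b"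
    unfolding n3 defect_Suc v d by simp
  moreover have "energy (n + 3) \<sigma>' \<le> energy n \<sigma> + (14 * ((norm a)\<^sup>2 + (norm b)\<^sup>2)) * (real n + 1) * \<bar>c\<bar>"
  proof -
    have na: "(norm (sqrt \<bar>c\<bar> *\<^sub>R a))\<^sup>2 = \<bar>c\<bar> * (norm a)\<^sup>2" by (simp add: power_mult_distrib)
    have nb: "(norm ((sgn c * sqrt \<bar>c\<bar>) *\<^sub>R b))\<^sup>2 \<le> \<bar>c\<bar> * (norm b)\<^sup>2"
      by (cases "c = 0") (simp_all add: power_mult_distrib abs_mult abs_sgn_eq)
    have "energy (n + 3) \<sigma>' = energy n \<sigma> + 2 * (2 * real (Suc n) + 3) * (\<bar>c\<bar> * (norm a)\<^sup>2)
        + 2 * (2 * real (Suc (Suc n)) + 3) * (norm ((sgn c * sqrt \<bar>c\<bar>) *\<^sub>R b))\<^sup>2"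
      unfolding n3 energy_Suc v d na by simp
    \<comment> \<open>The weights at n + 2 and n + 3 are 4 n + 10 and 4 n + 14, both at most 14 (n +
      1).\<close>
    also have "\<dots> \<le> energy n \<sigma> + (14 * (real n + 1)) * (\<bar>c\<bar> * (norm a)\<^sup>2) + (14 * (real n + 1)) * (\<bar>c\<bar> * (norm b)\<^sup>2)"
    proof -
      have k1: "2 * (2 * real (Suc n) + 3) \<le> 14 * (real n + 1)" and k2: "2 * (2 * real (Suc (Suc n)) + 3) \<le> 14 * (real n + 1)"
        by simp_all
      have "2 * (2 * real (Suc n) + 3) * (\<bar>c\<bar> * (norm a)\<^sup>2) \<le> (14 * (real n + 1)) * (\<bar>c\<bar> * (norm a)\<^sup>2)"
        by (rule mult_right_mono[OF k1]) simp
      moreover have "2 * (2 * real (Suc (Suc n)) + 3) * (norm ((sgn c * sqrt \<bar>c\<bar>) *\<^sub>R b))\<^sup>2 \<le> (14 * (real n + 1)) * (\<bar>c\<bar> * (norm b)\<^sup>2)"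
        by (rule mult_mono[OF k2 nb]) auto
      ultimately show ?thesis by linarith
    qed
    also have "\<dots> = energy n \<sigma> + (14 * ((norm a)\<^sup>2 + (norm b)\<^sup>2)) * (real n + 1) * \<bar>c\<bar>"
      by (simp add: algebra_simps)
    finally show ?thesis .
  qed
  moreover have "\<forall>j\<le>n. \<sigma>' j = \<sigma> j" by (simp add: \<sigma>'_def)
  ultimately show ?thesis by blast
qed

text \<open>Each appended pair moves the last index from N to N + 3, and N + 4 \<le> 4 (N + 1). The
  powers of 4 record that after card B steps the cost is still proportional to n + 1.\<close>

lemma append_combination:
  assumes "finite B" "B \<subseteq> {U_pair U a b | a b. True}"
  shows "\<exists>D\<ge>0. \<forall>c \<sigma> n. \<exists>\<sigma>' N. n \<le> N \<and> (\<forall>j\<le>n. \<sigma>' j = \<sigma> j) \<and> real N + 1 \<le> 4 ^ card B * (real n + 1) \<and>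
    defect U N t \<sigma>' = defect U n t \<sigma> + (\<Sum>b\<in>B. c b *\<^sub>R b) \<and>
    energy N \<sigma>' \<le> energy n \<sigma> + D * (real n + 1) * (\<Sum>b\<in>B. \<bar>c b\<bar>)"
  using assms
proof (induction B rule: finite_induct)
  case empty
  show ?case by (rule exI[of _ 0]) auto
next
  case (insert v B)
  then obtain D where D: "D \<ge> 0" "\<And>c \<sigma> n. \<exists>\<sigma>' N. n \<le> N \<and> (\<forall>j\<le>n. \<sigma>' j = \<sigma> j) \<and> real N + 1 \<le> 4 ^ card B * (real n + 1) \<and>
    defect U N t \<sigma>' = defect U n t \<sigma> + (\<Sum>b\<in>B. c b *\<^sub>R b) \<and>
    energy N \<sigma>' \<le> energy n \<sigma> + D * (real n + 1) * (\<Sum>b\<in>B. \<bar>c b\<bar>)" by auto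
  obtain a b where v: "v = U_pair U a b" using insert.prems by auto
  define G where "G = 14 * ((norm a)\<^sup>2 + (norm b)\<^sup>2)"
  have G: "G \<ge> 0" by (simp add: G_def)
  define D' where "D' = D + G * 4 ^ card B"
  have D': "D' \<ge> 0" "D \<le> D'" "G * 4 ^ card B \<le> D'" using D(1) G by (simp_all add: D'_def)
  show ?case
  proof (intro exI[of _ D'] conjI allI D'(1))
    fix c :: "real^'m \<Rightarrow> real" and \<sigma> :: "nat \<Rightarrow> real^'q" and n
    obtain \<sigma>1 N where 1: "n \<le> N" "\<forall>j\<le>n. \<sigma>1 j = \<sigma> j" "real N + 1 \<le> 4 ^ card B * (real n + 1)"
      "defect U N t \<sigma>1 = defect U n t \<sigma> + (\<Sum>b\<in>B. c b *\<^sub>R b)"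
      "energy N \<sigma>1 \<le> energy n \<sigma> + D * (real n + 1) * (\<Sum>b\<in>B. \<bar>c b\<bar>)"
      using D(2) by blast
    obtain \<sigma>' where 2: "\<forall>j\<le>N. \<sigma>' j = \<sigma>1 j" "defect U (N + 3) t \<sigma>' = defect U N t \<sigma>1 + c v *\<^sub>R v"
      "energy (N + 3) \<sigma>' \<le> energy N \<sigma>1 + G * (real N + 1) * \<bar>c v\<bar>"
      using append_pair[of N \<sigma>1 t "c v" a b] unfolding v[symmetric] G_def[symmetric] by blast
    have card: "card (insert v B) = Suc (card B)" using insert.hyps by simp
    have N4: "real (N + 3) + 1 \<le> 4 ^ card (insert v B) * (real n + 1)"
      using 1(3) unfolding card by simp
    have "defect U (N + 3) t \<sigma>' = defect U n t \<sigma> + (\<Sum>b\<in>insert v B. c b *\<^sub>R b)"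
      unfolding 2(2) 1(4) using insert.hyps by simp
    moreover have "energy (N + 3) \<sigma>' \<le> energy n \<sigma> + D' * (real n + 1) * (\<Sum>b\<in>insert v B. \<bar>c b\<bar>)"
    proof -
      have "G * (real N + 1) * \<bar>c v\<bar> \<le> G * (4 ^ card B * (real n + 1)) * \<bar>c v\<bar>"
        using 1(3) G by (intro mult_right_mono mult_left_mono) auto
      also have "\<dots> = (G * 4 ^ card B) * ((real n + 1) * \<bar>c v\<bar>)" by (simp only: mult.assoc)
      also have "\<dots> \<le> D' * ((real n + 1) * \<bar>c v\<bar>)" using D'(3) by (intro mult_right_mono) auto
      finally have g: "G * (real N + 1) * \<bar>c v\<bar> \<le> D' * ((real n + 1) * \<bar>c v\<bar>)" .
      have d: "D * ((real n + 1) * (\<Sum>b\<in>B. \<bar>c b\<bar>)) \<le> D' * ((real n + 1) * (\<Sum>b\<in>B. \<bar>c b\<bar>))"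
        using D'(2) by (intro mult_right_mono) (auto intro!: mult_nonneg_nonneg sum_nonneg)
      have "(\<Sum>b\<in>insert v B. \<bar>c b\<bar>) = \<bar>c v\<bar> + (\<Sum>b\<in>B. \<bar>c b\<bar>)" using insert.hyps by simp
      then have "D' * (real n + 1) * (\<Sum>b\<in>insert v B. \<bar>c b\<bar>)
          = D' * ((real n + 1) * \<bar>c v\<bar>) + D' * ((real n + 1) * (\<Sum>b\<in>B. \<bar>c b\<bar>))"
      proof -
        have "D' * k * (p + q) = D' * (k * p) + D' * (k * q)" for k p q by (simp add: algebra_simps)
        then show ?thesis unfolding \<open>(\<Sum>b\<in>insert v B. \<bar>c b\<bar>) = _\<close> .
      qed
      then show ?thesis using 1(5) 2(3) g d unfolding mult.assoc[of D] by linarith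
    qed
    moreover have "n \<le> N + 3" "\<forall>j\<le>n. \<sigma>' j = \<sigma> j" using 1(1,2) 2(1) by auto
    ultimately show "\<exists>\<sigma>' N. n \<le> N \<and> (\<forall>j\<le>n. \<sigma>' j = \<sigma> j) \<and> real N + 1 \<le> 4 ^ card (insert v B) * (real n + 1) \<and>
      defect U N t \<sigma>' = defect U n t \<sigma> + (\<Sum>b\<in>insert v B. c b *\<^sub>R b) \<and>
      energy N \<sigma>' \<le> energy n \<sigma> + D' * (real n + 1) * (\<Sum>b\<in>insert v B. \<bar>c b\<bar>)"
      using N4 by blast
  qed
qed

text \<open>Coordinates in a basis of brackets are bounded by a multiple of the norm. The constant
  depends neither on n nor on the sequence, so long sequences are repaired at a cost that grows only
  with the factor n + 1.\<close>

lemma correct_defect: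
  "\<exists>C\<ge>0. \<forall>w \<sigma> n. \<exists>\<sigma>' N. (\<forall>j\<le>n. \<sigma>' j = \<sigma> j) \<and> defect U N t \<sigma>' = defect U n t \<sigma> + w \<and>
    energy N \<sigma>' \<le> energy n \<sigma> + C * (real n + 1) * norm w"
proof -
  obtain B where B: "B \<subseteq> {U_pair U a b | a b. True}" "independent B" "{U_pair U a b | a b. True} \<subseteq> span B"
    by (rule basis_exists)
  have "span {U_pair U a b | a b. True} \<subseteq> span B" using B(3) by (rule span_minimal) (rule subspace_span)
  then have sB: "span B = UNIV" unfolding span_U_pair by blast
  have fin: "finite B" using B(2) by (rule independent_imp_finite)
  obtain D where D: "D \<ge> 0" "\<And>c \<sigma> n. \<exists>\<sigma>' N. n \<le> N \<and> (\<forall>j\<le>n. \<sigma>' j = \<sigma> j) \<and> real N + 1 \<le> 4 ^ card B * (real n + 1) \<and>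
    defect U N t \<sigma>' = defect U n t \<sigma> + (\<Sum>b\<in>B. c b *\<^sub>R b) \<and>
    energy N \<sigma>' \<le> energy n \<sigma> + D * (real n + 1) * (\<Sum>b\<in>B. \<bar>c b\<bar>)"
    using append_combination[OF fin B(1), of t] by auto
  have lin: "linear (\<lambda>w. representation B w b)" for b
    by (rule linearI) (simp_all add: representation_add[OF B(2)] representation_scale[OF B(2)] sB)
  have "\<exists>K. \<forall>w. \<bar>representation B w b\<bar> \<le> K * norm w" for b
    using linear_bounded[OF lin[of b]] by (auto simp: real_norm_def)
  then obtain K where K: "\<And>b w. \<bar>representation B w b\<bar> \<le> K b * norm w" by metis
  define C where "C = D * (\<Sum>b\<in>B. \<bar>K b\<bar>)"
  have C0: "C \<ge> 0" using D(1) by (simp add: C_def sum_nonneg)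
  show ?thesis
  proof (intro exI[of _ C] conjI C0 allI)
    fix w :: "real^'m" and \<sigma> :: "nat \<Rightarrow> real^'q" and n
    obtain \<sigma>' N where s: "\<forall>j\<le>n. \<sigma>' j = \<sigma> j" "defect U N t \<sigma>' = defect U n t \<sigma> + (\<Sum>b\<in>B. representation B w b *\<^sub>R b)"
      "energy N \<sigma>' \<le> energy n \<sigma> + D * (real n + 1) * (\<Sum>b\<in>B. \<bar>representation B w b\<bar>)"
      using D(2)[of n \<sigma> "representation B w"] by blast
    have w: "(\<Sum>b\<in>B. representation B w b *\<^sub>R b) = w"
      by (rule sum_representation_eq[OF B(2) _ fin order_refl]) (simp add: sB)
    have "(\<Sum>b\<in>B. \<bar>representation B w b\<bar>) \<le> (\<Sum>b\<in>B. \<bar>K b\<bar> * norm w)"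
    proof (rule sum_mono)
      fix b
      have "K b * norm w \<le> \<bar>K b\<bar> * norm w" by (intro mult_right_mono) auto
      then show "\<bar>representation B w b\<bar> \<le> \<bar>K b\<bar> * norm w" using K[of w b] by linarith
    qed
    then have "D * (real n + 1) * (\<Sum>b\<in>B. \<bar>representation B w b\<bar>) \<le> D * (real n + 1) * ((\<Sum>b\<in>B. \<bar>K b\<bar>) * norm w)"
      unfolding sum_distrib_right using D(1) by (intro mult_left_mono) auto
    also have "\<dots> = C * (real n + 1) * norm w" by (simp add: C_def mult_ac)
    finally show "\<exists>\<sigma>' N. (\<forall>j\<le>n. \<sigma>' j = \<sigma> j) \<and> defect U N t \<sigma>' = defect U n t \<sigma> + w \<and>
      energy N \<sigma>' \<le> energy n \<sigma> + C * (real n + 1) * norm w"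
      using s unfolding w by (meson add_left_mono order_trans)
  qed
qed

end

section \<open>Comparison of the functionals with the distance\<close>

lemma tuples_nonempty: "tuples k \<noteq> {}"
  by (auto simp: tuples_def PiE_eq_empty_iff)

context
  fixes U :: "'m::finite \<Rightarrow> real^'q^'q"
  assumes U: "step_two_data U"
begin

lemma cc_norm_le_energy:
  assumes s0: "sqrt 2 *\<^sub>R \<sigma> 0 = x" and d: "defect U n t \<sigma> = 0"
  shows "(cc_norm U (x, t))\<^sup>2 \<le> energy n \<sigma>"
proof (rule field_le_epsilon)
  fix \<eta> :: real assume \<eta>: "\<eta> > 0"
  have pos: "energy n \<sigma> + \<eta> > 0" using energy_nonneg[of n \<sigma>] \<eta> by linarith
  \<comment> \<open>The energy may be 0 while \<open>exists_curve\<close> asks for a positive bound,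
    hence the slack \<eta>.\<close>
  define e where "e = sqrt (energy n \<sigma> + \<eta>)"
  have e: "e > 0" "e\<^sup>2 = energy n \<sigma> + \<eta>" using pos by (simp_all add: e_def)
  obtain \<gamma> u where \<gamma>: "horizontal_curve U \<gamma> u" "\<gamma> 0 = (x, t)" "\<gamma> 1 = 0" "integral {0..1} (\<lambda>r. norm (u r)) \<le> e"
    using exists_curve[where \<sigma>=\<sigma> and x=x and t=t and n=n and e=e, OF U s0] d e \<eta> unfolding defect_def energy_def by auto
  let ?A = "{integral {0..1} (\<lambda>r. norm (u r)) |\<gamma> u. horizontal_curve U \<gamma> u \<and> \<gamma> 0 = (x, t) \<and> \<gamma> 1 = 0}"
  have nn: "0 \<le> a" if "a \<in> ?A" for a
    using that by (auto simp: horizontal_curve_def absolutely_integrable_on_def intro!: integral_nonneg)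
  have mem: "integral {0..1} (\<lambda>r. norm (u r)) \<in> ?A" using \<gamma> by blast
  have "Inf ?A \<le> integral {0..1} (\<lambda>r. norm (u r))"
    by (rule cInf_lower[OF mem]) (use nn in \<open>auto intro!: bdd_belowI[of _ 0]\<close>)
  moreover have "0 \<le> Inf ?A" using mem nn by (intro cInf_greatest) auto
  ultimately have "0 \<le> cc_norm U (x, t)" "cc_norm U (x, t) \<le> e"
    using \<gamma>(4) by (auto simp: cc_norm_def cc_dist_def)
  then have "(cc_norm U (x, t))\<^sup>2 \<le> e\<^sup>2" by (intro power_mono)
  then show "(cc_norm U (x, t))\<^sup>2 \<le> energy n \<sigma> + \<eta>" using e by simp
qed

text \<open>Starting from the head alone, the whole of t is treated as a defect to be corrected. The
  infimum in \<open>cc_dist\<close> is thereby over a nonempty set and can be approached.\<close>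

lemma admissible_ex: "\<exists>\<sigma> n. sqrt 2 *\<^sub>R \<sigma> 0 = x \<and> defect U n t \<sigma> = 0"
proof -
  define \<sigma> where "\<sigma> = with_head x (\<lambda>_. 0)"
  obtain C where C: "\<forall>w \<sigma> n. \<exists>\<sigma>' N. (\<forall>j\<le>n. \<sigma>' j = \<sigma> j) \<and> defect U N t \<sigma>' = defect U n t \<sigma> + w \<and>
    energy N \<sigma>' \<le> energy n \<sigma> + C * (real n + 1) * norm w"
    using correct_defect[OF U] by blast
  then obtain \<sigma>' N where s: "\<forall>j\<le>0. \<sigma>' j = \<sigma> j" "defect U N t \<sigma>' = defect U 0 t \<sigma> + (- t)" by meson
  have "defect U N t \<sigma>' = 0" using s(2) by (simp add: defect_def)
  moreover have "sqrt 2 *\<^sub>R \<sigma>' 0 = x" using s(1) by (simp add: \<sigma>_def with_head_def)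
  ultimately show ?thesis by blast
qed

lemma cc_norm_lessD:
  assumes "cc_norm U (x, t) < b"
  shows "\<exists>\<gamma> u. horizontal_curve U \<gamma> u \<and> \<gamma> 0 = (x, t) \<and> \<gamma> 1 = 0 \<and> integral {0..1} (\<lambda>r. norm (u r)) < b"
proof -
  let ?A = "{integral {0..1} (\<lambda>r. norm (u r)) |\<gamma> u. horizontal_curve U \<gamma> u \<and> \<gamma> 0 = (x, t) \<and> \<gamma> 1 = 0}"
  obtain \<sigma> n where \<sigma>: "sqrt 2 *\<^sub>R \<sigma> 0 = x" "defect U n t \<sigma> = 0" using admissible_ex by blast
  have "energy n \<sigma> \<le> (sqrt (energy n \<sigma> + 1))\<^sup>2" "sqrt (energy n \<sigma> + 1) > 0" using energy_nonneg[of n \<sigma>] by simp_all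
  then have "?A \<noteq> {}"
    using exists_curve[where \<sigma>=\<sigma> and x=x and t=t and n=n and e="sqrt (energy n \<sigma> + 1)", OF U \<sigma>(1)] \<sigma>(2) unfolding defect_def energy_def by blast
  then show ?thesis using cInf_lessD[of ?A b] assms unfolding cc_norm_def cc_dist_def by blast
qed

lemma phi_bdd_above: "bdd_above (phi U k (x, t) s ` Omega U k)"
proof -
  obtain R where R: "R > 0" "\<And>\<tau>. \<tau> \<in> Omega U k \<Longrightarrow> norm \<tau> \<le> R" using Omega_bounded[OF U] by blast
  have "phi U k (x, t) s \<tau> \<le> energy k (with_head x s) + 4 * (norm (defect U k t (with_head x s)) * R)" if \<tau>: "\<tau> \<in> Omega U k" for \<tau>
  proof -
    have "defect U k t (with_head x s) \<bullet> \<tau> \<le> norm (defect U k t (with_head x s)) * norm \<tau>" by (rule norm_cauchy_schwarz)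
    also have "\<dots> \<le> norm (defect U k t (with_head x s)) * R" using R(2)[OF \<tau>] by (intro mult_left_mono) auto
    finally show ?thesis using psi_le[OF U \<tau> order_refl, of t "with_head x s"] unfolding phi_eq_psi[OF U \<tau>] by linarith
  qed
  then show ?thesis by (auto intro!: bdd_aboveI2)
qed

lemma phi_le_phi_star: "\<tau> \<in> Omega U k \<Longrightarrow> phi U k (x, t) s \<tau> \<le> phi_star U k (x, t) s"
  unfolding phi_star_def by (rule cSUP_upper[OF _ phi_bdd_above])

lemma phi_star_le: "(\<And>\<tau>. \<tau> \<in> Omega U k \<Longrightarrow> phi U k (x, t) s \<tau> \<le> c) \<Longrightarrow> phi_star U k (x, t) s \<le> c"
  unfolding phi_star_def by (rule cSUP_least) (use zero_in_Omega[of U k] in auto)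

lemma energy_le_phi_star: "energy k (with_head x s) \<le> phi_star U k (x, t) s"
  using phi_le_phi_star[OF zero_in_Omega] unfolding phi_eq_psi[OF U zero_in_Omega] psi_zero[OF U] .

lemma phi_star_nonneg: "0 \<le> phi_star U k (x, t) s"
  using energy_nonneg[of k "with_head x s"] energy_le_phi_star[of k x s t] by linarith

lemma Phi_le: "s \<in> tuples k \<Longrightarrow> Phi U k (x, t) \<le> phi_star U k (x, t) s"
  unfolding Phi_def by (rule cINF_lower[rotated]) (auto intro!: bdd_belowI2 phi_star_nonneg)

lemma Phi_ge: "(\<And>s. s \<in> tuples k \<Longrightarrow> c \<le> phi_star U k (x, t) s) \<Longrightarrow> c \<le> Phi U k (x, t)"
  unfolding Phi_def by (rule cINF_greatest[OF tuples_nonempty])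

lemma Phi_nonneg: "0 \<le> Phi U k (x, t)"
  by (rule Phi_ge) (rule phi_star_nonneg)

lemma psi_with_head_restrict:
  assumes "\<sigma> 0 = (1 / sqrt 2) *\<^sub>R x"
  shows "psi U k t (with_head x (restrict \<sigma> {1..k})) \<tau> = psi U k t \<sigma> \<tau>"
  by (rule psi_cong) (use assms in \<open>auto simp: with_head_def\<close>)

lemma head_eq: "sqrt 2 *\<^sub>R y = x \<longleftrightarrow> y = (1 / sqrt 2) *\<^sub>R (x :: real^'q)"
  by auto

lemma Phi_le_energy:
  assumes s0: "sqrt 2 *\<^sub>R \<sigma> 0 = x" and d: "defect U n t \<sigma> = 0"
  shows "Phi U k (x, t) \<le> energy n \<sigma>"
proof -
  \<comment> \<open>The entries of \<sigma> beyond n are arbitrary. Setting them to 0 lets the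
    sequence be prolonged past k without changing energy or defect; with defect 0 the multiplier
    drops out.\<close>
  define \<sigma>' where "\<sigma>' j = (if j \<le> n then \<sigma> j else 0)" for j
  have ext: "energy (n + m) \<sigma>' = energy n \<sigma> \<and> defect U (n + m) t \<sigma>' = 0" for m
  proof (induction m)
    case 0
    have "energy n \<sigma>' = energy n \<sigma>" by (rule energy_cong) (simp add: \<sigma>'_def)
    moreover have "defect U n t \<sigma>' = defect U n t \<sigma>" by (rule defect_cong) (simp add: \<sigma>'_def)
    ultimately show ?case using d by simp
  next
    case (Suc m)
    have "\<sigma>' (Suc (n + m)) = 0" by (simp add: \<sigma>'_def)
    then show ?case using Suc by (simp add: energy_Suc defect_Suc)
  qed
  let ?s = "restrict \<sigma>' {1..k}"
  have s0': "\<sigma>' 0 = (1 / sqrt 2) *\<^sub>R x" using s0 by (simp add: \<sigma>'_def head_eq)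
  have "Phi U k (x, t) \<le> phi_star U k (x, t) ?s" by (rule Phi_le) (simp add: tuples_def)
  also have "\<dots> \<le> energy n \<sigma>"
  proof (rule phi_star_le)
    fix \<tau> assume \<tau>: "\<tau> \<in> Omega U k"
    have "phi U k (x, t) ?s \<tau> = psi U k t \<sigma>' \<tau>"
      unfolding phi_eq_psi[OF U \<tau>] by (rule psi_with_head_restrict[where \<sigma>=\<sigma>', OF s0'])
    also have "\<dots> \<le> psi U (n + k) t \<sigma>' \<tau>" by (rule psi_mono[OF U \<tau>]) simp
    also have "\<dots> \<le> energy (n + k) \<sigma>' + 4 * (defect U (n + k) t \<sigma>' \<bullet> \<tau>)" by (rule psi_le[OF U \<tau>]) simp
    finally show "phi U k (x, t) ?s \<tau> \<le> energy n \<sigma>" using ext[of k] by simp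
  qed
  finally show ?thesis .
qed

text \<open>The variable t enters only through 4 (t \<bullet> \<tau>) with \<tau> in a bounded set.
  The estimate absorbs the small defect left by \<open>curve_approx\<close>.\<close>

lemma Phi_lipschitz: "\<exists>R>0. \<forall>x t t'. Phi U k (x, t) \<le> Phi U k (x, t') + R * norm (t - t')"
proof -
  obtain R where R: "R > 0" "\<And>\<tau>. \<tau> \<in> Omega U k \<Longrightarrow> norm \<tau> \<le> R" using Omega_bounded[OF U] by blast
  have "Phi U k (x, t) \<le> Phi U k (x, t') + (4 * R) * norm (t - t')" for x t t'
  proof -
    have "Phi U k (x, t) - (4 * R) * norm (t - t') \<le> Phi U k (x, t')"
    proof (rule Phi_ge)
      fix s :: "nat \<Rightarrow> real^'q" assume s: "s \<in> tuples k"
      have "phi_star U k (x, t) s \<le> phi_star U k (x, t') s + (4 * R) * norm (t - t')"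
      proof (rule phi_star_le)
        fix \<tau> assume \<tau>: "\<tau> \<in> Omega U k"
        have "(t - t') \<bullet> \<tau> \<le> norm (t - t') * norm \<tau>" by (rule norm_cauchy_schwarz)
        also have "\<dots> \<le> norm (t - t') * R" using R(2)[OF \<tau>] by (intro mult_left_mono) auto
        finally have "4 * ((t - t') \<bullet> \<tau>) \<le> (4 * R) * norm (t - t')" by (simp add: mult_ac)
        moreover have "phi U k (x, t) s \<tau> = phi U k (x, t') s \<tau> + 4 * ((t - t') \<bullet> \<tau>)"
          unfolding phi_eq_psi[OF U \<tau>] psi_def defect_def by (simp add: inner_add_left inner_diff_left algebra_simps)
        ultimately show "phi U k (x, t) s \<tau> \<le> phi_star U k (x, t') s + (4 * R) * norm (t - t')"
          using phi_le_phi_star[OF \<tau>, of x t' s] by linarith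
      qed
      then show "Phi U k (x, t) - (4 * R) * norm (t - t') \<le> phi_star U k (x, t') s"
        using Phi_le[OF s, of x t] by linarith
    qed
    then show ?thesis by linarith
  qed
  then show ?thesis using R(1) by (intro exI[of _ "4 * R"]) auto
qed

lemma Phi_le_cc_norm: "Phi U k (x, t) \<le> (cc_norm U (x, t))\<^sup>2"
proof (rule ccontr)
  assume "\<not> ?thesis"
  then have less: "(cc_norm U (x, t))\<^sup>2 < Phi U k (x, t)" by simp
  then have "cc_norm U (x, t) < sqrt (Phi U k (x, t))" by (rule real_less_rsqrt)
  then obtain \<gamma> u where \<gamma>: "horizontal_curve U \<gamma> u" "\<gamma> 0 = (x, t)" "\<gamma> 1 = 0"
    "integral {0..1} (\<lambda>r. norm (u r)) < sqrt (Phi U k (x, t))" using cc_norm_lessD by blast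
  then obtain l where l: "integral {0..1} (\<lambda>r. norm (u r)) < l" "l < sqrt (Phi U k (x, t))" using dense by blast
  have "0 \<le> integral {0..1} (\<lambda>r. norm (u r))"
    using \<gamma>(1) by (intro integral_nonneg) (auto simp: horizontal_curve_def absolutely_integrable_on_def)
  then have l0: "0 \<le> l" using l(1) by simp
  obtain R where R: "R > 0" "\<And>x t t'. Phi U k (x, t) \<le> Phi U k (x, t') + R * norm (t - t')" using Phi_lipschitz by blast
  have "Phi U k (x, t) \<le> l\<^sup>2"
  proof (rule field_le_epsilon)
    fix \<eta> :: real assume "\<eta> > 0"
    then have "\<eta> / R > 0" using R(1) by simp
    from curve_approx[OF U \<gamma>(1-3) l(1) this] obtain n \<sigma> where
      s: "sqrt 2 *\<^sub>R \<sigma> 0 = x" "energy n \<sigma> \<le> l\<^sup>2" "norm (defect U n t \<sigma>) < \<eta> / R"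
      unfolding energy_def defect_def by blast
    \<comment> \<open>The target is changed instead of the sequence: \<sigma> satisfies the
      constraint exactly for t'.\<close>
    define t' where "t' = t - defect U n t \<sigma>"
    have "defect U n t' \<sigma> = 0" by (simp add: t'_def defect_def)
    then have "Phi U k (x, t') \<le> l\<^sup>2" using Phi_le_energy[where \<sigma>=\<sigma>, OF s(1)] s(2) by (meson order_trans)
    moreover have "R * norm (t - t') \<le> \<eta>" using s(3) R(1) by (simp add: t'_def pos_less_divide_eq mult.commute)
    ultimately show "Phi U k (x, t) \<le> l\<^sup>2 + \<eta>" using R(2)[of x t t'] by linarith
  qed
  moreover have "l\<^sup>2 < Phi U k (x, t)"
    using power_strict_mono[OF l(2) l0, of 2] Phi_nonneg[of k x t] by simp
  ultimately show False by simp
qed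

lemma Phi_le_Suc: "Phi U k (x, t) \<le> Phi U (Suc k) (x, t)"
proof (rule Phi_ge)
  fix s :: "nat \<Rightarrow> real^'q" assume s: "s \<in> tuples (Suc k)"
  let ?s = "restrict s {1..k}"
  have "Phi U k (x, t) \<le> phi_star U k (x, t) ?s" by (rule Phi_le) (simp add: tuples_def)
  also have "\<dots> \<le> phi_star U (Suc k) (x, t) s"
  proof (rule phi_star_le)
    fix \<tau> assume \<tau>: "\<tau> \<in> Omega U k"
    then have \<tau>': "\<tau> \<in> Omega U (Suc k)" using Omega_mono[of k "Suc k" U] by auto
    have "phi U k (x, t) ?s \<tau> = psi U k t (with_head x s) \<tau>"
      unfolding phi_eq_psi[OF U \<tau>] by (rule psi_cong) (auto simp: with_head_def)
    also have "\<dots> \<le> psi U (Suc k) t (with_head x s) \<tau>" by (rule psi_le_Suc[OF U \<tau>])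
    also have "\<dots> = phi U (Suc k) (x, t) s \<tau>" unfolding phi_eq_psi[OF U \<tau>'] ..
    also have "\<dots> \<le> phi_star U (Suc k) (x, t) s" by (rule phi_le_phi_star[OF \<tau>'])
    finally show "phi U k (x, t) ?s \<tau> \<le> phi_star U (Suc k) (x, t) s" .
  qed
  finally show "Phi U k (x, t) \<le> phi_star U (Suc k) (x, t) s" .
qed

text \<open>The maximality of \<open>\<theta>\<close> is inherited by the next level: the minimisers \<open>s\<^sub>\<epsilon>\<close> at points of the
  segment from \<open>\<theta>\<close> to \<open>\<tau>\<close> converge to the minimiser at \<open>\<theta>\<close> by uniform convexity.\<close>
lemma maximal_Suc:
  assumes kn: "k \<le> n" and \<theta>: "\<theta> \<in> Omega U k" and V: "psi U n t \<sigma> \<theta> = V"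
    and max: "\<And>\<tau>. \<tau> \<in> Omega U k \<Longrightarrow> psi U n t \<sigma> \<tau> \<le> V"
  shows "\<exists>s0. psi U (Suc n) t (\<sigma>(Suc n := s0)) \<theta> = V \<and>
    (\<forall>\<tau>\<in>Omega U k. psi U (Suc n) t (\<sigma>(Suc n := s0)) \<tau> \<le> V)"
proof -
  have On: "\<tau> \<in> Omega U n" "\<tau> \<in> Omega U (Suc n)" if "\<tau> \<in> Omega U k" for \<tau>
    using Omega_mono[OF kn, of U] Omega_mono[of k "Suc n" U] kn that by auto
  define f where "f \<tau> s' = psi U (Suc n) t (\<sigma>(Suc n := s')) \<tau>" for \<tau> s'
  obtain s0 c where c: "c > 0" "\<And>s'. V + c * (norm (s' - s0))\<^sup>2 \<le> f \<theta> s'" "f \<theta> s0 = V"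
    using psi_minimum[OF U On(1)[OF \<theta>], of t \<sigma>] unfolding f_def V by blast
  have "f \<tau> s0 \<le> V" if \<tau>: "\<tau> \<in> Omega U k" for \<tau>
  proof -
    define P where "P = psi U n t \<sigma> \<tau>"
    have fP: "P \<le> f \<tau> s'" for s'
    proof -
      have "psi U n t \<sigma> \<tau> = psi U n t (\<sigma>(Suc n := s')) \<tau>" by (rule psi_cong) simp
      then show ?thesis using psi_le_Suc[OF U On(1)[OF \<tau>], of t "\<sigma>(Suc n := s')"] by (simp add: f_def P_def)
    qed
    have PV: "P \<le> V" unfolding P_def by (rule max[OF \<tau>])
    \<comment> \<open>At most 1/2, so that \<theta> keeps weight at least 1/2 in the convex
      combination.\<close>
    define \<epsilon> where "\<epsilon> m = 1 / (real m + 2)" for m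
    have \<epsilon>: "0 < \<epsilon> m" "\<epsilon> m \<le> 1 / 2" for m by (simp_all add: \<epsilon>_def field_simps)
    have "\<exists>s'. f \<tau> s' \<le> V \<and> c * (norm (s' - s0))\<^sup>2 \<le> 2 * \<epsilon> m * (V - P)" for m
    proof -
      define \<tau>' where "\<tau>' = (1 - \<epsilon> m) *\<^sub>R \<theta> + \<epsilon> m *\<^sub>R \<tau>"
      have e: "0 \<le> 1 - \<epsilon> m" "0 \<le> \<epsilon> m" "1 - \<epsilon> m + \<epsilon> m = 1" using \<epsilon>[of m] by auto
      have \<tau>': "\<tau>' \<in> Omega U k" unfolding \<tau>'_def by (rule convexD[OF convex_Omega \<theta> \<tau> e])
      obtain s' where s': "f \<tau>' s' = psi U n t \<sigma> \<tau>'"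
        using psi_minimum[OF U On(1)[OF \<tau>'], of t \<sigma>] unfolding f_def by blast
      \<comment> \<open>Concavity on the next level, at the s' that is optimal for \<tau>', bounds
        the weighted mean by V. As the value at \<theta> is at least V + c |s' - s0|^2, the value at
        \<tau> is at most V; as that value is at least P, s' is close to s0.\<close>
      have le: "(1 - \<epsilon> m) * f \<theta> s' + \<epsilon> m * f \<tau> s' \<le> V"
        using psi_concave[OF U On(2)[OF \<theta>] On(2)[OF \<tau>] e, of t "\<sigma>(Suc n := s')"] max[OF \<tau>'] s'
        unfolding f_def \<tau>'_def by linarith
      have cn: "0 \<le> c * (norm (s' - s0))\<^sup>2" using c(1) by simp
      have "(1 - \<epsilon> m) * V \<le> (1 - \<epsilon> m) * f \<theta> s'" using c(2)[of s'] cn e(1) by (intro mult_left_mono) auto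
      with le have "\<epsilon> m * f \<tau> s' \<le> \<epsilon> m * V" by (simp add: algebra_simps)
      then have 1: "f \<tau> s' \<le> V" using \<epsilon>(1)[of m] by simp
      have "(1 - \<epsilon> m) * (V + c * (norm (s' - s0))\<^sup>2) \<le> (1 - \<epsilon> m) * f \<theta> s'" using c(2)[of s'] e(1) by (rule mult_left_mono)
      moreover have "\<epsilon> m * P \<le> \<epsilon> m * f \<tau> s'" using fP[of s'] e(2) by (rule mult_left_mono)
      ultimately have "(1 - \<epsilon> m) * (V + c * (norm (s' - s0))\<^sup>2) + \<epsilon> m * P \<le> V" using le by linarith
      then have "(1 - \<epsilon> m) * (c * (norm (s' - s0))\<^sup>2) \<le> \<epsilon> m * (V - P)" by (simp add: algebra_simps)
      moreover have "(1 / 2) * (c * (norm (s' - s0))\<^sup>2) \<le> (1 - \<epsilon> m) * (c * (norm (s' - s0))\<^sup>2)"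
        using \<epsilon>(2)[of m] cn by (intro mult_right_mono) auto
      ultimately have "c * (norm (s' - s0))\<^sup>2 \<le> 2 * \<epsilon> m * (V - P)" by linarith
      with 1 show ?thesis by blast
    qed
    then obtain s where s: "\<And>m. f \<tau> (s m) \<le> V" "\<And>m. c * (norm (s m - s0))\<^sup>2 \<le> 2 * \<epsilon> m * (V - P)" by metis
    have "\<epsilon> \<longlonglongrightarrow> 0"
      unfolding \<epsilon>_def[abs_def] using LIMSEQ_ignore_initial_segment[OF lim_1_over_n, of 2] by (simp add: add.commute)
    then have "(\<lambda>m. 2 * \<epsilon> m * (V - P) / c) \<longlonglongrightarrow> 2 * 0 * (V - P) / c" by (intro tendsto_intros) (use c(1) in auto)
    moreover have "(norm (s m - s0))\<^sup>2 \<le> 2 * \<epsilon> m * (V - P) / c" for m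
      using s(2)[of m] c(1) by (simp add: pos_le_divide_eq mult.commute)
    ultimately have "(\<lambda>m. (norm (s m - s0))\<^sup>2) \<longlonglongrightarrow> 0"
      by (intro tendsto_sandwich[of "\<lambda>_. 0" "\<lambda>m. (norm (s m - s0))\<^sup>2" sequentially "\<lambda>m. 2 * \<epsilon> m * (V - P) / c"]) auto
    then have "(\<lambda>m. sqrt ((norm (s m - s0))\<^sup>2)) \<longlonglongrightarrow> sqrt 0" by (rule tendsto_real_sqrt)
    then have slim: "s \<longlonglongrightarrow> s0" by (simp add: tendsto_norm_zero_iff LIM_zero_iff)
    have "f \<tau> = (\<lambda>s'. energy n \<sigma> + 2 * (2 * real n + 3) * (norm s')\<^sup>2 + 2 * rho U (Suc n) \<tau> s'
        + 4 * ((defect U n t \<sigma> + U_pair U (\<sigma> n) s') \<bullet> \<tau>))"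
    proof
      fix s'
      have "energy n (\<sigma>(Suc n := s')) = energy n \<sigma>" by (rule energy_cong) simp
      moreover have "defect U n t (\<sigma>(Suc n := s')) = defect U n t \<sigma>" by (rule defect_cong) simp
      ultimately show "f \<tau> s' = energy n \<sigma> + 2 * (2 * real n + 3) * (norm s')\<^sup>2 + 2 * rho U (Suc n) \<tau> s'
        + 4 * ((defect U n t \<sigma> + U_pair U (\<sigma> n) s') \<bullet> \<tau>)"
        unfolding f_def psi_def energy_Suc defect_Suc by simp
    qed
    then have "continuous_on UNIV (f \<tau>)"
      by (simp only: inner_add_left U_pair_inner) (intro continuous_intros continuous_rho[OF U])
    then have "(\<lambda>m. f \<tau> (s m)) \<longlonglongrightarrow> f \<tau> s0"
      using slim by (auto simp: continuous_on_eq_continuous_at isCont_def intro: isCont_tendsto_compose)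
    then show "f \<tau> s0 \<le> V" by (rule LIMSEQ_le_const2) (use s(1) in auto)
  qed
  then show ?thesis using c(3) unfolding f_def by blast
qed

text \<open>Every level keeps the same \<theta> and the same set \<open>Omega U k\<close> instead of
  its own larger set. One sequence serves all levels because a new term does not change the lower
  functionals.\<close>

lemma maximal_chain:
  assumes \<theta>: "\<theta> \<in> Omega U k" and V: "psi U k t \<sigma> \<theta> = V"
    and max: "\<And>\<tau>. \<tau> \<in> Omega U k \<Longrightarrow> psi U k t \<sigma> \<tau> \<le> V"
  shows "\<exists>\<sigma>'. \<sigma>' 0 = \<sigma> 0 \<and> (\<forall>j. k \<le> j \<longrightarrow> j \<le> k + m \<longrightarrow> psi U j t \<sigma>' \<theta> = V \<and> (\<forall>\<tau>\<in>Omega U k. psi U j t \<sigma>' \<tau> \<le> V))"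
proof (induction m)
  case 0
  show ?case by (rule exI[of _ \<sigma>]) (use V max in auto)
next
  case (Suc m)
  then obtain \<sigma>' where s: "\<sigma>' 0 = \<sigma> 0"
    "\<And>j. k \<le> j \<Longrightarrow> j \<le> k + m \<Longrightarrow> psi U j t \<sigma>' \<theta> = V \<and> (\<forall>\<tau>\<in>Omega U k. psi U j t \<sigma>' \<tau> \<le> V)" by blast
  obtain s0 where s0: "psi U (Suc (k + m)) t (\<sigma>'(Suc (k + m) := s0)) \<theta> = V"
    "\<forall>\<tau>\<in>Omega U k. psi U (Suc (k + m)) t (\<sigma>'(Suc (k + m) := s0)) \<tau> \<le> V"
    using maximal_Suc[of k "k + m" \<theta> t \<sigma>' V] \<theta> s(2)[of "k + m"] by auto
  let ?s = "\<sigma>'(Suc (k + m) := s0)"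
  show ?case
  proof (intro exI[of _ ?s] conjI allI impI)
    show "?s 0 = \<sigma> 0" using s(1) by simp
    fix j assume j: "k \<le> j" "j \<le> k + Suc m"
    have same: "psi U j t ?s \<tau> = psi U j t \<sigma>' \<tau>" if "j \<le> k + m" for \<tau> by (rule psi_cong) (use that in auto)
    show "psi U j t ?s \<theta> = V"
      using s0(1) s(2)[OF j(1)] same j by (cases "j \<le> k + m") (auto simp: le_Suc_eq)
    show "\<forall>\<tau>\<in>Omega U k. psi U j t ?s \<tau> \<le> V"
      using s0(2) s(2)[OF j(1)] same j by (cases "j \<le> k + m") (auto simp: le_Suc_eq)
  qed
qed

end

section \<open>The minimax\<close>

context
  fixes U :: "'m::finite \<Rightarrow> real^'q^'q"
  assumes U: "step_two_data U"
begin

lemma norm_le_sum_axis: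
  fixes w :: "real^'m"
  shows "norm w \<le> (\<Sum>i\<in>UNIV. \<bar>w \<bullet> axis i 1\<bar>)"
  using norm_le_l1_cart[of w] by (simp add: inner_axis)

text \<open>A step of length \<delta> from the maximiser \<theta> along plus or minus an axis cannot
  raise psi. So the increment of the linear part, 4 defect \<bullet> (\<tau> - \<theta>), is at most
  the drop of 2 rho, which \<open>rho_lower\<close> bounds by a multiple of |sigma_j|^2 uniformly in
  j.\<close>

lemma defect_bound:
  assumes \<theta>: "\<theta> \<in> Omega U k"
  shows "\<exists>C\<ge>0. \<forall>j \<sigma> t V. k \<le> j \<longrightarrow> psi U j t \<sigma> \<theta> = V \<longrightarrow> (\<forall>\<tau>\<in>Omega U k. psi U j t \<sigma> \<tau> \<le> V) \<longrightarrow>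
    norm (defect U j t \<sigma>) \<le> C * (norm (\<sigma> j))\<^sup>2"
proof -
  obtain \<delta> where \<delta>: "\<delta> > 0" "cball \<theta> \<delta> \<subseteq> Omega U k"
    using open_Omega[of U k] \<theta> open_contains_cball by blast
  define p where "p i \<epsilon> = \<theta> + (\<epsilon> * \<delta>) *\<^sub>R axis i (1::real)" for i :: 'm and \<epsilon> :: real
  have p: "p i \<epsilon> \<in> Omega U k" if "\<bar>\<epsilon>\<bar> = 1" for i \<epsilon>
  proof -
    have "dist \<theta> (p i \<epsilon>) = \<delta>" using \<delta>(1) that by (simp add: p_def dist_norm abs_mult)
    then show ?thesis using \<delta>(2) by auto
  qed
  define C where "C = (\<Sum>i\<in>UNIV. \<bar>R_real k ((freq U (p i 1))\<^sup>2)\<bar> + \<bar>R_real k ((freq U (p i (-1)))\<^sup>2)\<bar>)"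
  have C0: "C \<ge> 0" unfolding C_def by (intro sum_nonneg) simp
  have C: "\<bar>R_real k ((freq U (p i \<epsilon>))\<^sup>2)\<bar> \<le> C" if "\<epsilon> = 1 \<or> \<epsilon> = -1" for i \<epsilon>
  proof -
    have "\<bar>R_real k ((freq U (p i 1))\<^sup>2)\<bar> + \<bar>R_real k ((freq U (p i (-1)))\<^sup>2)\<bar> \<le> C"
      unfolding C_def by (rule member_le_sum[of i UNIV "\<lambda>i. \<bar>R_real k ((freq U (p i 1))\<^sup>2)\<bar> + \<bar>R_real k ((freq U (p i (-1)))\<^sup>2)\<bar>"]) auto
    then show ?thesis using that by auto
  qed
  have "norm (defect U j t \<sigma>) \<le> (real CARD('m) * (C / (2 * \<delta>))) * (norm (\<sigma> j))\<^sup>2"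
    if j: "k \<le> j" and V: "psi U j t \<sigma> \<theta> = V" and max: "\<forall>\<tau>\<in>Omega U k. psi U j t \<sigma> \<tau> \<le> V" for j \<sigma> t V
  proof -
    let ?w = "defect U j t \<sigma>"
    have one: "\<epsilon> * (?w \<bullet> axis i 1) \<le> C / (2 * \<delta>) * (norm (\<sigma> j))\<^sup>2" if e: "\<epsilon> = 1 \<or> \<epsilon> = -1" for \<epsilon> i
    proof -
      have pe: "p i \<epsilon> \<in> Omega U k" using p[of \<epsilon> i] e by auto
      have a: "- (C * (norm (\<sigma> j))\<^sup>2) \<le> rho U j (p i \<epsilon>) (\<sigma> j)"
      proof -
        have "- C * (norm (\<sigma> j))\<^sup>2 \<le> R_real k ((freq U (p i \<epsilon>))\<^sup>2) * (norm (\<sigma> j))\<^sup>2"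
          using C[OF e, of i] by (intro mult_right_mono) auto
        then show ?thesis using rho_lower[OF U pe j, of "\<sigma> j"] by linarith
      qed
      have b: "rho U j \<theta> (\<sigma> j) \<le> 0" by (rule rho_nonpos[OF U \<theta> j])
      have "psi U j t \<sigma> (p i \<epsilon>) \<le> psi U j t \<sigma> \<theta>" using max pe V by blast
      have "4 * (?w \<bullet> (p i \<epsilon> - \<theta>)) \<le> 2 * (C * (norm (\<sigma> j))\<^sup>2)"
      proof -
        have "4 * (u - v) \<le> 2 * c" if "E + 2 * p + 4 * u \<le> E + 2 * q + 4 * v" "- c \<le> p" "q \<le> 0" for u v c E p q :: real
          using that by (simp add: right_diff_distrib)
        from this[OF _ a b] show ?thesis using \<open>psi U j t \<sigma> (p i \<epsilon>) \<le> psi U j t \<sigma> \<theta>\<close>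
          unfolding psi_def inner_diff_right by blast
      qed
      then have "2 * \<delta> * (\<epsilon> * (?w \<bullet> axis i 1)) \<le> C * (norm (\<sigma> j))\<^sup>2" by (simp add: p_def mult_ac)
      then show ?thesis using \<delta>(1) by (simp add: pos_le_divide_eq mult.commute)
    qed
    have "\<bar>?w \<bullet> axis i 1\<bar> \<le> C / (2 * \<delta>) * (norm (\<sigma> j))\<^sup>2" for i
      using one[of 1 i] one[of "-1" i] by simp
    then have "(\<Sum>i\<in>UNIV. \<bar>?w \<bullet> axis i 1\<bar>) \<le> (\<Sum>i\<in>(UNIV::'m set). C / (2 * \<delta>) * (norm (\<sigma> j))\<^sup>2)"
      by (intro sum_mono)
    then show ?thesis using norm_le_sum_axis[of ?w] by simp
  qed
  then show ?thesis using C0 \<delta>(1) by (intro exI[of _ "real CARD('m) * (C / (2 * \<delta>))"]) auto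
qed

text \<open>Pigeonhole: the quantities (j + 1) |sigma_j|^2 are dominated by the terms of the energy,
  so they cannot all exceed V / M over a stretch of M + 1 indices.\<close>

lemma small_term:
  assumes "energy (k + M) \<sigma> \<le> V" "M > 0"
  shows "\<exists>j. k \<le> j \<and> j \<le> k + M \<and> (real j + 1) * (norm (\<sigma> j))\<^sup>2 \<le> V / real M"
proof (rule ccontr)
  assume "\<not> ?thesis"
  then have n: "V / real M < (real j + 1) * (norm (\<sigma> j))\<^sup>2" if "k \<le> j" "j \<le> k + M" for j using that by force
  \<comment> \<open>M of the M + 1 indices already add up to V; the index k left over makes the
    inequality strict.\<close>
  have "V = (\<Sum>j\<in>{k<..k + M}. V / real M)" using assms(2) by simp
  also have "\<dots> \<le> (\<Sum>j\<in>{k<..k + M}. (real j + 1) * (norm (\<sigma> j))\<^sup>2)" by (intro sum_mono less_imp_le[OF n]) auto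
  also have "\<dots> < (\<Sum>j\<in>{k..k + M}. (real j + 1) * (norm (\<sigma> j))\<^sup>2)"
  proof -
    have "{k..k + M} = insert k {k<..k + M}" by auto
    moreover have "0 < (real k + 1) * (norm (\<sigma> k))\<^sup>2"
      using n[of k] energy_nonneg[of "k + M" \<sigma>] assms
        divide_nonneg_nonneg[of V "real M"] by (simp del: divide_nonneg_nonneg)
    ultimately show ?thesis by simp
  qed
  also have "\<dots> \<le> (\<Sum>j\<in>{k..k + M}. 2 * (2 * real j + 1) * (norm (\<sigma> j))\<^sup>2)"
    by (intro sum_mono mult_right_mono) auto
  also have "\<dots> \<le> energy (k + M) \<sigma>" unfolding energy_def by (rule sum_mono2) auto
  finally show False using assms(1) by simp
qed

text \<open>Maximality at an interior point \<open>\<theta>\<close> forces the defect of the extended sequence to be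
  quadratically small, so it can be corrected at a cost which tends to \<open>0\<close>.\<close>
lemma minimax_attained:
  assumes s: "Phi U k (x, t) = phi_star U k (x, t) s" "phi_star U k (x, t) s = phi U k (x, t) s \<theta>"
    and \<theta>: "\<theta> \<in> Omega U k"
  shows "(cc_norm U (x, t))\<^sup>2 = Phi U k (x, t)"
proof (rule antisym[OF _ Phi_le_cc_norm[OF U]])
  define V where "V = Phi U k (x, t)"
  have V0: "0 \<le> V" unfolding V_def by (rule Phi_nonneg[OF U])
  let ?\<sigma> = "with_head x s"
  have V: "psi U k t ?\<sigma> \<theta> = V" using s unfolding phi_eq_psi[OF U \<theta>] V_def by simp
  have max: "psi U k t ?\<sigma> \<tau> \<le> V" if "\<tau> \<in> Omega U k" for \<tau>
    using phi_le_phi_star[OF U that, of x t s] s unfolding phi_eq_psi[OF U that] V_def by simp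
  obtain C where C: "C \<ge> 0" "\<And>j \<sigma> t V. k \<le> j \<Longrightarrow> psi U j t \<sigma> \<theta> = V \<Longrightarrow> \<forall>\<tau>\<in>Omega U k. psi U j t \<sigma> \<tau> \<le> V \<Longrightarrow>
    norm (defect U j t \<sigma>) \<le> C * (norm (\<sigma> j))\<^sup>2" using defect_bound[OF \<theta>] by metis
  obtain D where D: "D \<ge> 0" "\<And>w \<sigma> n. \<exists>\<sigma>' N. (\<forall>j\<le>n. \<sigma>' j = \<sigma> j) \<and> defect U N t \<sigma>' = defect U n t \<sigma> + w \<and>
    energy N \<sigma>' \<le> energy n \<sigma> + D * (real n + 1) * norm w"
    using correct_defect[OF U, of t] by auto
  \<comment> \<open>With M = m + 1 extra levels, the selected index has (j + 1) |sigma_j|^2 \<le> V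
    / M. The defect costs a factor C and its repair a factor D (j + 1), and neither constant depends
    on M.\<close>
  have bound: "(cc_norm U (x, t))\<^sup>2 \<le> V + D * C * V * (1 / real (Suc m))" for m
  proof -
    define M where "M = Suc m"
    obtain \<sigma> where \<sigma>: "\<sigma> 0 = ?\<sigma> 0" "\<And>j. k \<le> j \<Longrightarrow> j \<le> k + M \<Longrightarrow> psi U j t \<sigma> \<theta> = V \<and> (\<forall>\<tau>\<in>Omega U k. psi U j t \<sigma> \<tau> \<le> V)"
      using maximal_chain[OF U \<theta> V max, of M] by blast
    have en: "energy j \<sigma> \<le> V" if "k \<le> j" "j \<le> k + M" for j
      using \<sigma>(2)[OF that] zero_in_Omega[of U k] psi_zero[OF U, of j t \<sigma>] by fastforce
    obtain j where j: "k \<le> j" "j \<le> k + M" "(real j + 1) * (norm (\<sigma> j))\<^sup>2 \<le> V / real M"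
      using small_term[of k M \<sigma> V] en[of "k + M"] by (auto simp: M_def)
    have d: "norm (defect U j t \<sigma>) \<le> C * (norm (\<sigma> j))\<^sup>2" using C(2)[of j t \<sigma> V] \<sigma>(2)[OF j(1,2)] j(1) by blast
    obtain \<sigma>' N where s': "\<forall>i\<le>j. \<sigma>' i = \<sigma> i" "defect U N t \<sigma>' = defect U j t \<sigma> + (- defect U j t \<sigma>)"
      "energy N \<sigma>' \<le> energy j \<sigma> + D * (real j + 1) * norm (- defect U j t \<sigma>)" using D(2) by blast
    have "(cc_norm U (x, t))\<^sup>2 \<le> energy N \<sigma>'"
    proof (rule cc_norm_le_energy[OF U])
      show "sqrt 2 *\<^sub>R \<sigma>' 0 = x" using s'(1) \<sigma>(1) by (simp add: with_head_def)
      show "defect U N t \<sigma>' = 0" using s'(2) by simp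
    qed
    also have "\<dots> \<le> V + D * (real j + 1) * norm (defect U j t \<sigma>)" using s'(3) en[OF j(1,2)] by simp
    also have "\<dots> \<le> V + D * (real j + 1) * (C * (norm (\<sigma> j))\<^sup>2)"
      using d D(1) by (intro add_left_mono mult_left_mono) auto
    also have "\<dots> = V + (D * C) * ((real j + 1) * (norm (\<sigma> j))\<^sup>2)" by (simp only: mult_ac)
    also have "\<dots> \<le> V + (D * C) * (V / real M)" using j(3) C(1) D(1) by (intro add_left_mono mult_left_mono) auto
    finally show ?thesis by (simp add: M_def)
  qed
  have "(\<lambda>m. V + D * C * V * (1 / real (Suc m))) \<longlonglongrightarrow> V + D * C * V * 0"
    using LIMSEQ_inverse_real_of_nat by (intro tendsto_intros) (simp add: inverse_eq_divide)
  then have "(cc_norm U (x, t))\<^sup>2 \<le> V + D * C * V * 0"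
    by (rule LIMSEQ_le_const) (use bound in blast)
  then show "(cc_norm U (x, t))\<^sup>2 \<le> Phi U k (x, t)" by (simp add: V_def)
qed

lemma continuous_on_coordinate:
  fixes X :: "(nat \<Rightarrow> 'a::topological_space) set"
  shows "continuous_on X (\<lambda>s. s j)"
  by (rule continuous_on_product_coordinates[THEN continuous_on_subset]) simp

lemma continuous_on_psi_with_head:
  "continuous_on X (\<lambda>s. psi U k t (with_head x s) \<tau>)"
proof -
  have h: "continuous_on X (\<lambda>s. with_head x s j)" for j
    by (cases "j = 0") (simp_all add: with_head_def continuous_on_coordinate)
  have r: "continuous_on X (\<lambda>s. rho U k \<tau> (with_head x s k))"
    by (rule continuous_on_compose2[OF continuous_rho[OF U] h]) auto
  have T: "continuous_on X (\<lambda>s. T_mat U \<tau> *v with_head x s j)" for j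
    by (rule bounded_linear.continuous_on[OF matrix_vector_mul_bounded_linear h])
  show ?thesis
    unfolding psi_def energy_def defect_def inner_add_left inner_sum_left U_pair_inner
    by (intro continuous_intros h r T)
qed

text \<open>The minimiser is found as a common point of nested sublevel sets of phi_star: they are
  closed, being intersections over the multipliers of sublevel sets of continuous functions, and
  bounded because phi_star dominates the energy.\<close>

lemma Phi_attained: "\<exists>s\<in>tuples k. Phi U k (x, t) = phi_star U k (x, t) s"
proof -
  define P where "P = Phi U k (x, t)"
  define r where "r = sqrt (P + 1)"
  \<comment> \<open>Coordinates outside {1..k} are pinned to \<open>undefined\<close>, as in
    extensional tuples, so B is a product of compact sets and Tychonoff's theorem applies. The
    radius r fits all levels P + 1 / (m + 1), since they are at most P + 1.\<close>
  define B where "B = PiE UNIV (\<lambda>j. if j \<in> {1..k} then cball (0::real^'q) r else {undefined})"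
  define K where "K m = {s \<in> B. \<forall>\<tau>\<in>Omega U k. psi U k t (with_head x s) \<tau> \<le> P + 1 / real (Suc m)}" for m
  have "compactin (product_topology (\<lambda>_. euclidean) UNIV) B"
    unfolding B_def compactin_PiE by auto
  then have "compact B" by (simp add: euclidean_product_topology)
  have star: "phi_star U k (x, t) s \<le> c \<longleftrightarrow> (\<forall>\<tau>\<in>Omega U k. psi U k t (with_head x s) \<tau> \<le> c)" for s c
    using phi_star_le[OF U, of k x t s c] phi_le_phi_star[OF U, of _ k x t s] by (force simp: phi_eq_psi[OF U])
  have Bt: "s \<in> tuples k" if "s \<in> B" for s
    using that by (fastforce simp: B_def tuples_def PiE_iff extensional_def split: if_splits)
  have K_ne: "K m \<noteq> {}" for m
  proof -
    have "P < P + 1 / real (Suc m)" by simp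
    then obtain s where s: "s \<in> tuples k" "phi_star U k (x, t) s < P + 1 / real (Suc m)"
      using cInf_lessD[of "phi_star U k (x, t) ` tuples k" "P + 1 / real (Suc m)"] tuples_nonempty
      unfolding P_def Phi_def by auto
    have "1 / real (Suc m) \<le> 1" by simp
    then have e: "energy k (with_head x s) \<le> P + 1"
      using s(2) energy_le_phi_star[OF U, of k x s t] by linarith
    have "s j \<in> cball 0 r" if j: "j \<in> {1..k}" for j
    proof -
      have "(norm (with_head x s j))\<^sup>2 \<le> P + 1" using energy_term_le[of j k "with_head x s"] e j by simp
      then have "norm (s j) \<le> r" unfolding r_def using j by (intro real_le_rsqrt) (auto simp: with_head_def)
      then show ?thesis by simp
    qed
    then have "s \<in> B" using s(1) by (auto simp: B_def tuples_def PiE_iff extensional_def)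
    then show "K m \<noteq> {}" using s(2) star[of s "P + 1 / real (Suc m)"] by (auto simp: K_def)
  qed
  have K_anti: "K n \<subseteq> K m" if "m \<le> n" for m n
  proof -
    have "P + 1 / real (Suc n) \<le> P + 1 / real (Suc m)" using that by (simp add: frac_le)
    then show ?thesis unfolding K_def by fastforce
  qed
  have closed: "closed (\<Inter>\<tau>\<in>Omega U k. {s. psi U k t (with_head x s) \<tau> \<le> P + 1 / real (Suc m)})" for m
    by (intro closed_INT ballI closed_Collect_le continuous_on_psi_with_head continuous_on_const)
  have K: "K m = B \<inter> (\<Inter>\<tau>\<in>Omega U k. {s. psi U k t (with_head x s) \<tau> \<le> P + 1 / real (Suc m)})" for m
    by (auto simp: K_def)
  have "B \<inter> (\<Inter>m\<in>UNIV. \<Inter>\<tau>\<in>Omega U k. {s. psi U k t (with_head x s) \<tau> \<le> P + 1 / real (Suc m)}) \<noteq> {}"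
  proof (rule compact_imp_fip_image[OF \<open>compact B\<close> closed])
    fix I :: "nat set" assume "finite I"
    then obtain N where N: "\<And>m. m \<in> I \<Longrightarrow> m \<le> N" by (meson finite_nat_set_iff_bounded_le)
    obtain s where "s \<in> K N" using K_ne by blast
    then have "s \<in> K m" if "m \<in> I" for m using K_anti[OF N[OF that]] by blast
    moreover have "s \<in> B" using \<open>s \<in> K N\<close> by (simp add: K_def)
    ultimately show "B \<inter> (\<Inter>m\<in>I. \<Inter>\<tau>\<in>Omega U k. {s. psi U k t (with_head x s) \<tau> \<le> P + 1 / real (Suc m)}) \<noteq> {}"
      unfolding K by blast
  qed
  then obtain s where s: "\<And>m. s \<in> K m" unfolding K by blast
  have "phi_star U k (x, t) s \<le> P + 1 / real (Suc m)" for m using s[of m] star by (simp add: K_def)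
  moreover have "(\<lambda>m. P + 1 / real (Suc m)) \<longlonglongrightarrow> P + 0"
    using LIMSEQ_inverse_real_of_nat by (intro tendsto_intros) (simp add: inverse_eq_divide)
  ultimately have "phi_star U k (x, t) s \<le> P + 0" by (intro LIMSEQ_le_const[of _ "P + 0"]) auto
  moreover have "s \<in> tuples k" using Bt s[of 0] by (simp add: K_def)
  ultimately show ?thesis using Phi_le[OF U, of s k x t] by (auto simp: P_def intro!: bexI[of _ s])
qed

text \<open>A minimiser of level k + 1, cut to its first k entries, competes at level k. Since psi
  grows with the level on \<open>Omega U k\<close>, the value \<open>Phi U k\<close> is at most the
  maximum of the next psi over the closure, and equality of the two values makes this maximum a
  supremum over all of \<open>Omega U (Suc k)\<close>.\<close>

lemma equality_attained:
  assumes eq: "Phi U k (x, t) = Phi U (Suc k) (x, t)"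
  shows "\<exists>s\<in>tuples (Suc k). \<exists>\<theta>\<in>closure (Omega U k). Phi U (Suc k) (x, t) = phi_star U (Suc k) (x, t) s \<and>
    phi_star U (Suc k) (x, t) s = phi U (Suc k) (x, t) s \<theta>"
proof -
  obtain s where s: "s \<in> tuples (Suc k)" "Phi U (Suc k) (x, t) = phi_star U (Suc k) (x, t) s"
    using Phi_attained by blast
  let ?\<sigma> = "with_head x s"
  have sub: "closure (Omega U k) \<subseteq> Omega U (Suc k)" by (rule closure_Omega_subset)
  obtain R where R: "\<And>\<tau>. \<tau> \<in> Omega U k \<Longrightarrow> norm \<tau> \<le> R" using Omega_bounded[OF U] by blast
  then have comp: "compact (closure (Omega U k))" by (auto simp: compact_closure bounded_iff)
  have cont: "continuous_on (closure (Omega U k)) (psi U (Suc k) t ?\<sigma>)"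
    by (rule continuous_on_subset[OF continuous_on_psi[OF U] sub])
  have ne: "closure (Omega U k) \<noteq> {}" using zero_in_Omega[of U k] by auto
  obtain \<theta> where \<theta>: "\<theta> \<in> closure (Omega U k)"
    "\<And>\<tau>. \<tau> \<in> closure (Omega U k) \<Longrightarrow> psi U (Suc k) t ?\<sigma> \<tau> \<le> psi U (Suc k) t ?\<sigma> \<theta>"
    using continuous_attains_sup[OF comp ne cont] by blast
  have \<theta>': "\<theta> \<in> Omega U (Suc k)" using \<theta>(1) sub by blast
  have "Phi U k (x, t) \<le> phi_star U k (x, t) (restrict s {1..k})"
    by (rule Phi_le[OF U]) (simp add: tuples_def)
  also have "\<dots> \<le> psi U (Suc k) t ?\<sigma> \<theta>"
  proof (rule phi_star_le[OF U])
    fix \<tau> assume \<tau>: "\<tau> \<in> Omega U k"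
    have "phi U k (x, t) (restrict s {1..k}) \<tau> = psi U k t ?\<sigma> \<tau>"
      unfolding phi_eq_psi[OF U \<tau>] by (rule psi_cong) (auto simp: with_head_def)
    also have "\<dots> \<le> psi U (Suc k) t ?\<sigma> \<tau>" by (rule psi_le_Suc[OF U \<tau>])
    also have "\<dots> \<le> psi U (Suc k) t ?\<sigma> \<theta>" using \<theta>(2) \<tau> closure_subset by blast
    finally show "phi U k (x, t) (restrict s {1..k}) \<tau> \<le> psi U (Suc k) t ?\<sigma> \<theta>" .
  qed
  finally have "phi_star U (Suc k) (x, t) s \<le> phi U (Suc k) (x, t) s \<theta>"
    unfolding phi_eq_psi[OF U \<theta>'] using eq s(2) by simp
  then have "phi_star U (Suc k) (x, t) s = phi U (Suc k) (x, t) s \<theta>"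
    using phi_le_phi_star[OF U \<theta>', of x t s] by linarith
  then show ?thesis using s \<theta>(1) by blast
qed

end

theorem theorem2p3:
  fixes U :: "'m::finite \<Rightarrow> real^'q::finite^'q"
    and k :: nat
    and g :: "('q, 'm) grp"
  assumes "step_two_data U"
  shows "(cc_norm U g)\<^sup>2 \<ge> Phi U k g \<and>
    ((\<exists>s\<in>tuples k. \<exists>\<theta>\<in>Omega U k.
        Phi U k g = phi_star U k g s \<and> phi_star U k g s = phi U k g s \<theta>)
      \<longrightarrow> (cc_norm U g)\<^sup>2 = Phi U k g) \<and>
    Phi U k g \<le> Phi U (Suc k) g \<and>
    (Phi U k g = Phi U (Suc k) g \<longrightarrow>
      (\<exists>s\<in>tuples (Suc k). \<exists>\<theta>\<in>closure (Omega U k).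
        Phi U (Suc k) g = phi_star U (Suc k) g s \<and>
        phi_star U (Suc k) g s = phi U (Suc k) g s \<theta>) \<and>
      (cc_norm U g)\<^sup>2 = Phi U k g \<and> Phi U k g = Phi U (Suc k) g)"
proof -
  obtain x t where g: "g = (x, t)" by (cases g)
  have c: "(cc_norm U g)\<^sup>2 = Phi U n g"
    if "Phi U n g = phi_star U n g s" "phi_star U n g s = phi U n g s \<theta>" "\<theta> \<in> Omega U n" for n s \<theta>
    using minimax_attained[OF assms] that unfolding g by blast
  have d: "(\<exists>s\<in>tuples (Suc k). \<exists>\<theta>\<in>closure (Omega U k). Phi U (Suc k) g = phi_star U (Suc k) g s \<and>
      phi_star U (Suc k) g s = phi U (Suc k) g s \<theta>) \<and> (cc_norm U g)\<^sup>2 = Phi U k g \<and> Phi U k g = Phi U (Suc k) g"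
    if eq: "Phi U k g = Phi U (Suc k) g"
  proof -
    obtain s \<theta> where s: "s \<in> tuples (Suc k)" "\<theta> \<in> closure (Omega U k)"
      "Phi U (Suc k) g = phi_star U (Suc k) g s" "phi_star U (Suc k) g s = phi U (Suc k) g s \<theta>"
      using equality_attained[OF assms] eq unfolding g by blast
    \<comment> \<open>A multiplier on the boundary at level k is interior at level k + 1, so the
      attained minimax there identifies the distance.\<close>
    have "\<theta> \<in> Omega U (Suc k)" using s(2) closure_Omega_subset by blast
    from c[OF s(3,4) this] show ?thesis using s eq by (intro conjI bexI[of _ s] bexI[of _ \<theta>]) auto
  qed
  show ?thesis
    using Phi_le_cc_norm[OF assms, of k x t] Phi_le_Suc[OF assms, of k x t] c d unfolding g by blast
qed

end
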